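(* Let $a,b$ be integers with $b\neq 0$, $d=a/b\neq 0$, $|a-b|\neq 1$ and $\gcd(a,b)=1$. Then for every compact set $K\subset D$ and every $\varepsilon>0$, we have \[ \liminf_{T\to\infty}\frac{1}{T}\,\mu\Bigl\{\tau\in[0,T] : \sup_{s\in K}\bigl|\zeta(s+i\tau)-\zeta(s+id\tau)\bigr|<\varepsilon\Bigr\}>0 . \]
   Context: $\zeta(s)$ is the Riemann zeta function. $D:=\{s\in\mathbb{C}: 1/2<\Re(s)<1\}$. $\mu\{A\}$ denotes the Lebesgue measure of a measurable set $A\subset\mathbb{R}$. *)

theory Defs
  imports "HOL-Complex_Analysis.Complex_Analysis"
begin

text \<open>
  \<open>is_zeta f\<close>: \<open>f\<close> is the analytic continuation to \<open>\<complex> - {1}\<close> of the Dirichlet series of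
  \<open>n\<close> to the power \<open>- s\<close>, \<open>n \<ge> 1\<close>. The value at the pole \<open>1\<close> is a dummy that makes \<open>f\<close>
  unique as a total function.
\<close>
definition is_zeta :: "(complex \<Rightarrow> complex) \<Rightarrow> bool" where
  "is_zeta f \<longleftrightarrow> f holomorphic_on (- {1}) \<and>
     (\<forall>s. Re s > 1 \<longrightarrow> (\<lambda>n. of_nat (Suc n) powr (- s)) sums f s) \<and> f 1 = 0"

definition riemann_zeta :: "complex \<Rightarrow> complex" where
  "riemann_zeta = (THE f. is_zeta f)"

definition strip_D :: "complex set" where
  "strip_D = {s. 1 / 2 < Re s \<and> Re s < 1}"

text \<open>
  The rest of this theory shows that the description of \<open>riemann_zeta\<close> is proper, by
  Euler--Maclaurin summation: integrating by parts \<open>k\<close> times against antiderivatives \<open>p\<close> of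
  mean zero on the unit interval extends the series to \<open>Re s > 1 - k\<close>.
\<close>

definition em_term :: "(real \<Rightarrow> complex) \<Rightarrow> nat \<Rightarrow> nat \<Rightarrow> complex \<Rightarrow> complex" where
  "em_term p k n s = integral {0..1} (\<lambda>t. p t * of_real (real (Suc n) + t) powr (- s - of_nat k))"

lemma of_nat_plus_nz: "0 \<le> t \<Longrightarrow> 1 + of_nat n + complex_of_real t \<noteq> 0"
  by (simp add: complex_eq_iff)

lemma em_cont:
  fixes p :: "real \<Rightarrow> complex"
  assumes "continuous_on {0..1} p"
  shows "continuous_on {0..1::real} (\<lambda>t. p t * of_real (real (Suc n) + t) powr z)"
  using assms by (auto intro!: continuous_intros simp: complex_nonpos_Reals_iff of_nat_plus_nz)

lemma em_term_holomorphic: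
  assumes p: "continuous_on {0..1} p"
  shows "em_term p k n holomorphic_on UNIV"
proof -
  have "(\<lambda>s. integral (cbox 0 1) (\<lambda>t. p t * of_real (real (Suc n) + t) powr (- s - of_nat k))) holomorphic_on UNIV"
  proof (rule leibniz_rule_holomorphic)
    fix s :: complex and t :: real assume t: "t \<in> cbox 0 1"
    hence "complex_of_real (real (Suc n) + t) \<noteq> 0" using of_nat_plus_nz[of t n] by simp
    thus "((\<lambda>s. p t * of_real (real (Suc n) + t) powr (- s - of_nat k)) has_field_derivative
        p t * (- (of_real (real (Suc n) + t) powr (- s - of_nat k) * Ln (of_real (real (Suc n) + t))))) (at s within UNIV)"
      by (auto intro!: derivative_eq_intros simp: powr_def)
  next
    fix s :: complex
    show "(\<lambda>t. p t * of_real (real (Suc n) + t) powr (- s - of_nat k)) integrable_on cbox 0 1"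
      using em_cont[OF p] by (auto intro!: integrable_continuous_real)
  next
    have "continuous_on (UNIV \<times> {0..1::real}) (\<lambda>x. p (snd x))"
      by (rule continuous_on_compose2[OF p]) (auto intro!: continuous_intros)
    thus "continuous_on (UNIV \<times> cbox 0 1) (\<lambda>(s, t). p t * (- (of_real (real (Suc n) + t) powr (- s - of_nat k) * Ln (of_real (real (Suc n) + t)))))"
      unfolding case_prod_unfold
      by (auto intro!: continuous_intros simp: complex_nonpos_Reals_iff of_nat_plus_nz)
  qed auto
  thus ?thesis unfolding em_term_def[abs_def] by simp
qed

lemma em_term_bound:
  assumes p: "continuous_on {0..1} p" and B: "\<And>t. t \<in> {0..1} \<Longrightarrow> norm (p t) \<le> B"
    and s: "Re s + real k \<ge> r" "r \<ge> 0"
  shows "norm (em_term p k n s) \<le> B * real (Suc n) powr (- r)"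
proof -
  have B0: "B \<ge> 0" using B[of 0] norm_ge_zero[of "p 0"] by (simp del: norm_ge_zero)
  have "norm (em_term p k n s) \<le> (B * real (Suc n) powr (- r)) * (1 - 0)"
    unfolding em_term_def
  proof (rule integral_bound)
    fix t :: real assume t: "t \<in> {0..1}"
    have "norm (of_real (real (Suc n) + t) powr (- s - of_nat k) :: complex) = (real (Suc n) + t) powr (- (Re s + real k))"
      using t by (subst norm_powr_real_powr) auto
    also have "\<dots> \<le> real (Suc n) powr (- (Re s + real k))"
      using t s by (intro powr_mono2') auto
    also have "\<dots> \<le> real (Suc n) powr (- r)" using s by (intro powr_mono) auto
    finally show "norm (p t * of_real (real (Suc n) + t) powr (- s - of_nat k)) \<le> B * real (Suc n) powr (- r)"
      unfolding norm_mult using B[OF t] B0 by (intro mult_mono) auto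
  qed (use em_cont[OF p] in auto)
  thus ?thesis by simp
qed

lemma summable_Suc_powr: "r > 1 \<Longrightarrow> summable (\<lambda>n. B * real (Suc n) powr (- r))"
  by (intro summable_mult, subst summable_Suc_iff[where f = "\<lambda>n. real n powr (- r)"]) (simp add: summable_real_powr_iff)

lemma em_bounded:
  assumes "continuous_on {0..1::real} (p :: real \<Rightarrow> complex)"
  obtains B where "\<And>t. t \<in> {0..1} \<Longrightarrow> norm (p t) \<le> B"
  using compact_imp_bounded[OF compact_continuous_image[OF assms]] unfolding bounded_iff by blast

lemma em_summable:
  assumes p: "continuous_on {0..1} p" and s: "Re s + real k > 1"
  shows "summable (\<lambda>n. em_term p k n s)"
proof -
  obtain B where B: "\<And>t. t \<in> {0..1} \<Longrightarrow> norm (p t) \<le> B" using em_bounded[OF p] by metis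
  show ?thesis
    by (rule summable_comparison_test'[OF summable_Suc_powr[OF s, of B]])
       (rule em_term_bound[OF p B], use s in auto)
qed

lemma em_holomorphic:
  assumes p: "continuous_on {0..1} p"
  shows "(\<lambda>s. \<Sum>n. em_term p k n s) holomorphic_on {s. Re s > 1 - real k}"
proof (rule holomorphic_uniform_sequence)
  show "open {s. Re s > 1 - real k}" by (rule open_halfspace_Re_gt)
  show "(\<lambda>s. \<Sum>n<N. em_term p k n s) holomorphic_on {s. Re s > 1 - real k}" for N
    by (intro holomorphic_on_sum holomorphic_on_subset[OF em_term_holomorphic[OF p]]) auto
  fix s assume "s \<in> {s. Re s > 1 - real k}"
  hence s: "Re s + real k > 1" by auto
  obtain B where B: "\<And>t. t \<in> {0..1} \<Longrightarrow> norm (p t) \<le> B" using em_bounded[OF p] by metis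
  define e where "e = (Re s + real k - 1) / 2"
  have e: "e > 0" using s by (simp add: e_def)
  have *: "Re z + real k \<ge> 1 + e" if "z \<in> cball s e" for z
    using abs_Re_le_cmod[of "s - z"] that by (auto simp: dist_norm e_def field_simps)
  have "cball s e \<subseteq> {s. Re s > 1 - real k}" using * e by fastforce
  moreover have "uniform_limit (cball s e) (\<lambda>N s. \<Sum>n<N. em_term p k n s) (\<lambda>s. \<Sum>n. em_term p k n s) sequentially"
    by (rule Weierstrass_m_test[OF _ summable_Suc_powr[of "1 + e" B]])
       (use em_term_bound[OF p B *] e in auto)
  ultimately show "\<exists>d>0. cball s d \<subseteq> {s. Re s > 1 - real k} \<and>
     uniform_limit (cball s d) (\<lambda>N s. \<Sum>n<N. em_term p k n s) (\<lambda>s. \<Sum>n. em_term p k n s) sequentially"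
    using e by blast
qed

lemma em_by_parts:
  assumes p: "continuous_on {0..1} p"
    and q: "\<And>t. t \<in> {0..1} \<Longrightarrow> (q has_vector_derivative p t) (at t within {0..1})"
  shows "em_term p k n s = q 1 * of_nat (Suc (Suc n)) powr (- s - of_nat k)
     - q 0 * of_nat (Suc n) powr (- s - of_nat k) + (s + of_nat k) * em_term q (Suc k) n s"
proof -
  let ?z = "- s - of_nat k"
  let ?g = "\<lambda>t. complex_of_real (real (Suc n) + t) powr ?z"
  let ?g' = "\<lambda>t. ?z * complex_of_real (real (Suc n) + t) powr (?z - 1)"
  have cq: "continuous_on {0..1} q" by (rule continuous_on_vector_derivative) (rule q)
  have g: "(?g has_vector_derivative ?g' t) (at t within {0..1})" if "t \<in> {0..1}" for t
  proof -
    have "((\<lambda>w. (of_nat (Suc n) + w) powr ?z) has_field_derivative ?z * (of_nat (Suc n) + of_real t) powr (?z - 1)) (at (complex_of_real t))"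
      using that by (auto intro!: derivative_eq_intros simp: complex_nonpos_Reals_iff)
    from has_vector_derivative_real_field[OF this] show ?thesis
      by (simp add: has_vector_derivative_at_within)
  qed
  have "((\<lambda>t. q t * ?g' t + p t * ?g t) has_integral (q 1 * ?g 1 - q 0 * ?g 0)) {0..1}"
    by (rule fundamental_theorem_of_calculus)
       (use has_vector_derivative_mult[OF q g] in \<open>auto simp del: of_nat_Suc of_real_add\<close>)
  moreover have "((\<lambda>t. - (s + of_nat k) * (q t * complex_of_real (real (Suc n) + t) powr (- s - of_nat (Suc k)))) has_integral
      (- (s + of_nat k) * em_term q (Suc k) n s)) {0..1}"
    unfolding em_term_def
    by (intro has_integral_mult_right integrable_integral integrable_continuous_real em_cont cq)
  hence "((\<lambda>t. q t * ?g' t) has_integral (- (s + of_nat k) * em_term q (Suc k) n s)) {0..1}"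
    by (simp add: algebra_simps)
  ultimately have "((\<lambda>t. q t * ?g' t + p t * ?g t - q t * ?g' t) has_integral
      (q 1 * ?g 1 - q 0 * ?g 0 - (- (s + of_nat k) * em_term q (Suc k) n s))) {0..1}"
    by (rule has_integral_diff)
  hence "((\<lambda>t. p t * ?g t) has_integral
      (q 1 * ?g 1 - q 0 * ?g 0 + (s + of_nat k) * em_term q (Suc k) n s)) {0..1}"
    by (simp only: add_diff_cancel_left' mult_minus_left diff_minus_eq_add)
  from integral_unique[OF this] show ?thesis unfolding em_term_def[of p] by (simp add: add_ac)
qed

lemma Suc_powr_tendsto_0:
  assumes "Re z < 0"
  shows "(\<lambda>n. complex_of_nat (Suc n) powr z) \<longlonglongrightarrow> 0"
proof (rule tendsto_norm_zero_cancel)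
  have "(\<lambda>n. real (Suc n) powr Re z) \<longlonglongrightarrow> 0"
    using assms by (intro tendsto_neg_powr filterlim_compose[OF filterlim_real_sequentially filterlim_Suc]) auto
  moreover have "norm (complex_of_nat (Suc n) powr z) = real (Suc n) powr Re z" for n
    by (subst norm_powr_real_powr) (auto simp del: of_nat_Suc)
  ultimately show "(\<lambda>n. norm (complex_of_nat (Suc n) powr z)) \<longlonglongrightarrow> 0" by simp
qed

lemma Suc_powr_telescope:
  assumes "Re z < 0"
  shows "(\<lambda>n. complex_of_nat (Suc (Suc n)) powr z - of_nat (Suc n) powr z) sums (- 1)"
  using telescope_sums[OF Suc_powr_tendsto_0[OF assms]] by simp

lemma em_step:
  assumes p: "continuous_on {0..1} p"
    and q: "\<And>t. t \<in> {0..1} \<Longrightarrow> (q has_vector_derivative p t) (at t within {0..1})"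
    and "q 1 = q 0" and s: "Re s > 1"
  shows "(\<Sum>n. em_term p k n s) = - q 0 + (s + of_nat k) * (\<Sum>n. em_term q (Suc k) n s)"
proof -
  have cq: "continuous_on {0..1} q" by (rule continuous_on_vector_derivative) (rule q)
  have "(\<lambda>n. q 0 * (complex_of_nat (Suc (Suc n)) powr (- s - of_nat k) - of_nat (Suc n) powr (- s - of_nat k))
      + (s + of_nat k) * em_term q (Suc k) n s) sums (q 0 * (- 1) + (s + of_nat k) * (\<Sum>n. em_term q (Suc k) n s))"
    using s by (intro sums_add sums_mult Suc_powr_telescope summable_sums em_summable cq) auto
  moreover have "em_term p k n s = q 0 * (complex_of_nat (Suc (Suc n)) powr (- s - of_nat k) - of_nat (Suc n) powr (- s - of_nat k))
      + (s + of_nat k) * em_term q (Suc k) n s" for n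
    by (subst em_by_parts[OF p q]) (use assms(3) in \<open>auto simp: algebra_simps\<close>)
  ultimately show ?thesis by (simp add: sums_iff)
qed

lemma em_base:
  assumes s: "Re s > 1"
  shows "(\<lambda>n. complex_of_nat (Suc n) powr (- s)) sums
           (1 / (s - 1) + 1 / 2 + (- s) * (\<Sum>n. em_term (\<lambda>t. of_real t - 1 / 2) 1 n s))"
proof -
  let ?q = "\<lambda>t::real. complex_of_real t - 1 / 2"
  have s1: "s \<noteq> 1" using s by auto
  have 1: "em_term (\<lambda>_. 1) 0 n s = 1 / 2 * (of_nat (Suc (Suc n)) powr (- s) + of_nat (Suc n) powr (- s))
     + s * em_term ?q 1 n s" for n
  proof -
    have "(?q has_vector_derivative 1) (at t within {0..1})" for t
      by (auto intro!: derivative_eq_intros)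
    from em_by_parts[of "\<lambda>_. 1" ?q 0 n s, OF _ this] show ?thesis by (simp add: algebra_simps)
  qed
  have 2: "em_term (\<lambda>_. 1) 0 n s = (of_nat (Suc (Suc n)) powr (1 - s) - of_nat (Suc n) powr (1 - s)) / (1 - s)" for n
  proof -
    have "em_term (\<lambda>_. 0) 0 n (s - 1) = of_nat (Suc (Suc n)) powr (1 - s) - of_nat (Suc n) powr (1 - s) + (s - 1) * em_term (\<lambda>_. 1) 1 n (s - 1)"
      using em_by_parts[of "\<lambda>_. 0" "\<lambda>_. 1" 0 n "s - 1"] by simp
    moreover have "em_term (\<lambda>_. 0) 0 n (s - 1) = 0" "em_term (\<lambda>_. 1) 1 n (s - 1) = em_term (\<lambda>_. 1) 0 n s"
      by (simp_all add: em_term_def)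
    ultimately have "(1 - s) * em_term (\<lambda>_. 1) 0 n s = of_nat (Suc (Suc n)) powr (1 - s) - of_nat (Suc n) powr (1 - s)"
      by (simp add: algebra_simps)
    thus ?thesis using s1 by (simp add: field_simps)
  qed
  have A: "(\<lambda>n. em_term (\<lambda>_. 1) 0 n s) sums (- 1 / (1 - s))"
    unfolding 2 by (intro sums_divide Suc_powr_telescope) (use s in auto)
  have B: "(\<lambda>n. em_term ?q 1 n s) sums (\<Sum>n. em_term ?q 1 n s)"
    by (intro summable_sums em_summable) (use s in \<open>auto intro!: continuous_intros\<close>)
  have "(\<lambda>n. em_term (\<lambda>_. 1) 0 n s - s * em_term ?q 1 n s
      - 1 / 2 * (of_nat (Suc (Suc n)) powr (- s) - of_nat (Suc n) powr (- s)))
     sums (- 1 / (1 - s) - s * (\<Sum>n. em_term ?q 1 n s) - 1 / 2 * (- 1))"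
    by (intro sums_diff A B sums_mult Suc_powr_telescope) (use s in auto)
  moreover have "em_term (\<lambda>_. 1) 0 n s - s * em_term ?q 1 n s
      - 1 / 2 * (of_nat (Suc (Suc n)) powr (- s) - of_nat (Suc n) powr (- s)) = of_nat (Suc n) powr (- s)" for n
    unfolding 1 by (simp add: algebra_simps)
  moreover have "- 1 / (1 - s) = 1 / (s - 1)" using s1 by (simp add: divide_simps)
  ultimately have "(\<lambda>n. complex_of_nat (Suc n) powr (- s)) sums
      (1 / (s - 1) - s * (\<Sum>n. em_term ?q 1 n s) - 1 / 2 * (- 1))" by (simp only:)
  also have "1 / (s - 1) - s * (\<Sum>n. em_term ?q 1 n s) - 1 / 2 * (- 1) =
      1 / (s - 1) + 1 / 2 + (- s) * (\<Sum>n. em_term ?q 1 n s)" by simp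
  finally show ?thesis .
qed

lemma em_exists:
  "\<exists>p E c. continuous_on {0..1::real} p \<and> integral {0..1} p = (0::complex) \<and>
     E holomorphic_on (- {1}) \<and> c holomorphic_on UNIV \<and>
     (\<forall>s. Re s > 1 \<longrightarrow> (\<lambda>n. complex_of_nat (Suc n) powr (- s)) sums
        (E s + c s * (\<Sum>n. em_term p (Suc k) n s)))"
proof (induction k)
  case 0
  have "((\<lambda>t. complex_of_real t - 1 / 2) has_integral
      ((\<lambda>t. (complex_of_real t)\<^sup>2 / 2 - complex_of_real t / 2) 1 - (\<lambda>t. (complex_of_real t)\<^sup>2 / 2 - complex_of_real t / 2) 0)) {0..1::real}"
    by (rule fundamental_theorem_of_calculus)
       (auto intro!: derivative_eq_intros has_vector_derivative_real_field)
  hence "integral {0..1} (\<lambda>t. complex_of_real t - 1 / 2) = 0"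
    by (simp add: integral_unique)
  thus ?case using em_base
    by (intro exI[of _ "\<lambda>t. complex_of_real t - 1 / 2"] exI[of _ "\<lambda>s. 1 / (s - 1) + 1 / 2"] exI[of _ "\<lambda>s. - s"])
       (auto intro!: continuous_intros holomorphic_intros)
next
  case (Suc k)
  then obtain p E c where p: "continuous_on {0..1::real} p" "integral {0..1} p = (0::complex)"
     and E: "E holomorphic_on (- {1})" and c: "c holomorphic_on UNIV" and
     sums: "\<And>s. Re s > 1 \<Longrightarrow> (\<lambda>n. complex_of_nat (Suc n) powr (- s)) sums
        (E s + c s * (\<Sum>n. em_term p (Suc k) n s))" by auto
  define r where "r = (\<lambda>t. integral {0..t} p)"
  define q where "q = (\<lambda>t. r t - integral {0..1} r)"
  have r: "(r has_vector_derivative p t) (at t within {0..1})" if "t \<in> {0..1}" for t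
    unfolding r_def using p that by (intro integral_has_vector_derivative)
  hence q: "(q has_vector_derivative p t) (at t within {0..1})" if "t \<in> {0..1}" for t
    unfolding q_def using that by (auto intro!: derivative_eq_intros)
  have cr: "continuous_on {0..1} r" by (rule continuous_on_vector_derivative) (rule r)
  have cq: "continuous_on {0..1} q" unfolding q_def by (intro continuous_intros cr)
  have iq: "integral {0..1} q = 0"
    unfolding q_def by (subst integral_diff) (auto intro!: integrable_continuous_real cr)
  have q01: "q 1 = q 0" using p by (simp add: q_def r_def)
  show ?case
  proof (rule exI[of _ q], rule exI[of _ "\<lambda>s. E s - c s * q 0"],
      rule exI[of _ "\<lambda>s. c s * (s + of_nat (Suc k))"], intro conjI allI impI)
    fix s :: complex assume s: "Re s > 1"
    have "E s + c s * (\<Sum>n. em_term p (Suc k) n s) =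
        E s - c s * q 0 + c s * (s + of_nat (Suc k)) * (\<Sum>n. em_term q (Suc (Suc k)) n s)"
      by (subst em_step[OF p(1) q q01 s]) (auto simp: algebra_simps)
    with sums[OF s] show "(\<lambda>n. complex_of_nat (Suc n) powr (- s)) sums
        (E s - c s * q 0 + c s * (s + of_nat (Suc k)) * (\<Sum>n. em_term q (Suc (Suc k)) n s))"
      by (simp only:)
  qed (auto intro!: holomorphic_on_diff holomorphic_on_mult holomorphic_on_add holomorphic_on_const
         holomorphic_on_ident E c holomorphic_on_subset[OF c] iq cq)
qed

lemma zeta_half_plane_exists:
  "\<exists>f. f holomorphic_on ({s. Re s > - real k} - {1}) \<and>
     (\<forall>s. Re s > 1 \<longrightarrow> (\<lambda>n. complex_of_nat (Suc n) powr (- s)) sums f s)"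
proof -
  obtain p E c where p: "continuous_on {0..1::real} p"
     and E: "E holomorphic_on (- {1})" and c: "c holomorphic_on UNIV" and
     sums: "\<forall>s. Re s > 1 \<longrightarrow> (\<lambda>n. complex_of_nat (Suc n) powr (- s)) sums
        (E s + c s * (\<Sum>n. em_term p (Suc k) n s))" using em_exists[of k] by metis
  have "(\<lambda>s. E s + c s * (\<Sum>n. em_term p (Suc k) n s)) holomorphic_on ({s. Re s > - real k} - {1})"
    by (intro holomorphic_intros holomorphic_on_subset[OF E] holomorphic_on_subset[OF c]
         holomorphic_on_subset[OF em_holomorphic[OF p]]) auto
  with sums show ?thesis by blast
qed

theorem ex1_is_zeta: "\<exists>!f. is_zeta f"
proof (rule ex_ex1I)
  let ?H = "\<lambda>k. {s. Re s > - real k} - {1::complex}"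
  obtain F where F: "\<And>k. F k holomorphic_on ?H k"
    and Fs: "\<And>k s. Re s > 1 \<Longrightarrow> (\<lambda>n. complex_of_nat (Suc n) powr (- s)) sums F k s"
    using zeta_half_plane_exists by metis
  have op: "open (?H k)" for k by (intro open_Diff open_halfspace_Re_gt) auto
  have conn: "connected (?H k)" for k
    by (intro connected_open_delete) (auto intro: convex_connected convex_halfspace_Re_gt open_halfspace_Re_gt)
  have F_eq: "F j s = F k s" if "j \<le> k" "s \<in> ?H j" for j k s
  proof (rule analytic_continuation_open[where s = "{s. Re s > 1}" and s' = "?H j" and f = "F j" and g = "F k"])
    show "{s. Re s > 1} \<noteq> {}" by (auto intro!: exI[of _ 2])
    show "F k holomorphic_on ?H j" using that(1) by (intro holomorphic_on_subset[OF F[of k]]) auto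
    show "F j z = F k z" if "z \<in> {s. Re s > 1}" for z using Fs[of z] that sums_unique2 by blast
  qed (use that op conn F open_halfspace_Re_gt in auto)
  define f where "f = (\<lambda>s. if s = 1 then 0 else F (nat \<lceil>\<bar>Re s\<bar>\<rceil> + 1) s)"
  have f_eq: "f s = F k s" if "s \<in> ?H k" for k s
  proof -
    have "s \<in> ?H (nat \<lceil>\<bar>Re s\<bar>\<rceil> + 1)" using that by (auto; linarith)
    thus ?thesis using that F_eq[of _ _ s] unfolding f_def by (metis DiffD2 insertI1 nle_le)
  qed
  have "f holomorphic_on (\<Union>k. ?H k)"
    by (intro holomorphic_on_UN_open op holomorphic_transform[OF F]) (rule f_eq[symmetric])
  moreover have "(\<Union>k. ?H k) = - {1}"
    by (auto, metis reals_Archimedean2 minus_less_iff)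
  moreover have "(\<lambda>n. of_nat (Suc n) powr (- s)) sums f s" if "Re s > 1" for s
    using Fs[OF that, of 0] f_eq[of s 0] that by (cases "s = 1") auto
  ultimately show "\<exists>f. is_zeta f" unfolding is_zeta_def by (intro exI[of _ f]) (auto simp: f_def)
next
  fix f g assume f: "is_zeta f" and g: "is_zeta g"
  have "f s = g s" if "s \<noteq> 1" for s
  proof (rule analytic_continuation_open[where s = "{s. Re s > 1}" and s' = "- {1}" and f = f and g = g])
    show "{s. Re s > 1} \<noteq> {}" by (auto intro!: exI[of _ 2])
    show "connected (- {1::complex})" by (rule connected_punctured_universe) simp
    show "f z = g z" if "z \<in> {s. Re s > 1}" for z
      using f g that sums_unique2 unfolding is_zeta_def by blast
  qed (use f g that open_halfspace_Re_gt in \<open>auto simp: is_zeta_def\<close>)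
  thus "f = g" using f g unfolding is_zeta_def by (metis ext)
qed

lemma is_zeta_riemann_zeta: "is_zeta riemann_zeta"
  unfolding riemann_zeta_def by (rule theI'[OF ex1_is_zeta])

lemma riemann_zeta_holomorphic: "riemann_zeta holomorphic_on (- {1})"
  and riemann_zeta_sums: "Re s > 1 \<Longrightarrow> (\<lambda>n. of_nat (Suc n) powr (- s)) sums riemann_zeta s"
  using is_zeta_riemann_zeta unfolding is_zeta_def by blast+

end

theory Submission
  imports Defs "HOL-Real_Asymp.Real_Asymp"
begin

text \<open>
  Put \<open>\<tau> = b t\<close> and compare \<open>\<zeta>(s + i a t)\<close> with \<open>\<zeta>(s + i b t)\<close>. Let \<open>m = |a - b| \<ge> 2\<close> (for \<open>a = b\<close>
  there is nothing to prove). If \<open>p\<close> to the power \<open>i t\<close> is close to an \<open>m\<close>-th root of unity \<open>w p\<close> for every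
  prime \<open>p \<le> y\<close>, then the Euler factors at \<open>p \<le> y\<close> of both functions nearly agree. Letting \<open>w p\<close> run
  cyclically through the \<open>m\<close>-th roots of unity along the primes makes the partial Euler product at
  these phases bounded in \<open>y\<close> for \<open>Re s > 1/2\<close>: since \<open>a\<close> is coprime to \<open>m\<close>, the powers of the \<open>w p\<close>
  with exponent \<open>- a\<close> have bounded partial sums. This is where \<open>m \<noteq> 1\<close> is needed.

  Instead of restricting \<open>t\<close> to a set, average against a product \<open>W(t)\<close> of Fejer kernels, one for each
  \<open>p \<le> y\<close>, centred at \<open>w p\<close>. By unique factorisation the mean value of \<open>W\<close> is 1 and the integers
  without prime factors \<open>\<le> y\<close> remain independent of \<open>W\<close>, so after division by the Euler factors at
  \<open>p \<le> y\<close> zeta differs from 1 in \<open>W\<close>-weighted mean square by a tail of the series of \<open>n\<close> to the power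
  \<open>- 2 Re s\<close>. As \<open>W\<close> is bounded, replacing zeta by a Dirichlet polynomial costs little in mean square, by
  Euler--Maclaurin summation. Hence both functions are close to the same partial Euler product in
  \<open>W\<close>-weighted mean square on finitely many circles around \<open>K\<close>; Cauchy's formula and Chebyshev's
  inequality conclude, again because \<open>W\<close> is bounded.
\<close>

section \<open>Trigonometric polynomials with parameters\<close>

text \<open>
  In \<open>trigpoly X L f m\<close>, \<open>m x\<close> is the constant term of the trigonometric polynomial \<open>f x\<close> with
  frequencies in \<open>L\<close>. Coefficients bounded in \<open>x\<close> make the means over \<open>[0, T]\<close> converge to \<open>m x\<close>
  uniformly in \<open>x \<in> X\<close>.
\<close>

inductive trigpoly :: "'x set \<Rightarrow> real set \<Rightarrow> ('x \<Rightarrow> real \<Rightarrow> complex) \<Rightarrow> ('x \<Rightarrow> complex) \<Rightarrow> bool"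
  for X L where
  const: "bounded (c ` X) \<Longrightarrow> trigpoly X L (\<lambda>x t. c x) c"
| cis: "bounded (c ` X) \<Longrightarrow> l \<in> L \<Longrightarrow> l \<noteq> 0 \<Longrightarrow> trigpoly X L (\<lambda>x t. c x * cis (l * t)) (\<lambda>x. 0)"
| add: "trigpoly X L f m \<Longrightarrow> trigpoly X L g n \<Longrightarrow> trigpoly X L (\<lambda>x t. f x t + g x t) (\<lambda>x. m x + n x)"

lemma trigpoly_continuous: "trigpoly X L f m \<Longrightarrow> continuous_on A (f x)"
  by (induction rule: trigpoly.induct) (auto intro!: continuous_intros)

lemma trigpoly_mono: "trigpoly X L f m \<Longrightarrow> L \<subseteq> L' \<Longrightarrow> trigpoly X L' f m"
  by (induction rule: trigpoly.induct) (auto intro: trigpoly.intros)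

lemma bounded_mult_comp:
  fixes f g :: "'x \<Rightarrow> 'a::real_normed_algebra"
  assumes "bounded (f ` X)" "bounded (g ` X)"
  shows "bounded ((\<lambda>x. f x * g x) ` X)"
proof -
  obtain B C where "\<forall>x\<in>X. norm (f x) \<le> B" "\<forall>x\<in>X. norm (g x) \<le> C"
    using assms unfolding bounded_iff by auto
  hence "norm (f x * g x) \<le> \<bar>B\<bar> * \<bar>C\<bar>" if "x \<in> X" for x
    by (intro order_trans[OF norm_mult_ineq] mult_mono) (use that in \<open>auto intro: order_trans\<close>)
  thus ?thesis unfolding bounded_iff by blast
qed

lemma trigpoly_cis:
  assumes "bounded (c ` X)" "l \<in> L"
  shows "trigpoly X L (\<lambda>x t. c x * cis (l * t)) (\<lambda>x. if l = 0 then c x else 0)"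
  using trigpoly.const[OF assms(1)] trigpoly.cis[OF assms] by (cases "l = 0") auto

lemma trigpoly_scale:
  assumes "trigpoly X L f m" "bounded (c ` X)"
  shows "trigpoly X L (\<lambda>x t. c x * f x t) (\<lambda>x. c x * m x)"
  using assms(1)
proof (induction rule: trigpoly.induct)
  case (const d)
  show ?case by (intro trigpoly.const bounded_mult_comp const assms)
next
  case (cis d l)
  from trigpoly.cis[OF bounded_mult_comp[OF assms(2) cis(1)] cis(2,3)] show ?case
    by (simp add: mult.assoc)
next
  case (add f m g n)
  from trigpoly.add[OF add.IH] show ?case by (simp add: algebra_simps)
qed

lemma trigpoly_sum:
  assumes "finite J" "\<And>j. j \<in> J \<Longrightarrow> trigpoly X L (f j) (m j)"
  shows "trigpoly X L (\<lambda>x t. \<Sum>j\<in>J. f j x t) (\<lambda>x. \<Sum>j\<in>J. m j x)"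
  using assms
proof (induction J rule: finite_induct)
  case empty
  from trigpoly.const[of "\<lambda>_. 0" X L] show ?case by (simp add: image_constant_conv)
next
  case (insert j J)
  have "trigpoly X L (\<lambda>x t. f j x t + (\<Sum>j\<in>J. f j x t)) (\<lambda>x. m j x + (\<Sum>j\<in>J. m j x))"
    by (intro trigpoly.add insert) auto
  with insert(1,2) show ?case by simp
qed

lemma trigpoly_cis_mult:
  assumes "trigpoly X L g n" "bounded (c ` X)" "l \<in> M" "l \<noteq> 0"
    and "\<And>l'. l' \<in> L \<Longrightarrow> l + l' \<noteq> 0" "\<And>l'. l' \<in> L \<Longrightarrow> l + l' \<in> M"
  shows "trigpoly X M (\<lambda>x t. c x * cis (l * t) * g x t) (\<lambda>x. 0)"
  using assms(1)
proof (induction rule: trigpoly.induct)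
  case (const d)
  from trigpoly.cis[OF bounded_mult_comp[OF assms(2) const] assms(3,4)] show ?case
    by (simp add: mult_ac)
next
  case (cis d k)
  from trigpoly.cis[OF bounded_mult_comp[OF assms(2) cis(1)] assms(6)[OF cis(2)] assms(5)[OF cis(2)]]
  show ?case by (simp add: cis_mult[symmetric] ring_distribs mult_ac)
next
  case (add f m g n)
  from trigpoly.add[OF add.IH] show ?case by (simp add: algebra_simps)
qed

lemma trigpoly_mult_indep:
  assumes "trigpoly X L f m" "trigpoly X L' g n"
    and "\<And>l l'. l \<in> L \<Longrightarrow> l' \<in> L' \<Longrightarrow> l + l' = 0 \<Longrightarrow> l = 0"
    and "L \<subseteq> M" "L' \<subseteq> M" "\<And>l l'. l \<in> L \<Longrightarrow> l' \<in> L' \<Longrightarrow> l + l' \<in> M"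
  shows "trigpoly X M (\<lambda>x t. f x t * g x t) (\<lambda>x. m x * n x)"
  using assms(1)
proof (induction rule: trigpoly.induct)
  case (const c)
  show ?case by (rule trigpoly_scale[OF trigpoly_mono[OF assms(2,5)] const])
next
  case (cis c l)
  have "trigpoly X M (\<lambda>x t. c x * cis (l * t) * g x t) (\<lambda>x. 0)"
    by (rule trigpoly_cis_mult[OF assms(2) cis(1)]) (use cis assms(3,4,6) in blast)+
  thus ?case by simp
next
  case (add f m f' m')
  from trigpoly.add[OF add.IH] show ?case by (simp add: algebra_simps)
qed

lemma norm_trig_sum_square:
  fixes c :: "'j \<Rightarrow> complex"
  shows "of_real ((norm (\<Sum>j\<in>J. c j * cis (\<omega> j * t)))\<^sup>2) =
    (\<Sum>j\<in>J. \<Sum>k\<in>J. (c j * cnj (c k)) * cis ((\<omega> j - \<omega> k) * t))"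
proof -
  have cis: "cis ((\<omega> j - \<omega> k) * t) = cis (\<omega> j * t) * cis (- (\<omega> k * t))" for j k
    by (simp add: cis_mult algebra_simps)
  show ?thesis
    unfolding complex_norm_square cnj_sum sum_product cis by (simp add: cis_cnj mult_ac)
qed

abbreviation real_trigpoly :: "'x set \<Rightarrow> real set \<Rightarrow> ('x \<Rightarrow> real \<Rightarrow> real) \<Rightarrow> ('x \<Rightarrow> real) \<Rightarrow> bool" where
  "real_trigpoly X L f m \<equiv> trigpoly X L (\<lambda>x t. complex_of_real (f x t)) (\<lambda>x. complex_of_real (m x))"

lemma real_trigpoly_add:
  "real_trigpoly X L f m \<Longrightarrow> real_trigpoly X L g n \<Longrightarrow>
    real_trigpoly X L (\<lambda>x t. f x t + g x t) (\<lambda>x. m x + n x)"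
  using trigpoly.add[of X L "\<lambda>x t. of_real (f x t)" "\<lambda>x. of_real (m x)"] by simp

lemma real_trigpoly_cmult:
  "real_trigpoly X L f m \<Longrightarrow> real_trigpoly X L (\<lambda>x t. c * f x t) (\<lambda>x. c * m x)"
  using trigpoly_scale[of X L "\<lambda>x t. of_real (f x t)" "\<lambda>x. of_real (m x)" "\<lambda>_. of_real c"]
  by (simp add: image_constant_conv)

lemma real_trigpoly_sum:
  "finite J \<Longrightarrow> (\<And>j. j \<in> J \<Longrightarrow> real_trigpoly X L (f j) (m j)) \<Longrightarrow>
    real_trigpoly X L (\<lambda>x t. \<Sum>j\<in>J. f j x t) (\<lambda>x. \<Sum>j\<in>J. m j x)"
  using trigpoly_sum[of J X L "\<lambda>j x t. of_real (f j x t)" "\<lambda>j x. of_real (m j x)"] by simp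

lemma real_trigpoly_mult_indep:
  assumes "real_trigpoly X L f m" "real_trigpoly X L' g n"
    and "\<And>l l'. l \<in> L \<Longrightarrow> l' \<in> L' \<Longrightarrow> l + l' = 0 \<Longrightarrow> l = 0"
    and "L \<subseteq> M" "L' \<subseteq> M" "\<And>l l'. l \<in> L \<Longrightarrow> l' \<in> L' \<Longrightarrow> l + l' \<in> M"
  shows "real_trigpoly X M (\<lambda>x t. f x t * g x t) (\<lambda>x. m x * n x)"
  using trigpoly_mult_indep[OF assms] by simp

lemma real_trigpoly_norm_square:
  assumes J: "finite J" "inj_on \<omega> J" and c: "\<And>j. j \<in> J \<Longrightarrow> bounded (c j ` X)"
    and L: "\<And>j k. j \<in> J \<Longrightarrow> k \<in> J \<Longrightarrow> \<omega> j - \<omega> k \<in> L"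
  shows "real_trigpoly X L (\<lambda>x t. (norm (\<Sum>j\<in>J. c j x * cis (\<omega> j * t)))\<^sup>2) (\<lambda>x. \<Sum>j\<in>J. (norm (c j x))\<^sup>2)"
proof -
  have cnj: "bounded ((\<lambda>x. cnj (c j x)) ` X)" if "j \<in> J" for j
    using c[OF that] by (auto simp: bounded_iff)
  have "trigpoly X L (\<lambda>x t. \<Sum>j\<in>J. \<Sum>k\<in>J. (c j x * cnj (c k x)) * cis ((\<omega> j - \<omega> k) * t))
      (\<lambda>x. \<Sum>j\<in>J. \<Sum>k\<in>J. if \<omega> j - \<omega> k = 0 then c j x * cnj (c k x) else 0)"
    by (intro trigpoly_sum trigpoly_cis bounded_mult_comp c cnj L J(1))
  moreover have "(\<Sum>j\<in>J. \<Sum>k\<in>J. if \<omega> j - \<omega> k = 0 then c j x * cnj (c k x) else 0) =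
      of_real (\<Sum>j\<in>J. (norm (c j x))\<^sup>2)" for x
  proof -
    have "(\<Sum>j\<in>J. \<Sum>k\<in>J. if \<omega> j - \<omega> k = 0 then c j x * cnj (c k x) else 0) =
        (\<Sum>j\<in>J. \<Sum>k\<in>J. if k = j then c j x * cnj (c j x) else 0)"
      using J(2) by (intro sum.cong) (auto simp: inj_on_def)
    also have "\<dots> = of_real (\<Sum>j\<in>J. (norm (c j x))\<^sup>2)"
      using J(1) by (simp flip: complex_norm_square)
    finally show ?thesis .
  qed
  ultimately show ?thesis by (simp only: norm_trig_sum_square)
qed

section \<open>Uniform mean values\<close>

lemma norm_integral_cis_le:
  assumes "l \<noteq> 0" "a \<le> b"
  shows "norm (integral {a..b} (\<lambda>t. cis (l * t))) \<le> 2 / \<bar>l\<bar>"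
proof -
  have "((\<lambda>t. cis (l * t) / (\<i> * l)) has_vector_derivative cis (l * t)) (at t within {a..b})" for t
  proof -
    have "((\<lambda>z. exp (\<i> * l * z) / (\<i> * l)) has_field_derivative exp (\<i> * l * of_real t)) (at (of_real t))"
      using assms by (auto intro!: derivative_eq_intros)
    from has_vector_derivative_at_within[OF has_vector_derivative_real_field[OF this]] show ?thesis
      by (simp add: cis_conv_exp mult_ac)
  qed
  hence "integral {a..b} (\<lambda>t. cis (l * t)) = cis (l * b) / (\<i> * l) - cis (l * a) / (\<i> * l)"
    by (intro integral_unique fundamental_theorem_of_calculus assms)
  also have "norm \<dots> \<le> norm (cis (l * b) / (\<i> * l)) + norm (cis (l * a) / (\<i> * l))"
    by (rule norm_triangle_ineq4)
  also have "\<dots> = 2 / \<bar>l\<bar>" by (simp add: norm_divide norm_mult)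
  finally show ?thesis .
qed

lemma trigpoly_mean:
  assumes "trigpoly X L f m" "e > 0"
  shows "\<forall>\<^sub>F T in at_top. \<forall>x\<in>X. norm (integral {0..T} (f x) - of_real T * m x) \<le> e * T"
  using assms
proof (induction arbitrary: e rule: trigpoly.induct)
  case (const c)
  show ?case using eventually_ge_at_top[of 0]
    by eventually_elim (use const in \<open>auto simp: scaleR_conv_of_real\<close>)
next
  case (cis c l)
  obtain B where B: "\<forall>x\<in>X. norm (c x) \<le> B" using cis(1) unfolding bounded_iff by auto
  show ?case using eventually_ge_at_top[of 0] eventually_ge_at_top[of "\<bar>B\<bar> * (2 / \<bar>l\<bar>) / e"]
  proof eventually_elim
    case (elim T)
    have "norm (integral {0..T} (\<lambda>t. c x * cis (l * t))) \<le> \<bar>B\<bar> * (2 / \<bar>l\<bar>)" if "x \<in> X" for x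
      unfolding integral_mult_right norm_mult
      by (intro mult_mono norm_integral_cis_le) (use B that cis elim in \<open>auto intro: order_trans\<close>)
    moreover have "\<bar>B\<bar> * (2 / \<bar>l\<bar>) \<le> e * T" 
      using elim(2) by (simp only: pos_divide_le_eq[OF cis(4)] mult.commute)
    ultimately show ?case by (auto intro: order_trans)
  qed
next
  case (add f m g n)
  have "e / 2 > 0" using add by simp
  from add.IH(1)[OF this] add.IH(2)[OF this] show ?case
  proof eventually_elim
    case (elim T)
    show ?case
    proof
      fix x assume x: "x \<in> X"
      have "integral {0..T} (\<lambda>t. f x t + g x t) = integral {0..T} (f x) + integral {0..T} (g x)"
        by (intro integral_add integrable_continuous_real trigpoly_continuous[OF add(1)] trigpoly_continuous[OF add(2)])
      hence "norm (integral {0..T} (\<lambda>t. f x t + g x t) - of_real T * (m x + n x)) =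
         norm ((integral {0..T} (f x) - of_real T * m x) + (integral {0..T} (g x) - of_real T * n x))"
        by (simp add: algebra_simps)
      also have "\<dots> \<le> e / 2 * T + e / 2 * T"
        by (rule norm_triangle_le, rule add_mono) (use elim x in blast)+
      finally show "norm (integral {0..T} (\<lambda>t. f x t + g x t) - of_real T * (m x + n x)) \<le> e * T"
        by (simp add: mult.commute)
    qed
  qed
qed

lemma integral_of_real_continuous:
  fixes f :: "real \<Rightarrow> real"
  assumes "continuous_on {a..b} f"
  shows "integral {a..b} (\<lambda>t. complex_of_real (f t)) = of_real (integral {a..b} f)"
  by (intro integral_unique has_integral_of_real integrable_integral integrable_continuous_real assms)

lemma real_trigpoly_continuous:
  assumes "real_trigpoly X L f m"
  shows "continuous_on A (f x)"
  using continuous_on_Re[OF trigpoly_continuous[OF assms, of A x]] by simp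

lemma real_trigpoly_mean:
  assumes "real_trigpoly X L f m" "e > 0"
  shows "\<forall>\<^sub>F T in at_top. \<forall>x\<in>X. \<bar>integral {0..T} (f x) - T * m x\<bar> \<le> e * T"
  using trigpoly_mean[OF assms]
  unfolding integral_of_real_continuous[OF real_trigpoly_continuous[OF assms(1)]]
  by (simp flip: of_real_mult of_real_diff)

definition upper_mean_le :: "'x set \<Rightarrow> ('x \<Rightarrow> real \<Rightarrow> real) \<Rightarrow> real \<Rightarrow> bool" where
  "upper_mean_le X f \<eta> \<longleftrightarrow>
     (\<forall>\<^sub>F T in at_top. \<forall>x\<in>X. f x integrable_on {0..T} \<and> integral {0..T} (f x) \<le> \<eta> * T)"

lemma upper_mean_le_trigpoly:
  assumes f: "real_trigpoly X L f m" and m: "\<And>x. x \<in> X \<Longrightarrow> m x \<le> \<mu>" and "\<mu> < \<eta>"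
  shows "upper_mean_le X f \<eta>"
proof -
  have "\<eta> - \<mu> > 0" using \<open>\<mu> < \<eta>\<close> by simp
  from real_trigpoly_mean[OF f this] eventually_ge_at_top[of 0] show ?thesis
    unfolding upper_mean_le_def
  proof eventually_elim
    case (elim T)
    have "integral {0..T} (f x) \<le> \<eta> * T" if "x \<in> X" for x
    proof -
      have "T * m x \<le> T * \<mu>" using m[OF that] elim by (intro mult_left_mono) auto
      moreover have "integral {0..T} (f x) - T * m x \<le> (\<eta> - \<mu>) * T"
        using elim that by (meson abs_le_D1)
      ultimately show ?thesis by (simp add: algebra_simps)
    qed
    thus ?case using integrable_continuous_real[OF real_trigpoly_continuous[OF f]] by blast
  qed
qed

lemma upper_mean_le_add:
  assumes "upper_mean_le X f \<eta>" "upper_mean_le X g \<theta>"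
  shows "upper_mean_le X (\<lambda>x t. f x t + g x t) (\<eta> + \<theta>)"
  using assms unfolding upper_mean_le_def
  by eventually_elim (simp add: integral_add integrable_add ring_distribs add_mono)

lemma upper_mean_le_cmult:
  assumes "upper_mean_le X f \<eta>" "c \<ge> 0"
  shows "upper_mean_le X (\<lambda>x t. c * f x t) (c * \<eta>)"
  using assms(1) unfolding upper_mean_le_def
  by eventually_elim (simp add: integrable_on_mult_right mult.assoc mult_left_mono[OF _ assms(2)])

lemma upper_mean_le_mono:
  assumes "upper_mean_le X g \<eta>" "\<And>x T. x \<in> X \<Longrightarrow> f x integrable_on {0..T}"
    and "\<And>x t. x \<in> X \<Longrightarrow> f x t \<le> g x t" "\<eta> \<le> \<theta>"
  shows "upper_mean_le X f \<theta>"
  using assms(1) eventually_ge_at_top[of 0] unfolding upper_mean_le_def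
proof eventually_elim
  case (elim T)
  have "integral {0..T} (f x) \<le> \<theta> * T" if "x \<in> X" for x
  proof -
    have "integral {0..T} (f x) \<le> integral {0..T} (g x)"
      by (intro integral_le) (use elim that assms in auto)
    also have "\<dots> \<le> \<eta> * T" using elim that by blast
    also have "\<dots> \<le> \<theta> * T" using assms(4) elim by (intro mult_right_mono)
    finally show ?thesis .
  qed
  thus ?case using assms(2) by blast
qed

lemma integral_scale_le:
  fixes g :: "real \<Rightarrow> real"
  assumes g: "continuous_on UNIV g" "\<And>t. g t \<ge> 0" and c: "c \<noteq> 0" and T: "T \<ge> 0"
  shows "integral {0..T} (\<lambda>t. g (c * t)) \<le> integral {- (\<bar>c\<bar> * T)..\<bar>c\<bar> * T} g / \<bar>c\<bar>"
proof -
  have "(\<lambda>x. x / c) ` {- (\<bar>c\<bar> * T)..\<bar>c\<bar> * T} = {-T..T}"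
    using image_mult_atLeastAtMost_if'[of "1 / c" "- (\<bar>c\<bar> * T)" "\<bar>c\<bar> * T"] c T
    by (auto simp: abs_if)
  hence "integral {-T..T} (\<lambda>t. g (c * t)) = integral {- (\<bar>c\<bar> * T)..\<bar>c\<bar> * T} g / \<bar>c\<bar>"
    using integral_stretch_real[OF c, of "- (\<bar>c\<bar> * T)" "\<bar>c\<bar> * T" g] by simp
  moreover have "integral {0..T} (\<lambda>t. g (c * t)) \<le> integral {-T..T} (\<lambda>t. g (c * t))"
    using T g(2)
    by (intro integral_subset_le integrable_continuous_real continuous_on_compose2[OF g(1)] continuous_intros) auto
  ultimately show ?thesis by simp
qed

lemma upper_mean_le_scale:
  assumes "\<forall>\<^sub>F T in at_top. \<forall>x\<in>X. integral {-T..T} (f x) \<le> \<eta> * T"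
    and f: "\<And>x. x \<in> X \<Longrightarrow> continuous_on UNIV (f x)" "\<And>x t. x \<in> X \<Longrightarrow> f x t \<ge> 0" and c: "c \<noteq> 0"
  shows "upper_mean_le X (\<lambda>x t. f x (c * t)) \<eta>"
proof -
  have "filterlim (\<lambda>T. \<bar>c\<bar> * T) at_top at_top" using c by real_asymp
  from eventually_compose_filterlim[OF assms(1) this] eventually_ge_at_top[of 0] show ?thesis
    unfolding upper_mean_le_def
  proof eventually_elim
    case (elim T)
    have "integral {0..T} (\<lambda>t. f x (c * t)) \<le> \<eta> * T" if "x \<in> X" for x
    proof -
      have "integral {0..T} (\<lambda>t. f x (c * t)) \<le> integral {- (\<bar>c\<bar> * T)..\<bar>c\<bar> * T} (f x) / \<bar>c\<bar>"
        using that elim by (intro integral_scale_le f c) auto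
      also have "\<dots> \<le> (\<eta> * (\<bar>c\<bar> * T)) / \<bar>c\<bar>" using elim that by (intro divide_right_mono) auto
      finally show ?thesis using c by simp
    qed
    moreover have "(\<lambda>t. f x (c * t)) integrable_on {0..T}" if "x \<in> X" for x
      by (intro integrable_continuous_real continuous_on_compose2[OF f(1)[OF that]] continuous_intros) auto
    ultimately show ?case by blast
  qed
qed

section \<open>Fejer weights on the logarithms of primes\<close>

definition log_span :: "nat set \<Rightarrow> real set" where
  "log_span A = {ln (real u) - ln (real v) | u v. u > 0 \<and> v > 0 \<and>
     prime_factors u \<subseteq> A \<and> prime_factors v \<subseteq> A}"

lemma log_spanE:
  assumes "l \<in> log_span A"
  obtains u v where "u > 0" "v > 0" "prime_factors u \<subseteq> A" "prime_factors v \<subseteq> A" "l = ln (real u) - ln (real v)"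
  using assms unfolding log_span_def by blast

lemma log_spanI:
  assumes "u > 0" "v > 0" "prime_factors u \<subseteq> A" "prime_factors v \<subseteq> A" "l = ln (real u) - ln (real v)"
  shows "l \<in> log_span A"
  using assms unfolding log_span_def by blast

lemma log_span_ln: "u > 0 \<Longrightarrow> prime_factors u \<subseteq> A \<Longrightarrow> ln (real u) \<in> log_span A"
  by (rule log_spanI[of u 1]) auto

lemma log_span_mono: "A \<subseteq> B \<Longrightarrow> log_span A \<subseteq> log_span B"
  unfolding log_span_def by blast

lemma log_span_uminus: "l \<in> log_span A \<Longrightarrow> - l \<in> log_span A"
  unfolding log_span_def by force

lemma log_span_add:
  assumes "l \<in> log_span A" "l' \<in> log_span A"
  shows "l + l' \<in> log_span A"
proof -
  from assms(1) obtain u v where uv: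
    "u > 0" "v > 0" "prime_factors u \<subseteq> A" "prime_factors v \<subseteq> A" "l = ln (real u) - ln (real v)"
    by (rule log_spanE)
  from assms(2) obtain u' v' where uv':
    "u' > 0" "v' > 0" "prime_factors u' \<subseteq> A" "prime_factors v' \<subseteq> A" "l' = ln (real u') - ln (real v')"
    by (rule log_spanE)
  show ?thesis
    by (rule log_spanI[of "u * u'" "v * v'"]) (use uv uv' in \<open>auto simp: prime_factors_product ln_mult\<close>)
qed

lemma log_span_diff: "l \<in> log_span A \<Longrightarrow> l' \<in> log_span A \<Longrightarrow> l - l' \<in> log_span A"
  using log_span_add[of l A "- l'"] log_span_uminus by simp

lemma log_span_of_int_mult:
  assumes "l \<in> log_span A"
  shows "of_int n * l \<in> log_span A"
proof -
  have of_nat: "real k * l \<in> log_span A" for k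
  proof (induction k)
    case 0
    show ?case using log_span_ln[of 1 A] by simp
  next
    case (Suc k)
    from log_span_add[OF this assms] show ?case by (simp add: algebra_simps)
  qed
  show ?thesis
    by (cases n rule: int_cases2) (use of_nat log_span_uminus[OF of_nat] in auto)
qed

lemma coprime_disjoint_prime_factors:
  fixes m n :: nat
  assumes "m > 0" "n > 0" "prime_factors m \<inter> prime_factors n = {}"
  shows "coprime m n"
proof (rule ccontr)
  assume "\<not> coprime m n"
  then obtain q where "prime q" "q dvd m" "q dvd n"
    by (metis coprime_iff_gcd_eq_1 gcd_dvd1 gcd_dvd2 dvd_trans prime_factor_nat)
  thus False using assms by (auto simp: prime_factors_dvd)
qed

lemma log_span_indep:
  assumes "l \<in> log_span A" "l' \<in> log_span B" "A \<inter> B = {}" "l + l' = 0"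
  shows "l = 0"
proof -
  from assms(1) obtain u v where uv:
    "u > 0" "v > 0" "prime_factors u \<subseteq> A" "prime_factors v \<subseteq> A" "l = ln (real u) - ln (real v)"
    by (rule log_spanE)
  from assms(2) obtain u' v' where uv':
    "u' > 0" "v' > 0" "prime_factors u' \<subseteq> B" "prime_factors v' \<subseteq> B" "l' = ln (real u') - ln (real v')"
    by (rule log_spanE)
  have "ln (real (u * u')) = ln (real (v * v'))"
    using uv uv' assms(4) by (simp add: ln_mult)
  hence "real (u * u') = real (v * v')"
    using uv uv' by (subst (asm) ln_inj_iff) auto
  hence eq: "u * u' = v * v'" by linarith
  have "coprime u v'" "coprime v u'"
    using uv uv' assms(3) by (auto intro!: coprime_disjoint_prime_factors)
  hence "u dvd v" "v dvd u"
    using eq by (metis coprime_dvd_mult_left_iff dvd_triv_left)+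
  thus ?thesis using uv by (simp add: dvd_antisym)
qed

lemma real_trigpoly_mult_log_span:
  assumes "real_trigpoly X (log_span A) f m" "real_trigpoly X (log_span B) g n" "A \<inter> B = {}"
  shows "real_trigpoly X (log_span (A \<union> B)) (\<lambda>x t. f x t * g x t) (\<lambda>x. m x * n x)"
proof (rule real_trigpoly_mult_indep[OF assms(1,2)])
  show AB: "log_span A \<subseteq> log_span (A \<union> B)" "log_span B \<subseteq> log_span (A \<union> B)"
    by (intro log_span_mono; blast)+
  show "l + l' \<in> log_span (A \<union> B)" if "l \<in> log_span A" "l' \<in> log_span B" for l l'
    using that AB by (blast intro: log_span_add)
qed (use assms(3) log_span_indep in blast)

definition fejer_kernel :: "nat \<Rightarrow> complex \<Rightarrow> real \<Rightarrow> real" where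
  "fejer_kernel K w u = (norm (\<Sum>k<K. (cnj w * cis u) ^ k))\<^sup>2 / real K"

lemma fejer_kernel_nonneg: "fejer_kernel K w u \<ge> 0"
  by (simp add: fejer_kernel_def)

lemma fejer_kernel_le:
  assumes "norm w = 1"
  shows "fejer_kernel K w u \<le> real K"
proof -
  have "norm (\<Sum>k<K. (cnj w * cis u) ^ k) \<le> (\<Sum>k<K. norm ((cnj w * cis u) ^ k))" by (rule norm_sum)
  also have "\<dots> = real K" using assms by (simp add: norm_power norm_mult)
  finally have "(norm (\<Sum>k<K. (cnj w * cis u) ^ k))\<^sup>2 \<le> (real K)\<^sup>2" by (intro power_mono) auto
  thus ?thesis by (cases "K = 0") (auto simp: fejer_kernel_def power2_eq_square field_simps)
qed

lemma continuous_on_fejer_kernel: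
  "continuous_on S f \<Longrightarrow> continuous_on S (\<lambda>t. fejer_kernel K w (f t))"
  unfolding fejer_kernel_def divide_inverse by (intro continuous_intros)

lemma cnj_cis_power: "(cnj w * cis u) ^ k = cnj w ^ k * cis (real k * u)"
  by (simp add: power_mult_distrib Complex.DeMoivre)

lemma fejer_kernel_mult_norm_diff:
  assumes "norm w = 1"
  shows "fejer_kernel K w u * (norm (cis u - w))\<^sup>2 = (norm (cnj w ^ K * cis (real K * u) - 1))\<^sup>2 / real K"
proof -
  define z where "z = cnj w * cis u"
  have "cnj w * w = 1"
    using assms by (metis complex_norm_square mult.commute of_real_1 one_power2)
  hence "norm (cis u - w) = norm (z - 1)"
    using assms by (metis complex_mod_cnj mult_1 norm_mult right_diff_distrib z_def)
  hence "(norm (\<Sum>k<K. z ^ k))\<^sup>2 * (norm (cis u - w))\<^sup>2 = (norm ((z - 1) * (\<Sum>k<K. z ^ k)))\<^sup>2"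
    by (simp add: norm_mult power_mult_distrib)
  also have "(z - 1) * (\<Sum>k<K. z ^ k) = z ^ K - 1" by (simp add: power_diff_1_eq)
  finally show ?thesis by (simp add: fejer_kernel_def z_def cnj_cis_power)
qed

lemma real_trigpoly_norm_square_harmonics:
  assumes "finite J" "l \<noteq> 0" "\<And>k. of_int k * l \<in> L"
  shows "real_trigpoly X L (\<lambda>x t. (norm (\<Sum>j\<in>J. c j * cis (real j * (l * t))))\<^sup>2) (\<lambda>x. \<Sum>j\<in>J. (norm (c j))\<^sup>2)"
proof -
  have "real j * l - real k * l \<in> L" for j k
    using assms(3)[of "int j - int k"] by (simp add: algebra_simps)
  hence "real_trigpoly X L (\<lambda>x t. (norm (\<Sum>j\<in>J. c j * cis (real j * l * t)))\<^sup>2) (\<lambda>x. \<Sum>j\<in>J. (norm (c j))\<^sup>2)"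
    by (intro real_trigpoly_norm_square) (use assms in \<open>auto simp: inj_on_def image_constant_conv\<close>)
  thus ?thesis by (simp only: mult.assoc)
qed

lemma real_trigpoly_fejer_kernel:
  assumes "norm w = 1" "K > 0" "l \<noteq> 0" "\<And>k. of_int k * l \<in> L"
  shows "real_trigpoly X L (\<lambda>x t. fejer_kernel K w (l * t)) (\<lambda>x. 1)"
proof -
  have "real_trigpoly X L (\<lambda>x t. (norm (\<Sum>k<K. cnj w ^ k * cis (real k * (l * t))))\<^sup>2) (\<lambda>x. \<Sum>k<K. (norm (cnj w ^ k))\<^sup>2)"
    by (intro real_trigpoly_norm_square_harmonics assms) simp
  from real_trigpoly_cmult[OF this, of "1 / real K"] assms(1,2) show ?thesis
    by (simp add: fejer_kernel_def cnj_cis_power norm_power)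
qed

lemma real_trigpoly_fejer_kernel_mult_norm_diff:
  assumes "norm w = 1" "K > 0" "l \<noteq> 0" "\<And>k. of_int k * l \<in> L"
  shows "real_trigpoly X L (\<lambda>x t. fejer_kernel K w (l * t) * (norm (cis (l * t) - w))\<^sup>2) (\<lambda>x. 2 / real K)"
proof -
  let ?c = "\<lambda>k. if k = 0 then - 1 else cnj w ^ K"
  have "real_trigpoly X L (\<lambda>x t. (norm (\<Sum>k\<in>{0, K}. ?c k * cis (real k * (l * t))))\<^sup>2) (\<lambda>x. \<Sum>k\<in>{0, K}. (norm (?c k))\<^sup>2)"
    by (intro real_trigpoly_norm_square_harmonics assms) simp
  from real_trigpoly_cmult[OF this, of "1 / real K"] assms(1,2) show ?thesis
    by (simp add: fejer_kernel_mult_norm_diff norm_power)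
qed

definition fejer_weight :: "nat \<Rightarrow> (nat \<Rightarrow> complex) \<Rightarrow> nat set \<Rightarrow> real \<Rightarrow> real" where
  "fejer_weight K w A t = (\<Prod>p\<in>A. fejer_kernel K (w p) (ln (real p) * t))"

definition phase_error :: "(nat \<Rightarrow> complex) \<Rightarrow> nat set \<Rightarrow> real \<Rightarrow> real" where
  "phase_error w A t = (\<Sum>p\<in>A. (norm (cis (ln (real p) * t) - w p))\<^sup>2)"

lemma fejer_weight_nonneg: "fejer_weight K w A t \<ge> 0"
  unfolding fejer_weight_def by (intro prod_nonneg ballI fejer_kernel_nonneg)

lemma fejer_weight_le:
  assumes "\<And>p. norm (w p) = 1"
  shows "fejer_weight K w A t \<le> real K ^ card A"
  unfolding fejer_weight_def
  using prod_mono[of A "\<lambda>p. fejer_kernel K (w p) (ln (real p) * t)" "\<lambda>_. real K"]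
    fejer_kernel_nonneg fejer_kernel_le[OF assms] by simp

lemma continuous_on_fejer_weight: "continuous_on S (fejer_weight K w A)"
  unfolding fejer_weight_def by (intro continuous_on_prod continuous_on_fejer_kernel continuous_intros)

lemma phase_error_nonneg: "phase_error w A t \<ge> 0"
  unfolding phase_error_def by (intro sum_nonneg) auto

lemma phase_error_le:
  assumes "\<And>p. norm (w p) = 1"
  shows "phase_error w A t \<le> 4 * real (card A)"
proof -
  have "(norm (cis (ln (real p) * t) - w p))\<^sup>2 \<le> 2\<^sup>2" for p
    using norm_triangle_ineq4[of "cis (ln (real p) * t)" "w p"] assms by (intro power_mono) auto
  thus ?thesis
    unfolding phase_error_def using sum_mono[of A _ "\<lambda>_. 4 :: real"] by (simp add: mult.commute)
qed

lemma log_span_prime_multiples: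
  assumes "prime p"
  shows "of_int k * ln (real p) \<in> log_span {p}"
  using assms prime_gt_0_nat by (intro log_span_of_int_mult log_span_ln) (auto simp: prime_prime_factors)

lemma ln_prime_nonzero: "prime p \<Longrightarrow> ln (real p) \<noteq> 0"
  using prime_gt_1_nat[of p] by simp

lemma real_trigpoly_fejer_weight:
  assumes w: "\<And>p. norm (w p) = 1" and "K > 0" and A: "finite A" "\<And>p. p \<in> A \<Longrightarrow> prime p"
  shows "real_trigpoly X (log_span A) (\<lambda>x. fejer_weight K w A) (\<lambda>x. 1)"
  using A
proof (induction A rule: finite_induct)
  case empty
  from trigpoly.const[of "\<lambda>_. 1" X "log_span {}"] show ?case
    by (simp add: fejer_weight_def image_constant_conv)
next
  case (insert p A)
  have "real_trigpoly X (log_span {p}) (\<lambda>x t. fejer_kernel K (w p) (ln (real p) * t)) (\<lambda>x. 1)"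
    by (intro real_trigpoly_fejer_kernel w \<open>K > 0\<close> ln_prime_nonzero log_span_prime_multiples insert.prems) auto
  moreover have "real_trigpoly X (log_span A) (\<lambda>x. fejer_weight K w A) (\<lambda>x. 1)"
    using insert by simp
  ultimately have "real_trigpoly X (log_span ({p} \<union> A))
      (\<lambda>x t. fejer_kernel K (w p) (ln (real p) * t) * fejer_weight K w A t) (\<lambda>x. 1 * 1)"
    by (rule real_trigpoly_mult_log_span) (use insert in auto)
  with insert show ?case by (simp add: fejer_weight_def)
qed

definition mean_phase_error :: "nat \<Rightarrow> nat set \<Rightarrow> real" where
  "mean_phase_error K A = real (card A) * (2 / real K)"

lemma mean_phase_error_nonneg: "mean_phase_error K A \<ge> 0"
  by (simp add: mean_phase_error_def)

lemma real_trigpoly_fejer_weight_mult_phase_error: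
  assumes w: "\<And>p. norm (w p) = 1" and K: "K > 0" and A: "finite A" "\<And>p. p \<in> A \<Longrightarrow> prime p"
  shows "real_trigpoly X (log_span A) (\<lambda>x t. fejer_weight K w A t * phase_error w A t)
    (\<lambda>x. mean_phase_error K A)"
proof -
  let ?d = "\<lambda>p t. (norm (cis (ln (real p) * t) - w p))\<^sup>2"
  have "real_trigpoly X (log_span A) (\<lambda>x t. fejer_weight K w A t * ?d p t) (\<lambda>x. 2 / real K)" if p: "p \<in> A" for p
  proof -
    have "real_trigpoly X (log_span {p}) (\<lambda>x t. fejer_kernel K (w p) (ln (real p) * t) * ?d p t) (\<lambda>x. 2 / real K)"
      by (intro real_trigpoly_fejer_kernel_mult_norm_diff w K ln_prime_nonzero log_span_prime_multiples A(2) p)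
    moreover have "real_trigpoly X (log_span (A - {p})) (\<lambda>x. fejer_weight K w (A - {p})) (\<lambda>x. 1)"
      by (rule real_trigpoly_fejer_weight) (use assms in auto)
    ultimately have "real_trigpoly X (log_span ({p} \<union> (A - {p})))
        (\<lambda>x t. fejer_kernel K (w p) (ln (real p) * t) * ?d p t * fejer_weight K w (A - {p}) t) (\<lambda>x. 2 / real K * 1)"
      by (rule real_trigpoly_mult_log_span) auto
    moreover have "{p} \<union> (A - {p}) = A" using p by auto
    moreover have "fejer_weight K w A t = fejer_kernel K (w p) (ln (real p) * t) * fejer_weight K w (A - {p}) t" for t
      unfolding fejer_weight_def by (rule prod.remove[OF A(1) p])
    ultimately show ?thesis by (simp add: mult_ac)
  qed
  from real_trigpoly_sum[OF A(1) this] show ?thesis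
    by (simp add: phase_error_def mean_phase_error_def sum_distrib_left)
qed

section \<open>Powers of natural numbers and partial sums of Dirichlet series\<close>

lemma power2_norm_add_le:
  fixes x y :: "'a::real_normed_vector"
  shows "(norm (x + y))\<^sup>2 \<le> 2 * (norm x)\<^sup>2 + 2 * (norm y)\<^sup>2"
proof -
  have "(norm (x + y))\<^sup>2 \<le> (norm x + norm y)\<^sup>2" by (intro power_mono norm_triangle_ineq) auto
  also have "\<dots> \<le> 2 * (norm x)\<^sup>2 + 2 * (norm y)\<^sup>2"
    using sum_squares_bound[of "norm x" "norm y"] by (simp add: power2_sum)
  finally show ?thesis .
qed

lemma of_nat_mult_powr:
  assumes "m > 0" "n > 0"
  shows "complex_of_nat (m * n) powr z = of_nat m powr z * of_nat n powr z"
  using powr_times_real[of "of_nat m" "of_nat n" z] assms by simp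

lemma norm_of_nat_powr: "n > 0 \<Longrightarrow> norm (complex_of_nat n powr s) = real n powr Re s"
  by (subst norm_powr_real_powr) auto

lemma norm_of_nat_powr_le:
  assumes "n > 0" "Re s \<ge> r"
  shows "norm (complex_of_nat n powr (- s)) \<le> real n powr (- r)"
  using assms by (simp add: norm_of_nat_powr powr_mono)

lemma power2_powr: "(x powr a)\<^sup>2 = x powr (2 * a)" for x a :: real
  by (simp add: power2_eq_square flip: powr_add)

lemma sum_powr_le_tail:
  assumes "r > 1" "finite J" "\<And>n. n \<in> J \<Longrightarrow> n > y"
  shows "(\<Sum>n\<in>J. real n powr (- r)) \<le> (\<Sum>n. real (Suc (n + y)) powr (- r))"
proof -
  have "(\<Sum>n\<in>J. real n powr (- r)) = (\<Sum>n\<in>(\<lambda>n. n - Suc y) ` J. real (Suc (n + y)) powr (- r))"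
  proof (rule sum.reindex_cong[symmetric])
    show "inj_on (\<lambda>n. n - Suc y) J" using assms(3) by (intro inj_on_diff_nat Suc_leI) auto
    show "real (Suc (n - Suc y + y)) powr - r = real n powr - r" if "n \<in> J" for n
      using assms(3)[OF that] by simp
  qed simp
  also have "\<dots> \<le> (\<Sum>n. real (Suc (n + y)) powr (- r))"
    using summable_ignore_initial_segment[OF summable_Suc_powr[OF assms(1), of 1], of y] assms(2)
    by (intro sum_le_suminf) auto
  finally show ?thesis .
qed

lemma powr_tail_small:
  assumes "r > 1" "e > 0"
  obtains y where "\<And>J. finite J \<Longrightarrow> (\<And>n. n \<in> J \<Longrightarrow> n > y) \<Longrightarrow> (\<Sum>n\<in>J. real n powr (- r)) \<le> e"
proof -
  have "summable (\<lambda>n. real (Suc n) powr (- r))"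
    using summable_Suc_powr[OF assms(1), of 1] by simp
  from suminf_exist_split[OF assms(2) this] obtain y
    where "norm (\<Sum>n. real (Suc (n + y)) powr (- r)) < e" by auto
  hence "(\<Sum>n. real (Suc (n + y)) powr (- r)) \<le> e" by simp
  thus thesis by (intro that[of y] order_trans[OF sum_powr_le_tail[OF assms(1)]])
qed

lemma norm_powr_Suc_diff_le:
  assumes "Re s \<ge> r" "r \<ge> 0"
  shows "norm (complex_of_nat (Suc n) powr (- s) - of_nat (Suc (Suc n)) powr (- s))
    \<le> norm s * real (Suc n) powr (- (1 + r))"
proof -
  have "em_term (\<lambda>_. 0) 0 n s =
      of_nat (Suc (Suc n)) powr (- s) - of_nat (Suc n) powr (- s) + s * em_term (\<lambda>_. 1) 1 n s"
    using em_by_parts[of "\<lambda>_. 0" "\<lambda>_. 1" 0 n s] by simp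
  hence "complex_of_nat (Suc n) powr (- s) - of_nat (Suc (Suc n)) powr (- s) = s * em_term (\<lambda>_. 1) 1 n s"
    by (simp add: em_term_def algebra_simps)
  moreover have "norm (em_term (\<lambda>_. 1) 1 n s) \<le> 1 * real (Suc n) powr (- (1 + r))"
    by (rule em_term_bound) (use assms in auto)
  ultimately show ?thesis by (simp add: norm_mult mult_left_mono)
qed

lemma abel_summation:
  fixes a f :: "nat \<Rightarrow> 'a::comm_ring"
  shows "(\<Sum>n=1..N. a n * f n) = (\<Sum>n=1..N. a n) * f (Suc N) + (\<Sum>n=1..N. (\<Sum>k=1..n. a k) * (f n - f (Suc n)))"
  by (induction N) (auto simp: algebra_simps)

lemma norm_dirichlet_sum_le:
  fixes a :: "nat \<Rightarrow> complex"
  assumes B: "\<And>n. norm (\<Sum>k=1..n. a k) \<le> B" and s: "Re s \<ge> r" "r > 0"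
  shows "norm (\<Sum>n=1..N. a n * of_nat n powr (- s)) \<le> B * (1 + norm s * (\<Sum>n. real (Suc n) powr (- (1 + r))))"
proof -
  let ?f = "\<lambda>n. complex_of_nat n powr (- s)"
  let ?g = "\<lambda>n. real n powr (- (1 + r))"
  have B0: "B \<ge> 0" using B[of 0] by simp
  have "norm (?f (Suc N)) \<le> real (Suc N) powr 0"
    unfolding norm_of_nat_powr[OF zero_less_Suc] using s by (intro powr_mono) auto
  hence boundary: "norm ((\<Sum>n=1..N. a n) * ?f (Suc N)) \<le> B * 1"
    unfolding norm_mult using B B0 by (intro mult_mono) auto
  have "norm (\<Sum>n=1..N. (\<Sum>k=1..n. a k) * (?f n - ?f (Suc n))) \<le> (\<Sum>n=1..N. B * (norm s * ?g n))"
  proof (rule sum_norm_le)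
    fix n assume "n \<in> {1..N}"
    then obtain k where "n = Suc k" by (cases n) auto
    hence "norm (?f n - ?f (Suc n)) \<le> norm s * ?g n"
      using norm_powr_Suc_diff_le[of r s k] s by simp
    thus "norm ((\<Sum>k=1..n. a k) * (?f n - ?f (Suc n))) \<le> B * (norm s * ?g n)"
      unfolding norm_mult using B B0 by (intro mult_mono) auto
  qed
  also have "\<dots> = B * norm s * (\<Sum>n=1..N. ?g n)" by (simp add: sum_distrib_left mult_ac)
  also have "\<dots> \<le> B * norm s * (\<Sum>n. ?g (Suc n))"
    using sum_powr_le_tail[of "1 + r" "{1..N}" 0] s B0 by (intro mult_left_mono) auto
  finally have "norm (\<Sum>n=1..N. (\<Sum>k=1..n. a k) * (?f n - ?f (Suc n))) \<le> B * norm s * (\<Sum>n. ?g (Suc n))" .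
  with boundary show ?thesis
    unfolding abel_summation[of a ?f N] by (intro norm_triangle_le) (simp add: algebra_simps)
qed

section \<open>Euler products at prescribed phases\<close>

definition primes_le :: "nat \<Rightarrow> nat set" where
  "primes_le y = {p. prime p \<and> p \<le> y}"

definition prime_index :: "nat \<Rightarrow> nat" where
  "prime_index n = card (primes_le n)"

lemma finite_primes_le [simp]: "finite (primes_le y)"
  unfolding primes_le_def by (rule finite_subset[of _ "{..y}"]) auto

lemma prime_primes_le: "p \<in> primes_le y \<Longrightarrow> prime p"
  by (simp add: primes_le_def)

lemma prime_index_0: "prime_index 0 = 0"
proof -
  have "primes_le 0 = {}" by (auto simp: primes_le_def)
  thus ?thesis by (simp add: prime_index_def)
qed

lemma prime_index_Suc: "prime_index (Suc n) = prime_index n + (if prime (Suc n) then 1 else 0)"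
proof -
  have "primes_le (Suc n) = (if prime (Suc n) then insert (Suc n) (primes_le n) else primes_le n)"
    by (auto simp: primes_le_def le_Suc_eq)
  moreover have "Suc n \<notin> primes_le n" by (simp add: primes_le_def)
  ultimately show ?thesis by (simp add: prime_index_def)
qed

lemma norm_sum_power_prime_index_le:
  fixes w :: complex
  assumes "w \<noteq> 1" "norm w = 1"
  shows "norm (\<Sum>n=1..N. if prime n then w ^ prime_index n else 0) \<le> 2 / norm (1 - w)"
proof -
  have "(1 - w) * (\<Sum>n=1..N. if prime n then w ^ prime_index n else 0) = w - w ^ Suc (prime_index N)"
    by (induction N) (auto simp: prime_index_0 prime_index_Suc algebra_simps)
  moreover have "norm (w - w ^ Suc (prime_index N)) \<le> 2"
    using norm_triangle_ineq4[of w "w ^ Suc (prime_index N)"] assms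
    by (simp add: norm_power norm_mult)
  ultimately have "norm (1 - w) * norm (\<Sum>n=1..N. if prime n then w ^ prime_index n else 0) \<le> 2"
    by (metis norm_mult)
  thus ?thesis using assms by (simp add: field_simps)
qed

definition euler_prod :: "nat set \<Rightarrow> complex \<Rightarrow> (nat \<Rightarrow> real) \<Rightarrow> complex" where
  "euler_prod A s \<theta> = (\<Prod>p\<in>A. inverse (1 - of_nat p powr (- s) * cis (\<theta> p)))"

lemma norm_inverse_one_minus_le_exp:
  fixes z :: complex
  assumes "norm z \<le> 3 / 4"
  shows "norm (inverse (1 - z)) \<le> exp (Re z + 4 * (norm z)\<^sup>2)"
proof -
  have "z \<noteq> 1" using assms by auto
  have "norm (Ln (1 + - z) - - z) \<le> (norm (- z))\<^sup>2 / (1 - norm (- z))"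
    by (rule Ln_approx_linear) (use assms in simp)
  also have "\<dots> \<le> (norm z)\<^sup>2 / (1 / 4)"
    using assms by (simp, intro divide_left_mono[of "1/4" _ "(norm z)\<^sup>2", simplified]) auto
  finally have "norm (Ln (1 - z) + z) \<le> 4 * (norm z)\<^sup>2" by simp
  hence "- Re (Ln (1 - z)) \<le> Re z + 4 * (norm z)\<^sup>2"
    using abs_Re_le_cmod[of "Ln (1 - z) + z"] by simp
  moreover have "norm (inverse (1 - z)) = exp (- Re (Ln (1 - z)))"
    using \<open>z \<noteq> 1\<close> by (metis exp_Ln exp_minus norm_exp_eq_Re norm_inverse right_minus_eq)
  ultimately show ?thesis by simp
qed

lemma norm_prime_powr_le:
  assumes "prime p" "Re s \<ge> 1 / 2"
  shows "norm (complex_of_nat p powr (- s)) \<le> 3 / 4"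
proof -
  have "norm (complex_of_nat p powr (- s)) \<le> real p powr (- (1 / 2))"
    using assms prime_gt_0_nat by (intro norm_of_nat_powr_le) auto
  also have "\<dots> \<le> 2 powr (- (1 / 2))" using prime_ge_2_nat[OF assms(1)] by (intro powr_mono2') auto
  also have "\<dots> = inverse (sqrt 2)" by (simp only: powr_minus powr_half_sqrt)
  also have "\<dots> \<le> inverse (4 / 3)"
    by (intro le_imp_inverse_le real_le_rsqrt) (auto simp: power2_eq_square)
  finally show ?thesis by simp
qed

lemma norm_euler_prod_le:
  assumes A: "finite A" "\<And>p. p \<in> A \<Longrightarrow> prime p" and s: "Re s \<ge> 1 / 2"
  shows "norm (euler_prod A s \<theta>) \<le>
    exp (Re (\<Sum>p\<in>A. of_nat p powr (- s) * cis (\<theta> p)) + 4 * (\<Sum>p\<in>A. real p powr (- (2 * Re s))))"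
proof -
  let ?z = "\<lambda>p. of_nat p powr (- s) * cis (\<theta> p)"
  have norm_z: "norm (?z p) = real p powr (- Re s)" if "p \<in> A" for p
    using A(2)[OF that] prime_gt_0_nat by (simp add: norm_mult norm_of_nat_powr)
  have "norm (euler_prod A s \<theta>) = (\<Prod>p\<in>A. norm (inverse (1 - ?z p)))"
    by (simp add: euler_prod_def prod_norm)
  also have "\<dots> \<le> (\<Prod>p\<in>A. exp (Re (?z p) + 4 * (norm (?z p))\<^sup>2))"
    using norm_prime_powr_le[OF A(2) s]
    by (intro prod_mono conjI norm_inverse_one_minus_le_exp) (auto simp: norm_mult)
  also have "\<dots> = exp (\<Sum>p\<in>A. Re (?z p) + 4 * (norm (?z p))\<^sup>2)" using A(1) by (simp add: exp_sum)
  also have "(\<Sum>p\<in>A. Re (?z p) + 4 * (norm (?z p))\<^sup>2) =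
      Re (\<Sum>p\<in>A. ?z p) + 4 * (\<Sum>p\<in>A. real p powr (- (2 * Re s)))"
    using norm_z by (simp add: sum.distrib sum_distrib_left power2_powr)
  finally show ?thesis .
qed

lemma euler_prod_prime_index_bounded:
  assumes u: "cis u \<noteq> 1" and r: "r > 1 / 2"
  obtains C where "\<And>s y. Re s \<ge> r \<Longrightarrow> norm s \<le> H \<Longrightarrow>
    norm (euler_prod (primes_le y) s (\<lambda>p. real (prime_index p) * u)) \<le> C"
proof -
  define B where "B = 2 / norm (1 - cis u)"
  define \<sigma> where "\<sigma> = (\<Sum>n. real (Suc n) powr (- (1 + r)))"
  define \<sigma>2 where "\<sigma>2 = (\<Sum>n. real (Suc (n + 0)) powr (- (2 * r)))"
  have B: "B \<ge> 0" by (simp add: B_def)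
  have \<sigma>: "\<sigma> \<ge> 0" unfolding \<sigma>_def
    using summable_Suc_powr[of "1 + r" 1] r by (intro suminf_nonneg) auto
  show thesis
  proof (rule that)
    fix s y assume s: "Re s \<ge> r" "norm s \<le> H"
    let ?A = "primes_le y"
    have "(\<Sum>p\<in>?A. of_nat p powr (- s) * cis (real (prime_index p) * u)) =
        (\<Sum>n=1..y. (if prime n then cis u ^ prime_index n else 0) * of_nat n powr (- s))"
      by (rule sum.mono_neutral_cong_left)
         (auto simp: primes_le_def Complex.DeMoivre mult.commute dest: prime_gt_0_nat)
    hence "Re (\<Sum>p\<in>?A. of_nat p powr (- s) * cis (real (prime_index p) * u)) \<le> B * (1 + norm s * \<sigma>)"
      using norm_dirichlet_sum_le[OF norm_sum_power_prime_index_le[OF u norm_cis] s(1), of y] r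
      unfolding B_def \<sigma>_def by (intro order_trans[OF complex_Re_le_cmod]) simp
    also have "\<dots> \<le> B * (1 + H * \<sigma>)"
      using s B \<sigma> by (intro mult_left_mono add_left_mono mult_right_mono) auto
    finally have linear: "Re (\<Sum>p\<in>?A. of_nat p powr (- s) * cis (real (prime_index p) * u)) \<le> B * (1 + H * \<sigma>)" .
    have "(\<Sum>p\<in>?A. real p powr (- (2 * Re s))) \<le> (\<Sum>p\<in>?A. real p powr (- (2 * r)))"
      using s prime_ge_1_nat by (intro sum_mono powr_mono) (auto simp: primes_le_def)
    also have "\<dots> \<le> \<sigma>2"
      unfolding \<sigma>2_def using r by (intro sum_powr_le_tail) (auto simp: primes_le_def prime_gt_0_nat)
    finally have "norm (euler_prod ?A s (\<lambda>p. real (prime_index p) * u)) \<le> exp (\<dots> * 4 + B * (1 + H * \<sigma>))"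
      using norm_euler_prod_le[of ?A s "\<lambda>p. real (prime_index p) * u"] prime_primes_le linear s r
      by (smt (verit) exp_le_cancel_iff finite_primes_le)
    thus "norm (euler_prod ?A s (\<lambda>p. real (prime_index p) * u)) \<le> exp (\<sigma>2 * 4 + B * (1 + H * \<sigma>))" .
  qed
qed

lemma norm_inverse_one_minus_mult:
  fixes u x y :: complex
  assumes u: "norm u \<le> 3 / 4" and x: "norm x = 1" and y: "norm y = 1"
  shows "norm (inverse (1 - u * x)) \<le> 4"
    and "norm (inverse (1 - u * x) - inverse (1 - u * y)) \<le> 12 * norm (x - y)"
proof -
  have ge: "norm (1 - u * z) \<ge> 1 / 4" if "norm z = 1" for z
    using norm_triangle_ineq2[of 1 "u * z"] u that by (simp add: norm_mult)
  have le: "norm (inverse (1 - u * z)) \<le> 4" if "norm z = 1" for z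
    using le_imp_inverse_le[OF ge[OF that]] by (simp add: norm_inverse)
  show "norm (inverse (1 - u * x)) \<le> 4" by (rule le[OF x])
  have "1 - u * x \<noteq> 0" "1 - u * y \<noteq> 0" using ge[OF x] ge[OF y] by auto
  hence "inverse (1 - u * x) - inverse (1 - u * y) =
      inverse (1 - u * x) * (u * (x - y)) * inverse (1 - u * y)"
    by (simp add: inverse_diff_inverse algebra_simps)
  also have "norm \<dots> \<le> 4 * (3 / 4 * norm (x - y)) * 4"
    unfolding norm_mult using le x y u by (intro mult_mono mult_nonneg_nonneg) auto
  finally show "norm (inverse (1 - u * x) - inverse (1 - u * y)) \<le> 12 * norm (x - y)" by simp
qed

lemma norm_euler_prod_diff_le:
  assumes A: "\<And>p. p \<in> A \<Longrightarrow> prime p" and s: "Re s \<ge> 1 / 2"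
  shows "norm (euler_prod A s \<theta> - euler_prod A s \<phi>) \<le>
    3 * 4 ^ card A * (\<Sum>p\<in>A. norm (cis (\<theta> p) - cis (\<phi> p)))"
proof -
  let ?f = "\<lambda>\<theta> p. inverse (1 - of_nat p powr (- s) * cis (\<theta> p)) / (4::complex)"
  note factor = norm_inverse_one_minus_mult[OF norm_prime_powr_le[OF A s] norm_cis norm_cis]
  have scaled: "euler_prod A s \<theta> = 4 ^ card A * (\<Prod>p\<in>A. ?f \<theta> p)" for \<theta>
    unfolding euler_prod_def by (simp add: prod_dividef)
  have "norm ((\<Prod>p\<in>A. ?f \<theta> p) - (\<Prod>p\<in>A. ?f \<phi> p)) \<le> (\<Sum>p\<in>A. norm (?f \<theta> p - ?f \<phi> p))"
    by (rule norm_prod_diff) (use factor(1) in \<open>simp_all add: norm_divide\<close>)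
  also have "\<dots> \<le> (\<Sum>p\<in>A. 3 * norm (cis (\<theta> p) - cis (\<phi> p)))"
    using factor(2) by (intro sum_mono) (simp add: norm_divide flip: diff_divide_distrib)
  finally have "4 ^ card A * norm ((\<Prod>p\<in>A. ?f \<theta> p) - (\<Prod>p\<in>A. ?f \<phi> p)) \<le>
      4 ^ card A * (3 * (\<Sum>p\<in>A. norm (cis (\<theta> p) - cis (\<phi> p))))"
    by (intro mult_left_mono) (simp_all add: sum_distrib_left)
  thus ?thesis
    unfolding scaled right_diff_distrib[symmetric] norm_mult norm_power norm_numeral by simp
qed

lemma norm_cis_of_int_mult_diff_le:
  "norm (cis (of_int a * u) - cis (of_int a * v)) \<le> \<bar>of_int a\<bar> * norm (cis u - cis v)"
proof -
  have of_nat: "norm (cis (real k * u) - cis (real k * v)) \<le> real k * norm (cis u - cis v)" for k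
    using norm_power_diff[of "cis u" "cis v" k] by (simp add: Complex.DeMoivre)
  show ?thesis
  proof (cases a rule: int_cases2)
    case (nonneg k)
    thus ?thesis using of_nat[of k] by simp
  next
    case (nonpos k)
    have "norm (cis (real k * u) - cis (real k * v)) = norm (cnj (cis (real k * u) - cis (real k * v)))"
      by (rule complex_mod_cnj[symmetric])
    also have "\<dots> = norm (cis (- (real k * u)) - cis (- (real k * v)))" by (simp add: cis_cnj)
    finally show ?thesis using of_nat[of k] nonpos by simp
  qed
qed

definition line_phase :: "real \<Rightarrow> nat \<Rightarrow> real" where
  "line_phase u p = - u * ln (real p)"

lemma of_nat_powr_line:
  assumes "n > 0"
  shows "complex_of_nat n powr (- (s + \<i> * of_real u)) = of_nat n powr (- s) * cis (line_phase u n)"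
proof -
  have "complex_of_nat n powr (- (s + \<i> * of_real u)) =
      exp (- s * of_real (ln (real n)) + \<i> * of_real (line_phase u n))"
    using assms by (simp add: line_phase_def powr_def Ln_of_nat algebra_simps)
  also have "\<dots> = exp (- s * of_real (ln (real n))) * cis (line_phase u n)"
    by (simp only: exp_add cis_conv_exp)
  finally show ?thesis using assms by (simp add: powr_def Ln_of_nat)
qed

lemma norm_euler_prod_line_phase_diff_le:
  assumes A: "\<And>p. p \<in> A \<Longrightarrow> prime p" and s: "Re s \<ge> 1 / 2"
  shows "(norm (euler_prod A s (line_phase (of_int c * t)) - euler_prod A s (\<lambda>p. of_int (- c) * \<phi> p)))\<^sup>2
    \<le> (3 * 4 ^ card A * \<bar>of_int c\<bar>)\<^sup>2 * real (card A) * phase_error (\<lambda>p. cis (\<phi> p)) A t"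
proof -
  let ?\<delta> = "\<lambda>p. norm (cis (ln (real p) * t) - cis (\<phi> p))"
  have "norm (cis (line_phase (of_int c * t) p) - cis (of_int (- c) * \<phi> p)) \<le> \<bar>of_int c\<bar> * ?\<delta> p" for p
    using norm_cis_of_int_mult_diff_le[of "- c" "ln (real p) * t" "\<phi> p"]
    by (simp add: line_phase_def mult_ac)
  hence "norm (euler_prod A s (line_phase (of_int c * t)) - euler_prod A s (\<lambda>p. of_int (- c) * \<phi> p))
      \<le> 3 * 4 ^ card A * (\<Sum>p\<in>A. \<bar>of_int c\<bar> * ?\<delta> p)"
    by (intro order_trans[OF norm_euler_prod_diff_le[OF A s]] mult_left_mono sum_mono) auto
  also have "\<dots> = 3 * 4 ^ card A * \<bar>of_int c\<bar> * (\<Sum>p\<in>A. ?\<delta> p)"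
    by (simp add: sum_distrib_left mult.assoc)
  finally have "norm (euler_prod A s (line_phase (of_int c * t)) - euler_prod A s (\<lambda>p. of_int (- c) * \<phi> p))
      \<le> 3 * 4 ^ card A * \<bar>of_int c\<bar> * (\<Sum>p\<in>A. ?\<delta> p)" .
  from power_mono[OF this norm_ge_zero]
  have "(norm (euler_prod A s (line_phase (of_int c * t)) - euler_prod A s (\<lambda>p. of_int (- c) * \<phi> p)))\<^sup>2
      \<le> (3 * 4 ^ card A * \<bar>of_int c\<bar>)\<^sup>2 * (\<Sum>p\<in>A. ?\<delta> p)\<^sup>2"
    by (simp only: power_mult_distrib)
  also have "\<dots> \<le> (3 * 4 ^ card A * \<bar>of_int c\<bar>)\<^sup>2 * (phase_error (\<lambda>p. cis (\<phi> p)) A t * real (card A))"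
    unfolding phase_error_def by (intro mult_left_mono sum_squared_le_sum_of_squares) auto
  finally show ?thesis by (simp add: mult_ac)
qed

lemma cis_common_root:
  fixes a b :: int
  assumes "a \<noteq> b"
  shows "cis (of_int (- a) * (real k * (2 * pi / of_int (a - b)))) = cis (of_int (- b) * (real k * (2 * pi / of_int (a - b))))"
proof -
  define v where "v = real k * (2 * pi / of_int (a - b))"
  have "of_int (- b) * v = of_int (- a) * v + 2 * pi * of_int (int k)"
    using assms by (simp add: v_def field_simps)
  also have "cis \<dots> = cis (of_int (- a) * v) * cis (2 * pi * of_int (int k))"
    by (rule cis_mult[symmetric])
  also have "cis (2 * pi * of_int (int k)) = 1" by (rule cis_multiple_2pi) auto
  finally show ?thesis unfolding v_def by simp
qed

lemma cis_common_root_ne_1: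
  fixes a b :: int
  assumes "\<bar>a - b\<bar> \<ge> 2" "gcd a b = 1"
  shows "cis (of_int (- a) * (2 * pi / of_int (a - b))) \<noteq> 1"
proof
  assume "cis (of_int (- a) * (2 * pi / of_int (a - b))) = 1"
  hence "cos (of_int (- a) * (2 * pi / of_int (a - b))) = 1" by (simp add: complex_eq_iff)
  then obtain n :: int where "of_int (- a) * (2 * pi / of_int (a - b)) = of_int n * 2 * pi"
    using cos_one_2pi_int[THEN iffD1] by blast
  moreover have "real_of_int (a - b) \<noteq> 0" using assms(1) by auto
  ultimately have "2 * pi * of_int (- a) = 2 * pi * of_int (n * (a - b))" by (simp add: field_simps)
  hence "real_of_int (- a) = of_int (n * (a - b))"
    using pi_gt_zero by (simp only: mult_cancel_left) simp
  hence "- a = n * (a - b)" by (simp only: of_int_eq_iff)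
  hence a: "a - b dvd a" by (metis dvd_minus_iff dvd_triv_right)
  hence "a - b dvd a - (a - b)" by (rule dvd_diff) simp
  with a have "a - b dvd gcd a b" by simp
  thus False using assms by (simp add: zdvd1_eq)
qed

lemma euler_prod_line_phase_near:
  assumes A: "\<And>p. p \<in> A \<Longrightarrow> prime p" and C: "finite C"
  shows "\<exists>D\<ge>0. \<forall>c\<in>C. \<forall>s t. 1 / 2 \<le> Re s \<longrightarrow>
    (norm (euler_prod A s (line_phase (of_int c * t)) - euler_prod A s (\<lambda>p. of_int (- c) * \<phi> p)))\<^sup>2
      \<le> D * phase_error (\<lambda>p. cis (\<phi> p)) A t"
proof (intro exI conjI ballI allI impI)
  let ?D = "(3 * 4 ^ card A)\<^sup>2 * real (card A) * (\<Sum>c\<in>C. (of_int c)\<^sup>2)"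
  show "?D \<ge> 0" by (intro mult_nonneg_nonneg sum_nonneg) auto
  fix c s t assume c: "c \<in> C" and s: "1 / 2 \<le> Re s"
  have "(norm (euler_prod A s (line_phase (of_int c * t)) - euler_prod A s (\<lambda>p. of_int (- c) * \<phi> p)))\<^sup>2
      \<le> (3 * 4 ^ card A * \<bar>of_int c\<bar>)\<^sup>2 * real (card A) * phase_error (\<lambda>p. cis (\<phi> p)) A t"
    by (rule norm_euler_prod_line_phase_diff_le[OF A s])
  also have "\<dots> = (3 * 4 ^ card A)\<^sup>2 * real (card A) * (of_int c)\<^sup>2 * phase_error (\<lambda>p. cis (\<phi> p)) A t"
    by (simp add: power_mult_distrib)
  also have "\<dots> \<le> ?D * phase_error (\<lambda>p. cis (\<phi> p)) A t"
    using C c by (intro mult_right_mono mult_left_mono phase_error_nonneg member_le_sum) auto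
  finally show "(norm (euler_prod A s (line_phase (of_int c * t)) - euler_prod A s (\<lambda>p. of_int (- c) * \<phi> p)))\<^sup>2
      \<le> ?D * phase_error (\<lambda>p. cis (\<phi> p)) A t" .
qed

text \<open>
  The phases \<open>arg (w p)\<close> make the Euler products at their multiples by \<open>- a\<close> and \<open>- b\<close> coincide; the
  common value \<open>E\<close> is bounded independently of \<open>y\<close> because these multiples run through the powers of
  a root of unity other than \<open>1\<close>.
\<close>

lemma euler_prod_common_phases:
  fixes a b :: int
  assumes ab: "\<bar>a - b\<bar> \<ge> 2" "gcd a b = 1" and r: "r > 1 / 2"
  obtains w E B where "\<And>p. norm (w p) = 1"
    "\<And>y s. r \<le> Re s \<Longrightarrow> norm s \<le> H \<Longrightarrow> norm (E y s) \<le> B"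
    "\<And>y. \<exists>D\<ge>0. \<forall>c\<in>{a, b}. \<forall>s t. r \<le> Re s \<longrightarrow>
       (norm (euler_prod (primes_le y) s (line_phase (of_int c * t)) - E y s))\<^sup>2 \<le> D * phase_error w (primes_le y) t"
proof -
  define v where "v = 2 * pi / real_of_int (a - b)"
  define \<phi> where "\<phi> = (\<lambda>p. real (prime_index p) * v)"
  define E where "E = (\<lambda>y s. euler_prod (primes_le y) s (\<lambda>p. of_int (- a) * \<phi> p))"
  have "a \<noteq> b" using ab by auto
  have E_eq: "E y s = euler_prod (primes_le y) s (\<lambda>p. of_int (- c) * \<phi> p)" if "c \<in> {a, b}" for c y s
    using that cis_common_root[OF \<open>a \<noteq> b\<close>] unfolding E_def euler_prod_def \<phi>_def v_def by auto
  obtain B where "\<And>s y. Re s \<ge> r \<Longrightarrow> norm s \<le> H \<Longrightarrow>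
      norm (euler_prod (primes_le y) s (\<lambda>p. real (prime_index p) * (of_int (- a) * v))) \<le> B"
    using euler_prod_prime_index_bounded[OF cis_common_root_ne_1[OF ab] r] unfolding v_def by blast
  hence B: "norm (E y s) \<le> B" if "r \<le> Re s" "norm s \<le> H" for y s
    using that unfolding E_def \<phi>_def by (simp add: mult_ac)
  have near: "\<exists>D\<ge>0. \<forall>c\<in>{a, b}. \<forall>s t. r \<le> Re s \<longrightarrow>
      (norm (euler_prod (primes_le y) s (line_phase (of_int c * t)) - E y s))\<^sup>2
        \<le> D * phase_error (\<lambda>p. cis (\<phi> p)) (primes_le y) t" for y
  proof -
    have "\<exists>D\<ge>0. \<forall>c\<in>{a, b}. \<forall>s t. 1 / 2 \<le> Re s \<longrightarrow>
        (norm (euler_prod (primes_le y) s (line_phase (of_int c * t))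
          - euler_prod (primes_le y) s (\<lambda>p. of_int (- c) * \<phi> p)))\<^sup>2
          \<le> D * phase_error (\<lambda>p. cis (\<phi> p)) (primes_le y) t"
      by (rule euler_prod_line_phase_near) (auto intro: prime_primes_le)
    thus ?thesis using E_eq r by (smt (verit))
  qed
  show thesis by (rule that[OF _ B near]) simp
qed

section \<open>Approximation of zeta by Euler--Maclaurin summation\<close>

lemma suminf_powr_le:
  assumes r: "r \<ge> 2" and N: "N \<ge> 1"
  shows "summable (\<lambda>n. real (n + N) powr (- r))"
    and "(\<Sum>n. real (n + N) powr (- r)) \<le> 2 * real N powr (1 - r)"
proof -
  let ?g = "\<lambda>n. real N powr (2 - r) * (2 * (1 / real (n + N) - 1 / real (Suc n + N)))"
  have "?g sums (real N powr (2 - r) * (2 * (1 / real (0 + N) - 0)))"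
    using LIMSEQ_ignore_initial_segment[OF lim_1_over_n, of N]
    by (intro sums_mult telescope_sums') simp
  moreover have "real N powr (2 - r) * (2 * (1 / real (0 + N) - 0)) = 2 * real N powr (1 - r)"
    using N powr_add[of "real N" "1 - r" 1] by (simp add: add_ac)
  ultimately have g: "?g sums (2 * real N powr (1 - r))" by (simp only:)
  have le: "real (n + N) powr (- r) \<le> ?g n" for n
  proof -
    define x where "x = real (n + N)"
    have x: "x \<ge> 1" "x \<ge> real N" using N by (auto simp: x_def)
    have "x powr (- r) = x powr (2 - r) * x powr (- 2)" by (simp only: powr_add[symmetric]) simp
    also have "x powr (- 2) = 1 / x\<^sup>2" using x by (simp add: powr_minus powr_numeral divide_inverse)
    also have "x powr (2 - r) * (1 / x\<^sup>2) \<le> real N powr (2 - r) * (2 * (1 / x - 1 / (x + 1)))"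
    proof (rule mult_mono)
      show "x powr (2 - r) \<le> real N powr (2 - r)" using r N x by (intro powr_mono2') auto
      have "x * (x + 1) \<le> 2 * x\<^sup>2" using x by (simp add: power2_eq_square algebra_simps)
      thus "1 / x\<^sup>2 \<le> 2 * (1 / x - 1 / (x + 1))" using x by (simp add: divide_simps)
    qed (use x in auto)
    finally show ?thesis by (simp add: x_def add_ac)
  qed
  show sm: "summable (\<lambda>n. real (n + N) powr (- r))"
    by (rule summable_comparison_test'[OF sums_summable[OF g], of 0]) (use le in auto)
  show "(\<Sum>n. real (n + N) powr (- r)) \<le> 2 * real N powr (1 - r)"
    using suminf_le[OF le sm sums_summable[OF g]] sums_unique[OF g] by simp
qed

lemma mean_zero_antiderivative:
  fixes p :: "real \<Rightarrow> 'a::banach"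
  assumes p: "continuous_on {0..1} p" "integral {0..1} p = 0"
  obtains q where "\<And>t. t \<in> {0..1} \<Longrightarrow> (q has_vector_derivative p t) (at t within {0..1})"
    "continuous_on {0..1} q" "integral {0..1} q = 0" "q 1 = q 0"
proof -
  define h where "h = (\<lambda>t. integral {0..t} p)"
  define q where "q = (\<lambda>t. h t - integral {0..1} h)"
  have h: "(h has_vector_derivative p t) (at t within {0..1})" if "t \<in> {0..1}" for t
    unfolding h_def using p that by (intro integral_has_vector_derivative)
  have ch: "continuous_on {0..1} h" by (rule continuous_on_vector_derivative) (rule h)
  show thesis
  proof (rule that)
    show "(q has_vector_derivative p t) (at t within {0..1})" if "t \<in> {0..1}" for t
      unfolding q_def using h[OF that] by (auto intro!: derivative_eq_intros)
    show "continuous_on {0..1} q" unfolding q_def by (intro continuous_intros ch)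
    show "integral {0..1} q = 0"
      unfolding q_def by (subst integral_diff) (auto intro!: integrable_continuous_real ch)
    show "q 1 = q 0" using p by (simp add: q_def h_def)
  qed
qed

lemma em_tail_step:
  assumes p: "continuous_on {0..1} p"
    and q: "\<And>t. t \<in> {0..1} \<Longrightarrow> (q has_vector_derivative p t) (at t within {0..1})"
    and "q 1 = q 0" and s: "Re s > 0" and k: "k \<ge> 1"
  shows "(\<Sum>n. em_term p k (n + N) s) =
    - q 0 * of_nat (Suc N) powr (- s - of_nat k) + (s + of_nat k) * (\<Sum>n. em_term q (Suc k) (n + N) s)"
proof -
  let ?u = "\<lambda>n. complex_of_nat (Suc (n + N)) powr (- s - of_nat k)"
  have cq: "continuous_on {0..1} q" by (rule continuous_on_vector_derivative) (rule q)
  have "?u \<longlonglongrightarrow> 0"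
    using LIMSEQ_ignore_initial_segment[OF Suc_powr_tendsto_0[of "- s - of_nat k"], of N] s by simp
  hence telescope: "(\<lambda>n. ?u (Suc n) - ?u n) sums (0 - ?u 0)" by (rule telescope_sums)
  have "summable (\<lambda>n. em_term q (Suc k) (n + N) s)"
    by (rule summable_ignore_initial_segment[OF em_summable[OF cq]]) (use s k in auto)
  hence "(\<lambda>n. q 0 * (?u (Suc n) - ?u n) + (s + of_nat k) * em_term q (Suc k) (n + N) s) sums
      (q 0 * (0 - ?u 0) + (s + of_nat k) * (\<Sum>n. em_term q (Suc k) (n + N) s))"
    by (intro sums_add sums_mult telescope summable_sums)
  moreover have "em_term p k (n + N) s =
      q 0 * (?u (Suc n) - ?u n) + (s + of_nat k) * em_term q (Suc k) (n + N) s" for n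
    by (subst em_by_parts[OF p q]) (use \<open>q 1 = q 0\<close> in \<open>auto simp: algebra_simps\<close>)
  ultimately show ?thesis by (simp add: sums_iff)
qed

lemma norm_em_tail_le:
  assumes p: "continuous_on {0..1} p" and B: "\<And>t. t \<in> {0..1} \<Longrightarrow> norm (p t) \<le> B"
    and r: "Re s + real k \<ge> 2"
  shows "norm (\<Sum>n. em_term p k (n + N) s) \<le> 2 * B * real (Suc N) powr (1 - Re s - real k)"
proof -
  let ?r = "Re s + real k"
  have B0: "B \<ge> 0" using B[of 0] norm_ge_zero[of "p 0"] by (simp del: norm_ge_zero)
  note powr_sum = suminf_powr_le[OF r, of "Suc N", simplified]
  have "norm (em_term p k (n + N) s) \<le> B * real (Suc (n + N)) powr (- ?r)" for n
    by (rule em_term_bound[OF p B]) (use r in auto)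
  hence "norm (\<Sum>n. em_term p k (n + N) s) \<le> (\<Sum>n. B * real (Suc (n + N)) powr (- ?r))"
    using powr_sum(1) by (intro norm_suminf_le summable_mult) (simp_all add: add_ac)
  also have "\<dots> \<le> B * (2 * real (Suc N) powr (1 - ?r))"
    using powr_sum B0 by (subst suminf_mult) (auto simp: add_ac intro!: mult_left_mono)
  finally show ?thesis by (simp add: algebra_simps)
qed

lemma norm_em_tail_step_le:
  fixes s :: complex and k i N :: nat
  defines "n \<equiv> real (Suc N)"
  assumes p: "continuous_on {0..1} p"
    and q: "\<And>t. t \<in> {0..1} \<Longrightarrow> (q has_vector_derivative p t) (at t within {0..1})"
    and "q 1 = q 0" and s: "Re s > 0" and k: "k \<ge> 1" and U: "norm s + real k \<le> U" "U \<le> n"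
    and C: "C \<ge> 0" "norm (\<Sum>n. em_term q (Suc k) (n + N) s) \<le>
      C * (n powr (- Re s - real (Suc k)) + U ^ i * n powr (1 - Re s - real (Suc k) - real i))"
  shows "norm (\<Sum>n. em_term p k (n + N) s) \<le>
    (norm (q 0) + C) * (n powr (- Re s - real k) + U ^ Suc i * n powr (1 - Re s - real k - real (Suc i)))"
proof -
  have U0: "U \<ge> 0" using U(1) norm_ge_zero[of s] by linarith
  have sk: "norm (s + of_nat k) \<le> U" using norm_triangle_ineq[of s "of_nat k"] U(1) by simp
  let ?E = "n powr (- Re s - real k)" and ?F = "U ^ Suc i * n powr (1 - Re s - real k - real (Suc i))"
  let ?Q = "\<Sum>n. em_term q (Suc k) (n + N) s"
  have step: "(\<Sum>n. em_term p k (n + N) s) = - q 0 * of_nat (Suc N) powr (- s - of_nat k) + (s + of_nat k) * ?Q"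
    by (rule em_tail_step[OF p _ \<open>q 1 = q 0\<close> s k]) (rule q)
  have "norm (\<Sum>n. em_term p k (n + N) s) \<le>
      norm (q 0) * norm (complex_of_nat (Suc N) powr (- s - of_nat k)) + norm (s + of_nat k) * norm ?Q"
    unfolding step by (intro norm_triangle_le) (simp add: norm_mult)
  also have "norm (complex_of_nat (Suc N) powr (- s - of_nat k)) = ?E"
    by (simp add: n_def norm_of_nat_powr del: of_nat_Suc)
  also have "norm (s + of_nat k) * norm ?Q \<le>
      U * (C * (n powr (- Re s - real (Suc k)) + U ^ i * n powr (1 - Re s - real (Suc k) - real i)))"
    using sk U0 by (intro mult_mono C) auto
  also have "\<dots> = C * (U * n powr (- Re s - real (Suc k)) + ?F)" by (simp add: algebra_simps)
  also have "\<dots> \<le> C * (?E + ?F)"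
  proof (intro mult_left_mono add_right_mono C)
    have "U * n powr (- Re s - real (Suc k)) \<le> n powr 1 * n powr (- Re s - real (Suc k))"
      using U(2) by (intro mult_right_mono) (auto simp: n_def)
    also have "\<dots> = ?E" by (simp only: powr_add[symmetric]) simp
    finally show "U * n powr (- Re s - real (Suc k)) \<le> ?E" .
  qed
  finally have "norm (\<Sum>n. em_term p k (n + N) s) \<le> norm (q 0) * ?E + C * (?E + ?F)" by simp
  also have "\<dots> \<le> (norm (q 0) + C) * (?E + ?F)" using U0 by (simp add: algebra_simps)
  finally show ?thesis .
qed

lemma em_tail_bound:
  assumes p: "continuous_on {0..1::real} p" "integral {0..1} p = (0::complex)" and "k \<ge> 1" "k + i \<ge> 2"
  shows "\<exists>C\<ge>0. \<forall>s N U. Re s > 0 \<longrightarrow> norm s + real k + real i \<le> U \<longrightarrow> U \<le> real (Suc N) \<longrightarrow>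
     norm (\<Sum>n. em_term p k (n + N) s) \<le>
       C * (real (Suc N) powr (- Re s - real k) + U ^ i * real (Suc N) powr (1 - Re s - real k - real i))"
  using assms
proof (induction i arbitrary: p k)
  case 0
  obtain B where B: "\<And>t. t \<in> {0..1} \<Longrightarrow> norm (p t) \<le> B" using em_bounded[OF 0(1)] by metis
  have B0: "B \<ge> 0" using B[of 0] norm_ge_zero[of "p 0"] by (simp del: norm_ge_zero)
  show ?case
    by (rule exI[of _ "2 * B"])
       (use B0 0(4) norm_em_tail_le[OF 0(1) B] in \<open>auto simp: distrib_left intro!: add_increasing\<close>)
next
  case (Suc i)
  obtain q where q: "\<And>t. t \<in> {0..1} \<Longrightarrow> (q has_vector_derivative p t) (at t within {0..1})"
      "continuous_on {0..1} q" "integral {0..1} q = 0" "q 1 = q 0"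
    using mean_zero_antiderivative[OF Suc.prems(1,2)] by blast
  obtain C where C: "C \<ge> 0" "\<And>s N U. Re s > 0 \<Longrightarrow> norm s + real (Suc k) + real i \<le> U \<Longrightarrow> U \<le> real (Suc N) \<Longrightarrow>
      norm (\<Sum>n. em_term q (Suc k) (n + N) s) \<le>
        C * (real (Suc N) powr (- Re s - real (Suc k)) + U ^ i * real (Suc N) powr (1 - Re s - real (Suc k) - real i))"
    using Suc.IH[OF q(2,3), of "Suc k"] Suc.prems by auto
  show ?case
  proof (intro exI[of _ "norm (q 0) + C"] conjI allI impI)
    fix s N U assume "Re s > 0" "norm s + real k + real (Suc i) \<le> U" "U \<le> real (Suc N)"
    thus "norm (\<Sum>n. em_term p k (n + N) s) \<le> (norm (q 0) + C) * (real (Suc N) powr (- Re s - real k)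
        + U ^ Suc i * real (Suc N) powr (1 - Re s - real k - real (Suc i)))"
      by (intro norm_em_tail_step_le[OF Suc.prems(1) q(1) q(4)] C Suc.prems(3)) auto
  qed (use C in auto)
qed

definition sawtooth :: "real \<Rightarrow> complex" where
  "sawtooth t = of_real t - 1 / 2"

lemma continuous_on_sawtooth: "continuous_on A sawtooth"
  unfolding sawtooth_def by (intro continuous_intros)

lemma integral_sawtooth: "integral {0..1} sawtooth = 0"
proof -
  let ?F = "\<lambda>t. (complex_of_real t)\<^sup>2 / 2 - complex_of_real t / 2"
  have "(sawtooth has_integral (?F 1 - ?F 0)) {0..1}"
    unfolding sawtooth_def
    by (rule fundamental_theorem_of_calculus)
       (auto intro!: derivative_eq_intros has_vector_derivative_real_field)
  thus ?thesis by (simp add: integral_unique)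
qed

lemma riemann_zeta_em:
  assumes "Re s > 0" "s \<noteq> 1"
  shows "riemann_zeta s = 1 / (s - 1) + 1 / 2 - s * (\<Sum>n. em_term sawtooth 1 n s)"
proof -
  let ?H = "{s. Re s > 0} - {1::complex}"
  let ?g = "\<lambda>s. 1 / (s - 1) + 1 / 2 - s * (\<Sum>n. em_term sawtooth 1 n s)"
  have em: "(\<lambda>s. \<Sum>n. em_term sawtooth 1 n s) holomorphic_on {s. Re s > 0}"
    using em_holomorphic[OF continuous_on_sawtooth, of 1] by simp
  show ?thesis
  proof (rule analytic_continuation_open[where s = "{s. Re s > 1}" and s' = ?H and f = riemann_zeta and g = ?g])
    show "{s. Re s > 1} \<noteq> {}" by (auto intro!: exI[of _ 2])
    show "connected ?H"
      by (intro connected_open_delete) (auto intro: convex_connected convex_halfspace_Re_gt open_halfspace_Re_gt)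
    show "open ?H" by (intro open_Diff open_halfspace_Re_gt) auto
    show "riemann_zeta holomorphic_on ?H"
      by (rule holomorphic_on_subset[OF riemann_zeta_holomorphic]) auto
    show "?g holomorphic_on ?H" by (intro holomorphic_intros holomorphic_on_subset[OF em]) auto
    show "riemann_zeta z = ?g z" if "z \<in> {s. Re s > 1}" for z
      using sums_unique2[OF riemann_zeta_sums[of z] em_base[of z]] that
      by (simp add: sawtooth_def[abs_def])
  qed (use assms open_halfspace_Re_gt in auto)
qed

lemma em_term_sawtooth:
  assumes "s \<noteq> 1"
  shows "s * em_term sawtooth 1 n s =
    (of_nat (Suc (Suc n)) powr (1 - s) - of_nat (Suc n) powr (1 - s)) / (1 - s)
    - 1 / 2 * (of_nat (Suc (Suc n)) powr (- s) + of_nat (Suc n) powr (- s))"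
proof -
  have "(sawtooth has_vector_derivative 1) (at t within {0..1})" for t
    unfolding sawtooth_def by (auto intro!: derivative_eq_intros)
  from em_by_parts[of "\<lambda>_. 1" sawtooth 0 n s, OF _ this]
  have first: "em_term (\<lambda>_. 1) 0 n s =
      1 / 2 * (of_nat (Suc (Suc n)) powr (- s) + of_nat (Suc n) powr (- s)) + s * em_term sawtooth 1 n s"
    by (simp add: sawtooth_def algebra_simps)
  have "em_term (\<lambda>_. 0) 0 n (s - 1) =
      of_nat (Suc (Suc n)) powr (1 - s) - of_nat (Suc n) powr (1 - s) + (s - 1) * em_term (\<lambda>_. 1) 1 n (s - 1)"
    using em_by_parts[of "\<lambda>_. 0" "\<lambda>_. 1" 0 n "s - 1"] by simp
  moreover have "em_term (\<lambda>_. 0) 0 n (s - 1) = 0" "em_term (\<lambda>_. 1) 1 n (s - 1) = em_term (\<lambda>_. 1) 0 n s"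
    by (simp_all add: em_term_def)
  ultimately have "em_term (\<lambda>_. 1) 0 n s = (of_nat (Suc (Suc n)) powr (1 - s) - of_nat (Suc n) powr (1 - s)) / (1 - s)"
    using assms by (simp add: field_simps)
  thus ?thesis unfolding first by (simp add: algebra_simps)
qed

lemma riemann_zeta_em_tail:
  assumes s: "Re s > 0" "s \<noteq> 1"
  shows "riemann_zeta s = (\<Sum>n=1..N. of_nat n powr (- s)) + of_nat (Suc N) powr (1 - s) / (s - 1)
     + of_nat (Suc N) powr (- s) / 2 - s * (\<Sum>n. em_term sawtooth 1 (n + N) s)"
proof (induction N)
  case 0
  show ?case using riemann_zeta_em[OF s] by simp
next
  case (Suc N)
  have "summable (\<lambda>n. em_term sawtooth 1 n s)"
    by (rule em_summable[OF continuous_on_sawtooth]) (use s in auto)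
  from suminf_split_head[OF summable_ignore_initial_segment[OF this, of N]]
  have split: "(\<Sum>n. em_term sawtooth 1 (n + N) s) = em_term sawtooth 1 N s + (\<Sum>n. em_term sawtooth 1 (n + Suc N) s)"
    by simp
  have neg: "x / (s - 1) = - (x / (1 - s))" for x
    by (metis minus_diff_eq minus_divide_right)
  show ?case
    unfolding Suc split distrib_left em_term_sawtooth[OF s(2)] neg
    by (simp add: diff_divide_distrib add_divide_distrib algebra_simps)
qed

definition zeta_tail :: "nat \<Rightarrow> complex \<Rightarrow> complex" where
  "zeta_tail N s = riemann_zeta s - (\<Sum>n=1..N. of_nat n powr (- s))"

lemma norm_zeta_tail_le:
  assumes "i \<ge> 1"
  obtains C where "C \<ge> 0" "\<And>s N U. Re s > 0 \<Longrightarrow> s \<noteq> 1 \<Longrightarrow> norm s + 1 + real i \<le> U \<Longrightarrow> U \<le> real N \<Longrightarrow>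
    U ^ Suc i \<le> real N ^ i \<Longrightarrow> norm (zeta_tail N s)
      \<le> real (Suc N) powr (1 - Re s) / norm (s - 1) + C * real (Suc N) powr (- Re s)"
proof -
  obtain C where C: "C \<ge> 0" "\<And>s N U. Re s > 0 \<Longrightarrow> norm s + real 1 + real i \<le> U \<Longrightarrow> U \<le> real (Suc N) \<Longrightarrow>
      norm (\<Sum>n. em_term sawtooth 1 (n + N) s) \<le>
        C * (real (Suc N) powr (- Re s - real 1) + U ^ i * real (Suc N) powr (1 - Re s - real 1 - real i))"
    using em_tail_bound[OF continuous_on_sawtooth integral_sawtooth, of 1 i] assms by auto
  show thesis
  proof (rule that[of "2 * C + 1 / 2"])
    fix s N U assume s: "Re s > 0" "s \<noteq> 1" and U: "norm s + 1 + real i \<le> U" "U \<le> real N" "U ^ Suc i \<le> real N ^ i"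
    define n where "n = real (Suc N)"
    have n: "n \<ge> 1" "U \<le> n" using U(2) by (simp_all add: n_def)
    have U0: "U \<ge> 0" "norm s \<le> U" using U(1) norm_ge_zero[of s] by linarith+
    have Un: "U ^ Suc i \<le> n ^ i" using power_mono[of "real N" n i] U(3) by (simp add: n_def)
    let ?R = "\<Sum>n. em_term sawtooth 1 (n + N) s"
    have "norm (s * ?R) \<le> U * (C * (n powr (- Re s - 1) + U ^ i * n powr (- Re s - real i)))"
      unfolding norm_mult using C(2)[OF s(1), of U N] U U0 n unfolding n_def[symmetric]
      by (intro mult_mono) auto
    also have "\<dots> = C * (U * n powr (- Re s - 1) + U ^ Suc i * n powr (- Re s - real i))"
      by (simp add: algebra_simps)
    also have "\<dots> \<le> C * (n powr 1 * n powr (- Re s - 1) + n powr real i * n powr (- Re s - real i))"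
      using Un C(1) n by (intro mult_left_mono add_mono mult_right_mono) (auto simp: powr_realpow)
    also have "\<dots> = 2 * C * n powr (- Re s)" by (simp only: powr_add[symmetric]) simp
    finally have R: "norm (s * ?R) \<le> 2 * C * n powr (- Re s)" .
    have "zeta_tail N s =
        of_nat (Suc N) powr (1 - s) / (s - 1) + of_nat (Suc N) powr (- s) / 2 - s * ?R"
      unfolding zeta_tail_def riemann_zeta_em_tail[OF s, of N] by simp
    also have "norm \<dots> \<le>
        norm (of_nat (Suc N) powr (1 - s) / (s - 1)) + norm (of_nat (Suc N) powr (- s) / 2) + norm (s * ?R)"
      by (meson norm_triangle_ineq4 norm_triangle_ineq order_trans add_right_mono)
    also have "\<dots> \<le> n powr (1 - Re s) / norm (s - 1) + n powr (- Re s) / 2 + 2 * C * n powr (- Re s)"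
      using R by (simp add: norm_divide norm_of_nat_powr n_def del: of_nat_Suc)
    finally show "norm (zeta_tail N s) \<le>
        real (Suc N) powr (1 - Re s) / norm (s - 1) + (2 * C + 1 / 2) * real (Suc N) powr (- Re s)"
      unfolding n_def by (simp add: algebra_simps)
  qed (use C in auto)
qed

section \<open>Mean squares of Dirichlet polynomials\<close>

lemma trig_sum_mean_square_le:
  fixes c :: "'j \<Rightarrow> complex"
  assumes J: "finite J" "inj_on \<omega> J" and "a \<le> b"
  shows "integral {a..b} (\<lambda>t. (norm (\<Sum>j\<in>J. c j * cis (\<omega> j * t)))\<^sup>2) \<le> (b - a) * (\<Sum>j\<in>J. (norm (c j))\<^sup>2)
    + (\<Sum>j\<in>J. \<Sum>k\<in>J - {j}. norm (c j) * norm (c k) * (2 / \<bar>\<omega> j - \<omega> k\<bar>))"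
proof -
  let ?F = "\<lambda>t. (norm (\<Sum>j\<in>J. c j * cis (\<omega> j * t)))\<^sup>2"
  let ?I = "\<lambda>j k. integral {a..b} (\<lambda>t. cis ((\<omega> j - \<omega> k) * t))"
  have "complex_of_real (integral {a..b} ?F) =
      integral {a..b} (\<lambda>t. \<Sum>j\<in>J. \<Sum>k\<in>J. (c j * cnj (c k)) * cis ((\<omega> j - \<omega> k) * t))"
    unfolding norm_trig_sum_square[symmetric]
    by (rule integral_of_real_continuous[symmetric]) (intro continuous_intros)
  also have "\<dots> = (\<Sum>j\<in>J. \<Sum>k\<in>J. (c j * cnj (c k)) * ?I j k)"
    by (simp add: integral_sum J(1) integrable_continuous_real continuous_intros)
  finally have expand: "complex_of_real (integral {a..b} ?F) = (\<Sum>j\<in>J. \<Sum>k\<in>J. (c j * cnj (c k)) * ?I j k)" .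
  have "integral {a..b} ?F \<le> norm (complex_of_real (integral {a..b} ?F))"
    unfolding norm_of_real by (rule abs_ge_self)
  also have "\<dots> \<le> (\<Sum>j\<in>J. \<Sum>k\<in>J. norm (c j) * norm (c k) * norm (?I j k))"
    unfolding expand by (intro sum_norm_le) (simp add: norm_mult)
  also have "\<dots> = (\<Sum>j\<in>J. (b - a) * (norm (c j))\<^sup>2 + (\<Sum>k\<in>J - {j}. norm (c j) * norm (c k) * norm (?I j k)))"
    using J(1) \<open>a \<le> b\<close> by (intro sum.cong refl, subst sum.remove) (auto simp: power2_eq_square)
  also have "\<dots> \<le> (\<Sum>j\<in>J. (b - a) * (norm (c j))\<^sup>2 + (\<Sum>k\<in>J - {j}. norm (c j) * norm (c k) * (2 / \<bar>\<omega> j - \<omega> k\<bar>)))"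
    using J(2) \<open>a \<le> b\<close>
    by (intro sum_mono add_left_mono mult_left_mono norm_integral_cis_le) (auto simp: inj_on_def)
  finally show ?thesis by (simp add: sum.distrib sum_distrib_left)
qed

lemma sum_off_diagonal_symmetric:
  fixes f :: "'a::linorder \<Rightarrow> 'a \<Rightarrow> real"
  assumes "finite J" and sym: "\<And>m n. f m n = f n m"
  shows "(\<Sum>m\<in>J. \<Sum>n\<in>J - {m}. f m n) = 2 * (\<Sum>m\<in>J. \<Sum>n\<in>{n\<in>J. m < n}. f m n)"
proof -
  have "(\<Sum>n\<in>J - {m}. f m n) = (\<Sum>n\<in>{n\<in>J. m < n}. f m n) + (\<Sum>n\<in>{n\<in>J. n < m}. f m n)" for m
    using assms(1) by (subst sum.union_disjoint[symmetric]) (auto intro!: sum.cong)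
  moreover have "(\<Sum>m\<in>J. \<Sum>n\<in>{n\<in>J. n < m}. f m n) = (\<Sum>m\<in>J. \<Sum>n\<in>{n\<in>J. m < n}. f m n)"
    using sum.swap_restrict[OF assms(1,1), of f "\<lambda>m n. n < m"] by (simp add: sym)
  ultimately show ?thesis by (simp add: sum.distrib)
qed

lemma harm_le_ln: "N \<ge> 1 \<Longrightarrow> harm N \<le> 1 + ln (real N)"
  using euler_mascheroni_sequence_decreasing[of 1 N] by (simp add: harm_def)

lemma sum_powr_le_harm:
  assumes "\<alpha> \<le> 1"
  shows "(\<Sum>n=1..N. real n powr (- \<alpha>)) \<le> real N powr (1 - \<alpha>) * harm N"
  unfolding harm_def sum_distrib_left
proof (rule sum_mono)
  fix n assume n: "n \<in> {1..N}"
  have "real n powr (- \<alpha>) = real n powr (1 - \<alpha>) * inverse (real n)"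
    using n powr_add[of "real n" "1 - \<alpha>" "- 1"] by (simp add: powr_minus)
  also have "\<dots> \<le> real N powr (1 - \<alpha>) * inverse (real n)"
    using n assms by (intro mult_right_mono powr_mono2) auto
  finally show "real n powr (- \<alpha>) \<le> real N powr (1 - \<alpha>) * inverse (real n)" .
qed

lemma powr_over_ln_diff_le:
  fixes r x y z :: real
  assumes "r \<le> 1" "0 < x" "x < y" "y \<le> z"
  shows "x powr (- r) * y powr (- r) / (ln y - ln x) \<le> z powr (1 - r) * x powr (- r) * inverse (y - x)"
proof -
  have "ln (x / y) \<le> x / y - 1" using assms by (intro ln_le_minus_one) auto
  hence "(y - x) / y \<le> ln y - ln x" using assms by (simp add: ln_div diff_divide_distrib)
  hence "x powr (- r) * y powr (- r) / (ln y - ln x) \<le> x powr (- r) * y powr (- r) / ((y - x) / y)"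
    using assms by (intro divide_left_mono mult_nonneg_nonneg mult_pos_pos) auto
  also have "\<dots> = x powr (- r) * (y powr (- r) * y powr 1) * inverse (y - x)"
    using assms by (simp add: divide_inverse)
  also have "y powr (- r) * y powr 1 = y powr (1 - r)" by (simp only: powr_add[symmetric]) simp
  also have "x powr (- r) * y powr (1 - r) * inverse (y - x) \<le> x powr (- r) * z powr (1 - r) * inverse (y - x)"
    using assms by (intro mult_right_mono mult_left_mono powr_mono2) auto
  finally show ?thesis by (simp add: mult_ac)
qed

lemma sum_off_diagonal_le:
  assumes "r \<le> 1"
  shows "(\<Sum>m=1..N. \<Sum>n\<in>{n\<in>{1..N}. m < n}. real m powr (- r) * real n powr (- r) / (ln (real n) - ln (real m)))
     \<le> real N powr (2 - 2 * r) * (harm N)\<^sup>2"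
proof -
  let ?D = "\<lambda>m. {n\<in>{1..N}. m < n}"
  have inner: "(\<Sum>n\<in>?D m. inverse (real n - real m)) \<le> harm N" for m
  proof -
    have "(\<Sum>n\<in>?D m. inverse (real n - real m)) = (\<Sum>k=1..N - m. inverse (real k))"
      by (rule sum.reindex_bij_witness[of _ "\<lambda>k. k + m" "\<lambda>n. n - m"]) (auto simp: of_nat_diff)
    also have "\<dots> \<le> harm N" using harm_mono[of "N - m" N] by (simp add: harm_def)
    finally show ?thesis .
  qed
  have "(\<Sum>m=1..N. \<Sum>n\<in>?D m. real m powr (- r) * real n powr (- r) / (ln (real n) - ln (real m)))
      \<le> (\<Sum>m=1..N. \<Sum>n\<in>?D m. real N powr (1 - r) * real m powr (- r) * inverse (real n - real m))"
    by (intro sum_mono powr_over_ln_diff_le) (use assms in auto)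
  also have "\<dots> = (\<Sum>m=1..N. real N powr (1 - r) * real m powr (- r) * (\<Sum>n\<in>?D m. inverse (real n - real m)))"
    by (simp add: sum_distrib_left)
  also have "\<dots> \<le> (\<Sum>m=1..N. real N powr (1 - r) * real m powr (- r) * harm N)"
    by (intro sum_mono mult_left_mono inner) auto
  also have "\<dots> = real N powr (1 - r) * harm N * (\<Sum>m=1..N. real m powr (- r))"
    by (simp add: sum_distrib_left mult_ac)
  also have "\<dots> \<le> real N powr (1 - r) * harm N * (real N powr (1 - r) * harm N)"
    using assms by (intro mult_left_mono sum_powr_le_harm) (auto simp: harm_nonneg)
  also have "\<dots> = (real N powr (1 - r))\<^sup>2 * (harm N)\<^sup>2" by (simp add: power2_eq_square mult_ac)
  finally show ?thesis by (simp add: power2_powr)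
qed

lemma dirichlet_poly_mean_square_le:
  fixes c :: "nat \<Rightarrow> complex"
  assumes J: "J \<subseteq> {1..N}" and c: "\<And>n. n \<in> J \<Longrightarrow> norm (c n) \<le> real n powr (- r)"
    and "r \<le> 1" "N \<ge> 1" "T \<ge> 0"
  shows "integral {-T..T} (\<lambda>t. (norm (\<Sum>n\<in>J. c n * cis (line_phase t n)))\<^sup>2)
     \<le> 2 * T * (\<Sum>n\<in>J. real n powr (- (2 * r))) + 4 * (real N powr (2 - 2 * r) * (1 + ln (real N))\<^sup>2)"
proof -
  let ?f = "\<lambda>m n. real m powr (- r) * real n powr (- r) * (2 / \<bar>ln (real m) - ln (real n)\<bar>)"
  have fin: "finite J" using J finite_subset by blast
  have inj: "inj_on (\<lambda>n. - ln (real n)) J"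
  proof (rule inj_onI)
    fix m n assume "m \<in> J" "n \<in> J" "- ln (real m) = - ln (real n)"
    moreover from this J have "m > 0" "n > 0" by auto
    ultimately show "m = n" by simp
  qed
  have "integral {-T..T} (\<lambda>t. (norm (\<Sum>n\<in>J. c n * cis (line_phase t n)))\<^sup>2) \<le> (T - (- T)) * (\<Sum>n\<in>J. (norm (c n))\<^sup>2)
      + (\<Sum>m\<in>J. \<Sum>n\<in>J - {m}. norm (c m) * norm (c n) * (2 / \<bar>- ln (real m) - - ln (real n)\<bar>))"
    using trig_sum_mean_square_le[OF fin inj, of "- T" T c] \<open>T \<ge> 0\<close>
    by (simp add: line_phase_def mult.commute)
  also have "\<dots> \<le> (T - (- T)) * (\<Sum>n\<in>J. (real n powr (- r))\<^sup>2) + (\<Sum>m\<in>J. \<Sum>n\<in>J - {m}. ?f m n)"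
    using c \<open>T \<ge> 0\<close>
    by (intro add_mono mult_left_mono sum_mono power_mono mult_mono)
       (auto intro!: divide_left_mono simp: abs_minus_commute)
  also have "(\<Sum>m\<in>J. \<Sum>n\<in>J - {m}. ?f m n) \<le> (\<Sum>m=1..N. \<Sum>n\<in>{1..N} - {m}. ?f m n)"
    using J by (intro order_trans[OF sum_mono sum_mono2] sum_mono2 sum_nonneg) auto
  also have "\<dots> = 2 * (\<Sum>m=1..N. \<Sum>n\<in>{n\<in>{1..N}. m < n}. ?f m n)"
    by (rule sum_off_diagonal_symmetric) (auto simp: abs_minus_commute)
  also have "\<dots> = 4 * (\<Sum>m=1..N. \<Sum>n\<in>{n\<in>{1..N}. m < n}.
      real m powr (- r) * real n powr (- r) / (ln (real n) - ln (real m)))"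
    by (auto simp: sum_distrib_left intro!: sum.cong)
  also have "\<dots> \<le> 4 * (real N powr (2 - 2 * r) * (harm N)\<^sup>2)"
    by (intro mult_left_mono sum_off_diagonal_le assms) auto
  also have "\<dots> \<le> 4 * (real N powr (2 - 2 * r) * (1 + ln (real N))\<^sup>2)"
    using harm_le_ln[OF \<open>N \<ge> 1\<close>] by (intro mult_left_mono power_mono) (auto simp: harm_nonneg)
  finally show ?thesis by (simp add: power2_powr)
qed

section \<open>The mean square of zeta minus a partial sum\<close>

lemma integral_inverse_pole_square_le:
  assumes "Re s \<le> \<rho>" "\<rho> < 1" "a \<le> b"
  shows "integral {a..b} (\<lambda>t. 1 / (norm (s + \<i> * of_real t - 1))\<^sup>2) \<le> pi / (1 - \<rho>)"
proof -
  define u where "u = 1 - Re s"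
  have u: "u > 0" "u \<ge> 1 - \<rho>" using assms by (auto simp: u_def)
  let ?F = "\<lambda>t. arctan ((Im s + t) / u) / u"
  have norm_eq: "(norm (s + \<i> * of_real t - 1))\<^sup>2 = u\<^sup>2 + (Im s + t)\<^sup>2" for t
    by (simp add: cmod_power2 u_def power2_commute)
  have "(?F has_vector_derivative 1 / (u\<^sup>2 + (Im s + t)\<^sup>2)) (at t within {a..b})" for t
  proof -
    have "(?F has_real_derivative (1 / (1 + ((Im s + t) / u)\<^sup>2) * (1 / u)) / u) (at t within {a..b})"
      using u by (auto intro!: derivative_eq_intros simp: divide_inverse)
    moreover have "u\<^sup>2 * (1 + ((Im s + t) / u)\<^sup>2) = u\<^sup>2 + (Im s + t)\<^sup>2"
      using u by (simp add: field_simps)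
    hence "(1 / (1 + ((Im s + t) / u)\<^sup>2) * (1 / u)) / u = 1 / (u\<^sup>2 + (Im s + t)\<^sup>2)"
      by (simp add: power2_eq_square mult_ac)
    ultimately show ?thesis by (simp add: has_real_derivative_iff_has_vector_derivative)
  qed
  hence "integral {a..b} (\<lambda>t. 1 / (norm (s + \<i> * of_real t - 1))\<^sup>2) = ?F b - ?F a"
    unfolding norm_eq by (intro integral_unique fundamental_theorem_of_calculus assms)
  also have "\<dots> \<le> pi / u"
    using arctan_bounded[of "(Im s + b) / u"] arctan_bounded[of "(Im s + a) / u"] u
    by (simp add: divide_right_mono flip: diff_divide_distrib)
  also have "\<dots> \<le> pi / (1 - \<rho>)" using u assms by (intro divide_left_mono) auto
  finally show ?thesis .
qed

lemma continuous_on_vertical_line: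
  assumes "f holomorphic_on - {1}" "Re s < 1"
  shows "continuous_on A (\<lambda>t. f (s + \<i> * of_real (c * t)))"
proof (rule continuous_on_compose2[OF holomorphic_on_imp_continuous_on[OF assms(1)]])
  show "(\<lambda>t. s + \<i> * of_real (c * t)) ` A \<subseteq> - {1}"
    using assms(2) by (auto simp: complex_eq_iff)
qed (intro continuous_intros)

lemma of_nat_powr_holomorphic: "(\<lambda>s. complex_of_nat n powr (- s)) holomorphic_on A"
proof (cases "n = 0")
  case False
  thus ?thesis unfolding powr_def by (auto intro!: holomorphic_intros)
qed simp

text \<open>
  The length must exceed \<open>T\<close> for the Euler--Maclaurin remainder to be small, but its power
  \<open>2 - 2 r < 1\<close> must stay below \<open>T\<close> for the off-diagonal terms.
\<close>

definition approx_length :: "real \<Rightarrow> real \<Rightarrow> nat" where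
  "approx_length \<kappa> T = nat \<lceil>(2 * T) powr \<kappa>\<rceil>"

lemma approx_length_ge:
  assumes "T \<ge> 1" "\<kappa> \<ge> 1"
  shows "real (approx_length \<kappa> T) \<ge> (2 * T) powr \<kappa>" "(2 * T) powr \<kappa> \<ge> 2 * T"
proof -
  show "real (approx_length \<kappa> T) \<ge> (2 * T) powr \<kappa>" unfolding approx_length_def by linarith
  show "(2 * T) powr \<kappa> \<ge> 2 * T" using powr_mono[of 1 \<kappa> "2 * T"] assms by simp
qed

lemma approx_length_asymp:
  assumes \<kappa>: "\<kappa> \<ge> 1" "\<kappa> * \<beta> < 1" and "\<beta> > 0" "c \<ge> 0" "\<eta> > 0"
  shows "\<forall>\<^sub>F T in at_top. c * (real (Suc (approx_length \<kappa> T)) powr \<beta> *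
    (1 + ln (real (Suc (approx_length \<kappa> T))))\<^sup>2) \<le> \<eta> * T"
proof -
  let ?y = "\<lambda>T. 3 * (2 * T) powr \<kappa>"
  have "((\<lambda>T. c * (?y T powr \<beta> * (1 + ln (?y T))\<^sup>2) / T) \<longlongrightarrow> 0) at_top"
    using assms by real_asymp
  hence "\<forall>\<^sub>F T in at_top. c * (?y T powr \<beta> * (1 + ln (?y T))\<^sup>2) / T < \<eta>"
    using \<open>\<eta> > 0\<close> by (rule order_tendstoD)
  thus ?thesis using eventually_ge_at_top[of 1]
  proof eventually_elim
    case (elim T)
    let ?n = "real (Suc (approx_length \<kappa> T))"
    have "?n \<le> (2 * T) powr \<kappa> + 2"
      unfolding approx_length_def using powr_ge_zero[of "2 * T" \<kappa>] by linarith
    hence "?n \<le> ?y T" using approx_length_ge(2)[OF elim(2) \<kappa>(1)] elim by linarith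
    moreover from this have "ln ?n \<le> ln (?y T)" by (subst ln_le_cancel_iff) auto
    ultimately have "c * (?n powr \<beta> * (1 + ln ?n)\<^sup>2) \<le> c * (?y T powr \<beta> * (1 + ln (?y T))\<^sup>2)"
      using assms by (intro mult_left_mono mult_mono power_mono powr_mono2 add_left_mono) auto
    also have "\<dots> \<le> \<eta> * T" using elim by (simp add: divide_less_eq)
    finally show ?case .
  qed
qed

lemma dirichlet_segment_mean_square_le:
  assumes J: "J \<subseteq> {1..N}" and "r \<le> Re s" "r \<le> 1" "N \<ge> 1" "T \<ge> 0"
  shows "integral {-T..T} (\<lambda>t. (norm (\<Sum>n\<in>J. of_nat n powr (- (s + \<i> * of_real t))))\<^sup>2)
     \<le> 2 * T * (\<Sum>n\<in>J. real n powr (- (2 * r))) + 4 * (real N powr (2 - 2 * r) * (1 + ln (real N))\<^sup>2)"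
proof -
  have "(\<Sum>n\<in>J. complex_of_nat n powr (- (s + \<i> * of_real t))) =
      (\<Sum>n\<in>J. of_nat n powr (- s) * cis (line_phase t n))" for t
    using J by (intro sum.cong of_nat_powr_line) auto
  moreover have "integral {-T..T} (\<lambda>t. (norm (\<Sum>n\<in>J. of_nat n powr (- s) * cis (line_phase t n)))\<^sup>2)
     \<le> 2 * T * (\<Sum>n\<in>J. real n powr (- (2 * r))) + 4 * (real N powr (2 - 2 * r) * (1 + ln (real N))\<^sup>2)"
    using assms by (intro dirichlet_poly_mean_square_le norm_of_nat_powr_le) auto
  ultimately show ?thesis by (simp only:)
qed

lemma dirichlet_segment_mean_square:
  assumes r: "1 / 2 < r" "r < 1" and \<kappa>: "\<kappa> \<ge> 1" "\<kappa> * (2 - 2 * r) < 1" and \<eta>: "\<eta> > 0"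
  obtains M0 where "\<And>M. M \<ge> M0 \<Longrightarrow> \<forall>\<^sub>F T in at_top. \<forall>s. r \<le> Re s \<longrightarrow>
    integral {-T..T} (\<lambda>t. (norm (\<Sum>n\<in>{M<..approx_length \<kappa> T}. of_nat n powr (- (s + \<i> * of_real t))))\<^sup>2) \<le> \<eta> * T"
proof -
  obtain M0 where M0: "\<And>J. finite J \<Longrightarrow> (\<And>n. n \<in> J \<Longrightarrow> n > M0) \<Longrightarrow> (\<Sum>n\<in>J. real n powr (- (2 * r))) \<le> \<eta> / 4"
    using powr_tail_small[of "2 * r" "\<eta> / 4"] r \<eta> by auto
  have asymp: "\<forall>\<^sub>F T in at_top. 4 * (real (Suc (approx_length \<kappa> T)) powr (2 - 2 * r) *
      (1 + ln (real (Suc (approx_length \<kappa> T))))\<^sup>2) \<le> \<eta> / 2 * T"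
    using \<kappa> r \<eta> by (intro approx_length_asymp) auto
  show thesis
  proof (rule that[of M0])
    fix M assume M: "M \<ge> M0"
    show "\<forall>\<^sub>F T in at_top. \<forall>s. r \<le> Re s \<longrightarrow> integral {-T..T}
      (\<lambda>t. (norm (\<Sum>n\<in>{M<..approx_length \<kappa> T}. of_nat n powr (- (s + \<i> * of_real t))))\<^sup>2) \<le> \<eta> * T"
      using asymp eventually_ge_at_top[of 1]
    proof eventually_elim
      case (elim T)
      define N where "N = approx_length \<kappa> T"
      have N: "N \<ge> 1" using approx_length_ge[OF elim(2) \<kappa>(1)] elim unfolding N_def by linarith
      have "2 * T * (\<Sum>n\<in>{M<..N}. real n powr (- (2 * r))) \<le> 2 * T * (\<eta> / 4)"
        using M elim by (intro mult_left_mono M0) auto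
      hence tail: "2 * T * (\<Sum>n\<in>{M<..N}. real n powr (- (2 * r))) \<le> \<eta> / 2 * T"
        by (simp add: mult.commute)
      have "real N powr (2 - 2 * r) * (1 + ln (real N))\<^sup>2 \<le> real (Suc N) powr (2 - 2 * r) * (1 + ln (real (Suc N)))\<^sup>2"
        using N r by (intro mult_mono power_mono powr_mono2 add_left_mono) auto
      hence "2 * T * (\<Sum>n\<in>{M<..N}. real n powr (- (2 * r))) + 4 * (real N powr (2 - 2 * r) * (1 + ln (real N))\<^sup>2) \<le> \<eta> * T"
        using tail elim(1)[folded N_def] by linarith
      moreover have "{M<..N} \<subseteq> {1..N}" by auto
      ultimately show ?case
        using dirichlet_segment_mean_square_le[OF _ _ _ N, of "{M<..N}" r] r elim
        unfolding N_def[symmetric] by (meson order_trans less_imp_le zero_le_one)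
    qed
  qed
qed

definition strip_box :: "real \<Rightarrow> real \<Rightarrow> real \<Rightarrow> complex set" where
  "strip_box r \<rho> H = {s. r \<le> Re s \<and> Re s \<le> \<rho> \<and> norm s \<le> H}"

lemma norm_zeta_tail_approx_length_le:
  fixes i :: nat
  defines "\<kappa> \<equiv> 1 + 1 / real i"
  assumes "i \<ge> 1" and r: "1 / 2 \<le> r" and \<rho>: "\<rho> < 1"
  obtains C where "C \<ge> 0" "\<And>T s t. T \<ge> 1 \<Longrightarrow> T \<ge> H + 1 + real i \<Longrightarrow> s \<in> strip_box r \<rho> H \<Longrightarrow> t \<in> {-T..T} \<Longrightarrow>
    norm (zeta_tail (approx_length \<kappa> T) (s + \<i> * of_real t)) \<le>
      real (Suc (approx_length \<kappa> T)) powr (1 - r) / norm (s + \<i> * of_real t - 1)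
      + C * real (Suc (approx_length \<kappa> T)) powr (- r)"
proof -
  have \<kappa>: "\<kappa> \<ge> 1" "\<kappa> * real i = real (Suc i)" using \<open>i \<ge> 1\<close> by (simp_all add: \<kappa>_def field_simps)
  from norm_zeta_tail_le[OF \<open>i \<ge> 1\<close>] obtain C where C: "C \<ge> 0" "\<And>s N U. Re s > 0 \<Longrightarrow> s \<noteq> 1 \<Longrightarrow>
      norm s + 1 + real i \<le> U \<Longrightarrow> U \<le> real N \<Longrightarrow> U ^ Suc i \<le> real N ^ i \<Longrightarrow>
      norm (zeta_tail N s) \<le> real (Suc N) powr (1 - Re s) / norm (s - 1) + C * real (Suc N) powr (- Re s)"
    by blast
  show thesis
  proof (rule that[OF C(1)])
    fix T s t assume T: "T \<ge> 1" "T \<ge> H + 1 + real i" and s: "s \<in> strip_box r \<rho> H" and t: "t \<in> {-T..T}"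
    define z where "z = s + \<i> * of_real t"
    define N where "N = approx_length \<kappa> T"
    have N: "2 * T \<le> real N" "(2 * T) powr \<kappa> \<le> real N"
      using approx_length_ge[OF T(1) \<kappa>(1)] unfolding N_def by linarith+
    have z: "r \<le> Re z" "Re z < 1" using s \<rho> by (auto simp: z_def strip_box_def)
    have "norm z \<le> norm s + \<bar>t\<bar>"
      using norm_triangle_ineq[of s "\<i> * of_real t"] by (simp add: z_def norm_mult)
    hence z_le: "norm z + 1 + real i \<le> 2 * T" using s t T by (auto simp: strip_box_def)
    have "(2 * T) ^ Suc i = (2 * T) powr (\<kappa> * real i)"
      using T by (simp only: \<kappa>(2), intro powr_realpow[symmetric]) simp
    also have "\<dots> = ((2 * T) powr \<kappa>) ^ i" using T by (simp add: powr_power mult.commute)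
    also have "\<dots> \<le> real N ^ i" using N by (intro power_mono) auto
    finally have "(2 * T) ^ Suc i \<le> real N ^ i" .
    moreover have "z \<noteq> 1" "Re z > 0" using z r by auto
    ultimately have "norm (zeta_tail N z) \<le>
        real (Suc N) powr (1 - Re z) / norm (z - 1) + C * real (Suc N) powr (- Re z)"
      by (intro C(2)[OF _ _ z_le N(1)])
    also have "\<dots> \<le> real (Suc N) powr (1 - r) / norm (z - 1) + C * real (Suc N) powr (- r)"
      using z C(1) by (intro add_mono divide_right_mono mult_left_mono powr_mono) auto
    finally show "norm (zeta_tail (approx_length \<kappa> T) (s + \<i> * of_real t)) \<le>
        real (Suc (approx_length \<kappa> T)) powr (1 - r) / norm (s + \<i> * of_real t - 1)
        + C * real (Suc (approx_length \<kappa> T)) powr (- r)"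
      unfolding z_def N_def .
  qed
qed

lemma zeta_tail_approx_length_square_le:
  fixes i :: nat
  defines "\<kappa> \<equiv> 1 + 1 / real i"
  assumes "i \<ge> 1" and r: "1 / 2 \<le> r" and \<rho>: "\<rho> < 1"
  obtains C where "C \<ge> 0" "\<And>T s t. T \<ge> 1 \<Longrightarrow> T \<ge> H + 1 + real i \<Longrightarrow> s \<in> strip_box r \<rho> H \<Longrightarrow> t \<in> {-T..T} \<Longrightarrow>
    (norm (zeta_tail (approx_length \<kappa> T) (s + \<i> * of_real t)))\<^sup>2
      \<le> 2 * real (Suc (approx_length \<kappa> T)) powr (2 - 2 * r) * (1 / (norm (s + \<i> * of_real t - 1))\<^sup>2) + C / T"
proof -
  from norm_zeta_tail_approx_length_le[OF \<open>i \<ge> 1\<close> r \<rho>, of H] obtain C where C: "C \<ge> 0"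
    "\<And>T s t. T \<ge> 1 \<Longrightarrow> T \<ge> H + 1 + real i \<Longrightarrow> s \<in> strip_box r \<rho> H \<Longrightarrow> t \<in> {-T..T} \<Longrightarrow>
      norm (zeta_tail (approx_length \<kappa> T) (s + \<i> * of_real t)) \<le>
        real (Suc (approx_length \<kappa> T)) powr (1 - r) / norm (s + \<i> * of_real t - 1)
        + C * real (Suc (approx_length \<kappa> T)) powr (- r)"
    unfolding \<kappa>_def by blast
  show thesis
  proof (rule that[of "2 * C\<^sup>2"])
    fix T s t assume T: "T \<ge> 1" "T \<ge> H + 1 + real i" and s: "s \<in> strip_box r \<rho> H" and t: "t \<in> {-T..T}"
    define n where "n = real (Suc (approx_length \<kappa> T))"
    let ?d = "norm (s + \<i> * of_real t - 1)"
    have "n \<ge> (2 * T) powr \<kappa>" "(2 * T) powr \<kappa> \<ge> 2 * T"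
      using approx_length_ge[OF T(1), of \<kappa>] by (simp_all add: n_def \<kappa>_def)
    hence n: "n \<ge> 1" "T \<le> n" using T by linarith+
    have "(norm (zeta_tail (approx_length \<kappa> T) (s + \<i> * of_real t)))\<^sup>2 \<le> (norm (n powr (1 - r) / ?d + C * n powr (- r)))\<^sup>2"
      using C(2)[OF T s t] unfolding n_def[symmetric] by (intro power_mono) auto
    also have "\<dots> \<le> 2 * (n powr (1 - r) / ?d)\<^sup>2 + 2 * (C * n powr (- r))\<^sup>2"
      using power2_norm_add_le[of "n powr (1 - r) / ?d" "C * n powr (- r)"] by simp
    also have "(C * n powr (- r))\<^sup>2 \<le> C\<^sup>2 * (1 / T)"
    proof -
      have "(n powr (- r))\<^sup>2 \<le> n powr (- 1)"
        unfolding power2_powr using n r by (intro powr_mono) auto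
      also have "\<dots> \<le> 1 / T" using n T by (simp add: powr_minus_divide frac_le)
      finally show ?thesis unfolding power_mult_distrib by (intro mult_left_mono) auto
    qed
    finally show "(norm (zeta_tail (approx_length \<kappa> T) (s + \<i> * of_real t)))\<^sup>2
      \<le> 2 * real (Suc (approx_length \<kappa> T)) powr (2 - 2 * r) * (1 / ?d\<^sup>2) + 2 * C\<^sup>2 / T"
      by (simp add: power_divide power2_powr n_def)
  qed (use C in auto)
qed

lemma integral_linear_combination:
  fixes f g :: "real \<Rightarrow> real"
  assumes "continuous_on {a..b} f" "continuous_on {a..b} g"
  shows "integral {a..b} (\<lambda>t. c * f t + d * g t) = c * integral {a..b} f + d * integral {a..b} g"
  by (intro integral_unique has_integral_add has_integral_mult_right integrable_integral
      integrable_continuous_real assms)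

lemma zeta_tail_holomorphic: "zeta_tail N holomorphic_on - {1}"
  unfolding zeta_tail_def
  by (intro holomorphic_on_diff holomorphic_on_sum riemann_zeta_holomorphic of_nat_powr_holomorphic)

lemma continuous_on_norm_square_vertical_line:
  assumes "f holomorphic_on - {1}" "Re s < 1"
  shows "continuous_on A (\<lambda>t. (norm (f (s + \<i> * of_real t)))\<^sup>2)"
  using continuous_on_vertical_line[OF assms, of A 1]
  by (intro continuous_on_power continuous_on_norm) simp

lemma integral_pole_plus_const_le:
  assumes "Re s \<le> \<rho>" "\<rho> < 1" "T > 0" "m \<ge> 0"
  shows "integral {-T..T} (\<lambda>t. 2 * m * (1 / (norm (s + \<i> * of_real t - 1))\<^sup>2) + C / T) \<le> 2 * m * (pi / (1 - \<rho>)) + 2 * C"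
    and "continuous_on {-T..T} (\<lambda>t. 2 * m * (1 / (norm (s + \<i> * of_real t - 1))\<^sup>2) + C / T)"
proof -
  let ?q = "\<lambda>t. 1 / (norm (s + \<i> * of_real t - 1))\<^sup>2"
  have "s + \<i> * of_real t \<noteq> 1" for t using assms by (auto simp: complex_eq_iff)
  hence cont: "continuous_on {-T..T} ?q" by (intro continuous_intros) auto
  thus "continuous_on {-T..T} (\<lambda>t. 2 * m * ?q t + C / T)"
    by (intro continuous_on_add continuous_on_mult continuous_on_const)
  have "integral {-T..T} (\<lambda>t. 2 * m * ?q t + C / T) = 2 * m * integral {-T..T} ?q + 2 * C"
    using integral_linear_combination[OF cont continuous_on_const, of "2 * m" 1 "C / T"] assms(3)
    by simp
  also have "\<dots> \<le> 2 * m * (pi / (1 - \<rho>)) + 2 * C"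
    using assms by (intro add_right_mono mult_left_mono integral_inverse_pole_square_le) auto
  finally show "integral {-T..T} (\<lambda>t. 2 * m * ?q t + C / T) \<le> 2 * m * (pi / (1 - \<rho>)) + 2 * C" .
qed

lemma zeta_tail_approx_length_mean_square:
  fixes i :: nat
  defines "\<kappa> \<equiv> 1 + 1 / real i"
  assumes "i \<ge> 1" and r: "1 / 2 \<le> r" "r < 1" and "\<kappa> * (2 - 2 * r) < 1" and \<rho>: "\<rho> < 1" and \<eta>: "\<eta> > 0"
  shows "\<forall>\<^sub>F T in at_top. \<forall>s\<in>strip_box r \<rho> H. integral {-T..T}
    (\<lambda>t. (norm (zeta_tail (approx_length \<kappa> T) (s + \<i> * of_real t)))\<^sup>2) \<le> \<eta> * T"
proof -
  from zeta_tail_approx_length_square_le[OF \<open>i \<ge> 1\<close> r(1) \<rho>, of H] obtain C where C: "C \<ge> 0"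
    "\<And>T s t. T \<ge> 1 \<Longrightarrow> T \<ge> H + 1 + real i \<Longrightarrow> s \<in> strip_box r \<rho> H \<Longrightarrow> t \<in> {-T..T} \<Longrightarrow>
    (norm (zeta_tail (approx_length \<kappa> T) (s + \<i> * of_real t)))\<^sup>2
      \<le> 2 * real (Suc (approx_length \<kappa> T)) powr (2 - 2 * r) * (1 / (norm (s + \<i> * of_real t - 1))\<^sup>2) + C / T"
    unfolding \<kappa>_def by blast
  define G where "G = 2 * (pi / (1 - \<rho>)) + 2 * C"
  have G: "G \<ge> 0" using C \<rho> by (simp add: G_def)
  have "\<kappa> \<ge> 1" by (simp add: \<kappa>_def)
  hence "\<forall>\<^sub>F T in at_top. G * (real (Suc (approx_length \<kappa> T)) powr (2 - 2 * r) *
      (1 + ln (real (Suc (approx_length \<kappa> T))))\<^sup>2) \<le> \<eta> * T"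
    using assms G by (intro approx_length_asymp) auto
  thus ?thesis using eventually_ge_at_top[of 1] eventually_ge_at_top[of "H + 1 + real i"]
  proof eventually_elim
    case (elim T)
    define m where "m = real (Suc (approx_length \<kappa> T)) powr (2 - 2 * r)"
    have m: "m \<ge> 1" unfolding m_def using r by (intro ge_one_powr_ge_zero) auto
    have "integral {-T..T} (\<lambda>t. (norm (zeta_tail (approx_length \<kappa> T) (s + \<i> * of_real t)))\<^sup>2) \<le> \<eta> * T"
      if s: "s \<in> strip_box r \<rho> H" for s
    proof -
      have "Re s \<le> \<rho>" "T > 0" "m \<ge> 0" using s elim m by (auto simp: strip_box_def)
      note pole = integral_pole_plus_const_le[OF this(1) \<rho> this(2,3)]
      have "integral {-T..T} (\<lambda>t. (norm (zeta_tail (approx_length \<kappa> T) (s + \<i> * of_real t)))\<^sup>2) \<le>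
          integral {-T..T} (\<lambda>t. 2 * m * (1 / (norm (s + \<i> * of_real t - 1))\<^sup>2) + C / T)"
        using \<open>Re s \<le> \<rho>\<close> \<rho> C(2)[OF elim(2,3) s]
        by (intro integral_le integrable_continuous_real pole continuous_on_norm_square_vertical_line
            zeta_tail_holomorphic) (auto simp: m_def)
      also have "\<dots> \<le> 2 * m * (pi / (1 - \<rho>)) + 2 * C" by (rule pole(1))
      also have "\<dots> \<le> G * (m * 1)"
        using m C(1) by (simp add: G_def algebra_simps mult_le_cancel_left1)
      also have "\<dots> \<le> G * (m * (1 + ln (real (Suc (approx_length \<kappa> T))))\<^sup>2)"
        using G m by (intro mult_left_mono one_le_power) auto
      also have "\<dots> \<le> \<eta> * T" using elim(1) by (simp only: m_def)
      finally show ?thesis .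
    qed
    thus ?case by blast
  qed
qed

lemma exists_approx_exponent:
  assumes "1 / 2 < r"
  obtains i :: nat where "i \<ge> 1" "(1 + 1 / real i) * (2 - 2 * r) < 1"
proof -
  obtain i where i: "1 / real (Suc i) < 2 * r - 1"
    using nat_approx_posE[of "2 * r - 1"] assms by auto
  have "(1 + 1 / real (Suc i)) * (2 - 2 * r) < 1"
  proof (cases "r \<le> 1")
    case True
    have "(1 + 1 / real (Suc i)) * (2 - 2 * r) \<le> (1 + (2 * r - 1)) * (2 - 2 * r)"
      using i True by (intro mult_right_mono) auto
    also have "\<dots> = 1 - (2 * r - 1)\<^sup>2" by (simp add: power2_eq_square algebra_simps)
    also have "\<dots> < 1" using assms by simp
    finally show ?thesis .
  next
    case False
    hence "(1 + 1 / real (Suc i)) * (2 - 2 * r) \<le> 0" by (intro mult_nonneg_nonpos) auto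
    thus ?thesis by simp
  qed
  thus thesis by (intro that[of "Suc i"]) auto
qed

lemma integral_norm_square_zeta_tail_le:
  assumes s: "Re s < 1" and "M \<le> N"
  shows "integral {a..b} (\<lambda>t. (norm (zeta_tail M (s + \<i> * of_real t)))\<^sup>2) \<le>
    2 * integral {a..b} (\<lambda>t. (norm (zeta_tail N (s + \<i> * of_real t)))\<^sup>2)
    + 2 * integral {a..b} (\<lambda>t. (norm (\<Sum>n\<in>{M<..N}. of_nat n powr (- (s + \<i> * of_real t))))\<^sup>2)"
proof -
  let ?D = "\<lambda>z. \<Sum>n\<in>{M<..N}. complex_of_nat n powr (- z)"
  let ?f = "\<lambda>f t. (norm (f (s + \<i> * of_real t)))\<^sup>2"
  have "?D holomorphic_on - {1}" by (intro holomorphic_on_sum of_nat_powr_holomorphic)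
  hence cont: "continuous_on {a..b} (?f (zeta_tail J))" "continuous_on {a..b} (?f ?D)" for J
    using continuous_on_norm_square_vertical_line[OF _ s] zeta_tail_holomorphic by blast+
  have "{1..N} = {1..M} \<union> {M<..N}" using \<open>M \<le> N\<close> by auto
  hence split: "(\<Sum>n=1..N. f n) = (\<Sum>n=1..M. f n) + (\<Sum>n\<in>{M<..N}. f n)" for f :: "nat \<Rightarrow> complex"
    by (simp only:) (intro sum.union_disjoint; auto)
  have "zeta_tail M z = zeta_tail N z + ?D z" for z
    unfolding zeta_tail_def split by simp
  hence "(norm (zeta_tail M z))\<^sup>2 \<le> 2 * (norm (zeta_tail N z))\<^sup>2 + 2 * (norm (?D z))\<^sup>2" for z
    by (simp only: power2_norm_add_le)
  hence "integral {a..b} (?f (zeta_tail M)) \<le> integral {a..b} (\<lambda>t. 2 * ?f (zeta_tail N) t + 2 * ?f ?D t)"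
    by (intro integral_le integrable_continuous_real continuous_on_add continuous_on_mult continuous_on_const cont)
  also have "\<dots> = 2 * integral {a..b} (?f (zeta_tail N)) + 2 * integral {a..b} (?f ?D)"
    by (intro integral_linear_combination cont)
  finally show ?thesis .
qed

lemma zeta_tail_mean_square:
  assumes r: "1 / 2 < r" "r < 1" and \<rho>: "\<rho> < 1" and \<eta>: "\<eta> > 0"
  obtains M0 where "\<And>M. M \<ge> M0 \<Longrightarrow> \<forall>\<^sub>F T in at_top. \<forall>s\<in>strip_box r \<rho> H. integral {-T..T}
    (\<lambda>t. (norm (zeta_tail M (s + \<i> * of_real t)))\<^sup>2) \<le> \<eta> * T"
proof -
  obtain i :: nat where i: "i \<ge> 1" "(1 + 1 / real i) * (2 - 2 * r) < 1"
    using exists_approx_exponent[OF r(1)] .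
  define \<kappa> where "\<kappa> = 1 + 1 / real i"
  have \<kappa>: "\<kappa> \<ge> 1" "\<kappa> * (2 - 2 * r) < 1" using i by (simp_all add: \<kappa>_def)
  have "\<eta> / 4 > 0" using \<eta> by simp
  from dirichlet_segment_mean_square[OF r \<kappa> this] obtain M0 where
    M0: "\<And>M. M \<ge> M0 \<Longrightarrow> \<forall>\<^sub>F T in at_top. \<forall>s. r \<le> Re s \<longrightarrow> integral {-T..T}
      (\<lambda>t. (norm (\<Sum>n\<in>{M<..approx_length \<kappa> T}. of_nat n powr (- (s + \<i> * of_real t))))\<^sup>2) \<le> \<eta> / 4 * T"
    by blast
  have long: "\<forall>\<^sub>F T in at_top. \<forall>s\<in>strip_box r \<rho> H. integral {-T..T}
      (\<lambda>t. (norm (zeta_tail (approx_length \<kappa> T) (s + \<i> * of_real t)))\<^sup>2) \<le> \<eta> / 4 * T"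
    unfolding \<kappa>_def by (rule zeta_tail_approx_length_mean_square) (use i r \<rho> \<eta> in auto)
  show thesis
  proof (rule that[of M0])
    fix M assume M: "M \<ge> M0"
    show "\<forall>\<^sub>F T in at_top. \<forall>s\<in>strip_box r \<rho> H. integral {-T..T}
      (\<lambda>t. (norm (zeta_tail M (s + \<i> * of_real t)))\<^sup>2) \<le> \<eta> * T"
      using long M0[OF M] eventually_ge_at_top[of 1] eventually_ge_at_top[of "real M"]
    proof eventually_elim
      case (elim T)
      have "M \<le> approx_length \<kappa> T" using approx_length_ge[OF elim(3) \<kappa>(1)] elim(3,4) by linarith
      show ?case
      proof
        fix s assume s: "s \<in> strip_box r \<rho> H"
        hence "Re s < 1" "r \<le> Re s" using \<rho> by (auto simp: strip_box_def)
        hence "integral {-T..T} (\<lambda>t. (norm (zeta_tail M (s + \<i> * of_real t)))\<^sup>2) \<le> 2 * (\<eta> / 4 * T) + 2 * (\<eta> / 4 * T)"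
          using elim(1,2) s
          by (intro order_trans[OF integral_norm_square_zeta_tail_le[OF _ \<open>M \<le> approx_length \<kappa> T\<close>]]
              add_mono mult_left_mono) auto
        thus "integral {-T..T} (\<lambda>t. (norm (zeta_tail M (s + \<i> * of_real t)))\<^sup>2) \<le> \<eta> * T"
          by (simp add: mult.commute)
      qed
    qed
  qed
qed

lemma compact_strip_bounds:
  assumes "compact X" "X \<subseteq> strip_D"
  obtains r \<rho> H where "1 / 2 < r" "r < 1" "\<rho> < 1" "X \<subseteq> strip_box r \<rho> H"
proof (cases "X = {}")
  case True
  thus thesis by (intro that[of "3 / 4" 0]) auto
next
  case False
  obtain s0 where s0: "s0 \<in> X" "\<And>s. s \<in> X \<Longrightarrow> Re s0 \<le> Re s"
    using continuous_attains_inf[OF assms(1) False continuous_on_Re[OF continuous_on_id]] by blast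
  obtain s1 where s1: "s1 \<in> X" "\<And>s. s \<in> X \<Longrightarrow> Re s \<le> Re s1"
    using continuous_attains_sup[OF assms(1) False continuous_on_Re[OF continuous_on_id]] by blast
  obtain H where "\<And>s. s \<in> X \<Longrightarrow> norm s \<le> H"
    using compact_imp_bounded[OF assms(1)] unfolding bounded_iff by blast
  hence "X \<subseteq> strip_box (Re s0) (Re s1) H" using s0 s1 by (auto simp: strip_box_def)
  moreover have "1 / 2 < Re s0" "Re s0 < 1" "Re s1 < 1"
    using s0(1) s1(1) assms(2) by (auto simp: strip_D_def)
  ultimately show thesis by (intro that)
qed

lemma zeta_tail_upper_mean:
  assumes X: "compact X" "X \<subseteq> strip_D" and "c \<noteq> 0" "\<eta> > 0"
  obtains M0 where "\<And>M. M \<ge> M0 \<Longrightarrow> upper_mean_le X (\<lambda>s t. (norm (zeta_tail M (s + \<i> * of_real (c * t))))\<^sup>2) \<eta>"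
proof -
  obtain r \<rho> H where box: "1 / 2 < r" "r < 1" "\<rho> < 1" "X \<subseteq> strip_box r \<rho> H"
    using compact_strip_bounds[OF X] .
  from zeta_tail_mean_square[OF box(1-3) \<open>\<eta> > 0\<close>] obtain M0 where
    M0: "\<And>M. M \<ge> M0 \<Longrightarrow> \<forall>\<^sub>F T in at_top. \<forall>s\<in>strip_box r \<rho> H. integral {-T..T} (\<lambda>t.
      (norm (zeta_tail M (s + \<i> * of_real t)))\<^sup>2) \<le> \<eta> * T"
    by blast
  show thesis
  proof (rule that[of M0], rule upper_mean_le_scale[OF _ _ _ \<open>c \<noteq> 0\<close>])
    fix M assume "M \<ge> M0"
    from M0[OF this] show "\<forall>\<^sub>F T in at_top. \<forall>s\<in>X. integral {-T..T} (\<lambda>t.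
      (norm (zeta_tail M (s + \<i> * of_real t)))\<^sup>2) \<le> \<eta> * T"
      by eventually_elim (use box(4) in blast)
  next
    fix M s assume "s \<in> X"
    hence "Re s < 1" using X(2) by (auto simp: strip_D_def)
    thus "continuous_on UNIV (\<lambda>t. (norm (zeta_tail M (s + \<i> * of_real t)))\<^sup>2)"
      by (rule continuous_on_norm_square_vertical_line[OF zeta_tail_holomorphic])
  qed auto
qed

section \<open>Zeta without its small Euler factors\<close>

definition rough_numbers :: "nat set \<Rightarrow> nat \<Rightarrow> nat set" where
  "rough_numbers A M = {l\<in>{1..M}. \<forall>p\<in>A. \<not> p dvd l}"

definition rough_zeta :: "nat set \<Rightarrow> complex \<Rightarrow> complex" where
  "rough_zeta A s = riemann_zeta s * (\<Prod>p\<in>A. 1 - of_nat p powr (- s))"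

definition rough_zeta_tail :: "nat set \<Rightarrow> nat \<Rightarrow> complex \<Rightarrow> complex" where
  "rough_zeta_tail A M s = rough_zeta A s - (\<Sum>l\<in>rough_numbers A M. of_nat l powr (- s))"

lemma finite_rough_numbers [simp]: "finite (rough_numbers A M)"
  by (simp add: rough_numbers_def)

lemma rough_numbers_pos: "l \<in> rough_numbers A M \<Longrightarrow> l > 0"
  by (simp add: rough_numbers_def)

lemma rough_numbers_insert:
  assumes p: "prime p" "p \<notin> A" and A: "\<And>q. q \<in> A \<Longrightarrow> prime q"
  shows "rough_numbers A M = rough_numbers (insert p A) M \<union> (*) p ` rough_numbers A (M div p)"
    and "rough_numbers (insert p A) M \<inter> (*) p ` rough_numbers A (M div p) = {}"
proof -
  have dvd: "q dvd p * l \<longleftrightarrow> q dvd l" if "q \<in> A" for q l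
  proof -
    have "\<not> q dvd p" using p A that primes_dvd_imp_eq by blast
    thus ?thesis using A[OF that] by (simp add: prime_dvd_mult_iff)
  qed
  have "l \<in> (*) p ` rough_numbers A (M div p)" if l: "l \<in> rough_numbers A M" and "p dvd l" for l
  proof -
    obtain k where k: "l = p * k" using \<open>p dvd l\<close> by blast
    hence "k \<in> rough_numbers A (M div p)"
      using l dvd prime_gt_0_nat[OF p(1)]
      by (auto simp: rough_numbers_def less_eq_div_iff_mult_less_eq mult.commute)
    thus ?thesis using k by blast
  qed
  moreover have "p * k \<in> rough_numbers A M" if "k \<in> rough_numbers A (M div p)" for k
    using that dvd prime_gt_0_nat[OF p(1)]
    by (auto simp: rough_numbers_def less_eq_div_iff_mult_less_eq mult.commute)
  ultimately show "rough_numbers A M = rough_numbers (insert p A) M \<union> (*) p ` rough_numbers A (M div p)"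
    by (auto simp: rough_numbers_def)
  show "rough_numbers (insert p A) M \<inter> (*) p ` rough_numbers A (M div p) = {}"
    by (auto simp: rough_numbers_def)
qed

lemma rough_zeta_tail_insert:
  assumes A: "finite A" "\<And>q. q \<in> A \<Longrightarrow> prime q" and p: "prime p" "p \<notin> A"
  shows "rough_zeta_tail (insert p A) M s =
    rough_zeta_tail A M s - of_nat p powr (- s) * rough_zeta_tail A (M div p) s"
proof -
  let ?S = "\<lambda>J. \<Sum>l\<in>J. complex_of_nat l powr (- s)"
  have p0: "p > 0" using p(1) by (rule prime_gt_0_nat)
  have "?S (rough_numbers A M) = ?S (rough_numbers (insert p A) M) + ?S ((*) p ` rough_numbers A (M div p))"
    by (subst rough_numbers_insert(1)[OF p A(2)], assumption, rule sum.union_disjoint)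
       (use rough_numbers_insert(2)[OF p A(2)] in auto)
  also have "?S ((*) p ` rough_numbers A (M div p)) = (\<Sum>k\<in>rough_numbers A (M div p). of_nat (p * k) powr (- s))"
    using p0 by (subst sum.reindex) (auto simp: inj_on_def)
  also have "\<dots> = of_nat p powr (- s) * ?S (rough_numbers A (M div p))"
    unfolding sum_distrib_left using p0
    by (intro sum.cong refl of_nat_mult_powr) (auto dest: rough_numbers_pos)
  finally show ?thesis
    using A(1) p(2) by (simp add: rough_zeta_tail_def rough_zeta_def algebra_simps)
qed

lemma norm_rough_zeta_tail_insert_le:
  assumes "finite A" "\<And>q. q \<in> A \<Longrightarrow> prime q" and p: "prime p" "p \<notin> A" and s: "Re s \<ge> 0"
  shows "(norm (rough_zeta_tail (insert p A) M s))\<^sup>2 \<le>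
    2 * (norm (rough_zeta_tail A M s))\<^sup>2 + 2 * (norm (rough_zeta_tail A (M div p) s))\<^sup>2"
proof -
  let ?y = "of_nat p powr (- s) * rough_zeta_tail A (M div p) s"
  have "p > 0" using p(1) by (rule prime_gt_0_nat)
  hence "norm (complex_of_nat p powr (- s)) \<le> 1" using norm_of_nat_powr_le[of p 0 s] s by simp
  hence "norm ?y \<le> norm (rough_zeta_tail A (M div p) s)"
    by (simp add: norm_mult mult_left_le_one_le)
  hence "(norm ?y)\<^sup>2 \<le> (norm (rough_zeta_tail A (M div p) s))\<^sup>2" by (intro power_mono) auto
  moreover have "(norm (rough_zeta_tail A M s - ?y))\<^sup>2 \<le> 2 * (norm (rough_zeta_tail A M s))\<^sup>2 + 2 * (norm ?y)\<^sup>2"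
    using power2_norm_add_le[of "rough_zeta_tail A M s" "- ?y"] by simp
  moreover have insert: "rough_zeta_tail (insert p A) M s = rough_zeta_tail A M s - ?y"
    by (rule rough_zeta_tail_insert) (use assms in auto)
  ultimately show ?thesis unfolding insert by linarith
qed

lemma rough_zeta_tail_empty: "rough_zeta_tail {} = zeta_tail"
proof -
  have "rough_numbers {} M = {1..M}" for M by (auto simp: rough_numbers_def)
  thus ?thesis by (simp add: fun_eq_iff rough_zeta_tail_def rough_zeta_def zeta_tail_def)
qed

lemma rough_zeta_tail_holomorphic: "rough_zeta_tail A M holomorphic_on - {1}"
  unfolding rough_zeta_tail_def rough_zeta_def
  by (intro holomorphic_on_diff holomorphic_on_sum holomorphic_on_mult holomorphic_on_prod
      holomorphic_on_const riemann_zeta_holomorphic of_nat_powr_holomorphic)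

lemma rough_zeta_tail_upper_mean:
  assumes X: "compact X" "X \<subseteq> strip_D" and c: "c \<noteq> 0"
    and A: "finite A" "\<And>p. p \<in> A \<Longrightarrow> prime p" and "\<eta> > 0"
  shows "\<exists>M0. \<forall>M\<ge>M0. upper_mean_le X (\<lambda>s t. (norm (rough_zeta_tail A M (s + \<i> * of_real (c * t))))\<^sup>2) \<eta>"
  using A \<open>\<eta> > 0\<close>
proof (induction A arbitrary: \<eta> rule: finite_induct)
  case empty
  thus ?case using zeta_tail_upper_mean[OF X c, of \<eta>] unfolding rough_zeta_tail_empty by blast
next
  case (insert p A)
  have p: "prime p" "p > 0" using insert.prems prime_gt_0_nat by auto
  obtain M0 where M0: "\<And>M. M \<ge> M0 \<Longrightarrow>
      upper_mean_le X (\<lambda>s t. (norm (rough_zeta_tail A M (s + \<i> * of_real (c * t))))\<^sup>2) (\<eta> / 4)"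
    using insert.IH[of "\<eta> / 4"] insert.prems by auto
  have "upper_mean_le X (\<lambda>s t. (norm (rough_zeta_tail (insert p A) M (s + \<i> * of_real (c * t))))\<^sup>2) \<eta>"
    if M: "M \<ge> p * M0" for M
  proof (rule upper_mean_le_mono)
    have "M0 \<le> p * M0" using p(2) by simp
    hence "M0 \<le> M" using M by (rule order_trans)
    moreover have "M0 \<le> M div p"
      using M p(2) by (simp add: less_eq_div_iff_mult_less_eq mult.commute)
    ultimately show "upper_mean_le X (\<lambda>s t. 2 * (norm (rough_zeta_tail A M (s + \<i> * of_real (c * t))))\<^sup>2
        + 2 * (norm (rough_zeta_tail A (M div p) (s + \<i> * of_real (c * t))))\<^sup>2) (2 * (\<eta> / 4) + 2 * (\<eta> / 4))"
      by (intro upper_mean_le_add upper_mean_le_cmult M0) auto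
  next
    fix s t assume "s \<in> X"
    hence "Re (s + \<i> * of_real (c * t)) \<ge> 0" using X(2) by (auto simp: strip_D_def)
    thus "(norm (rough_zeta_tail (insert p A) M (s + \<i> * of_real (c * t))))\<^sup>2
      \<le> 2 * (norm (rough_zeta_tail A M (s + \<i> * of_real (c * t))))\<^sup>2
        + 2 * (norm (rough_zeta_tail A (M div p) (s + \<i> * of_real (c * t))))\<^sup>2"
      using insert by (intro norm_rough_zeta_tail_insert_le) auto
  next
    fix s T assume "s \<in> X"
    hence "Re s < 1" using X(2) by (auto simp: strip_D_def)
    thus "(\<lambda>t. (norm (rough_zeta_tail (insert p A) M (s + \<i> * of_real (c * t))))\<^sup>2) integrable_on {0..T}"
      by (intro integrable_continuous_real continuous_on_power continuous_on_norm
          continuous_on_vertical_line rough_zeta_tail_holomorphic)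
  qed simp
  thus ?case by blast
qed

lemma riemann_zeta_eq_euler_prod:
  assumes A: "\<And>p. p \<in> A \<Longrightarrow> prime p" and s: "Re s \<ge> 1 / 2"
  shows "riemann_zeta (s + \<i> * of_real u) = euler_prod A s (line_phase u) * rough_zeta A (s + \<i> * of_real u)"
proof -
  let ?z = "\<lambda>p. complex_of_nat p powr (- (s + \<i> * of_real u))"
  have "1 - ?z p \<noteq> 0" if "p \<in> A" for p
  proof
    assume "1 - ?z p = 0"
    hence "norm (?z p) = 1" by simp
    moreover have "norm (?z p) \<le> 3 / 4" by (rule norm_prime_powr_le[OF A[OF that]]) (use s in simp)
    ultimately show False by simp
  qed
  hence "(\<Prod>p\<in>A. inverse (1 - ?z p) * (1 - ?z p)) = 1" by (intro prod.neutral) simp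
  moreover have "euler_prod A s (line_phase u) = (\<Prod>p\<in>A. inverse (1 - ?z p))"
    unfolding euler_prod_def
    by (intro prod.cong refl) (simp only: of_nat_powr_line[OF prime_gt_0_nat[OF A]])
  ultimately show ?thesis by (simp add: rough_zeta_def prod.distrib mult_ac)
qed

lemma rough_numbers_primes_le:
  assumes "l \<in> rough_numbers (primes_le y) M" "l \<noteq> 1"
  shows "l > y"
proof -
  obtain q where q: "prime q" "q dvd l" using prime_factor_nat[OF assms(2)] by blast
  hence "q \<le> l" using assms(1) by (intro dvd_imp_le) (auto simp: rough_numbers_def)
  moreover have "\<not> q \<le> y" using assms(1) q by (auto simp: rough_numbers_def primes_le_def)
  ultimately show ?thesis by simp
qed

section \<open>Weighted mean squares of zeta\<close>

definition rough_sum_gt_1 :: "nat set \<Rightarrow> nat \<Rightarrow> complex \<Rightarrow> real \<Rightarrow> complex" where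
  "rough_sum_gt_1 A M s u = (\<Sum>l\<in>rough_numbers A M - {1}. of_nat l powr (- s) * cis (line_phase u l))"

lemma rough_zeta_eq:
  assumes "M \<ge> 1" "\<And>p. p \<in> A \<Longrightarrow> prime p"
  shows "rough_zeta A (s + \<i> * of_real u) = 1 + (rough_sum_gt_1 A M s u + rough_zeta_tail A M (s + \<i> * of_real u))"
proof -
  have "1 \<notin> A" using assms(2)[of 1] by auto
  hence "1 \<in> rough_numbers A M" using assms(1) by (auto simp: rough_numbers_def)
  hence "(\<Sum>l\<in>rough_numbers A M. of_nat l powr (- (s + \<i> * of_real u))) =
      1 + (\<Sum>l\<in>rough_numbers A M - {1}. of_nat l powr (- (s + \<i> * of_real u)) :: complex)"
    by (subst sum.remove) auto
  also have "(\<Sum>l\<in>rough_numbers A M - {1}. of_nat l powr (- (s + \<i> * of_real u)) :: complex) = rough_sum_gt_1 A M s u"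
    unfolding rough_sum_gt_1_def by (intro sum.cong of_nat_powr_line) (auto dest: rough_numbers_pos)
  finally show ?thesis by (simp add: rough_zeta_tail_def)
qed

lemma real_trigpoly_norm_square_rough_sum_gt_1:
  fixes c :: int
  assumes "c \<noteq> 0" and X: "\<And>s. s \<in> X \<Longrightarrow> Re s \<ge> 0"
  shows "real_trigpoly X (log_span (- A)) (\<lambda>s t. (norm (rough_sum_gt_1 A M s (of_int c * t)))\<^sup>2)
    (\<lambda>s. \<Sum>l\<in>rough_numbers A M - {1}. (norm (complex_of_nat l powr (- s)))\<^sup>2)"
proof -
  have ln: "ln (real l) \<in> log_span (- A)" if "l \<in> rough_numbers A M" for l
    using that by (intro log_span_ln) (auto simp: rough_numbers_def prime_factors_dvd)
  have "real_trigpoly X (log_span (- A))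
      (\<lambda>s t. (norm (\<Sum>l\<in>rough_numbers A M - {1}. of_nat l powr (- s) * cis (of_int (- c) * ln (real l) * t)))\<^sup>2)
      (\<lambda>s. \<Sum>l\<in>rough_numbers A M - {1}. (norm (complex_of_nat l powr (- s)))\<^sup>2)"
  proof (rule real_trigpoly_norm_square)
    show "inj_on (\<lambda>l. of_int (- c) * ln (real l)) (rough_numbers A M - {1})"
      using \<open>c \<noteq> 0\<close> by (auto simp: inj_on_def dest!: rough_numbers_pos)
    show "bounded ((\<lambda>s. complex_of_nat l powr (- s)) ` X)" if "l \<in> rough_numbers A M - {1}" for l
    proof (rule boundedI)
      have "l > 0" using that rough_numbers_pos by blast
      thus "norm z \<le> 1" if "z \<in> (\<lambda>s. complex_of_nat l powr (- s)) ` X" for z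
        using that norm_of_nat_powr_le[of l 0] X by auto
    qed
    show "of_int (- c) * ln (real j) - of_int (- c) * ln (real k) \<in> log_span (- A)"
      if "j \<in> rough_numbers A M - {1}" "k \<in> rough_numbers A M - {1}" for j k
      using that by (intro log_span_diff log_span_of_int_mult ln) auto
  qed simp
  thus ?thesis by (simp add: rough_sum_gt_1_def line_phase_def mult_ac)
qed

lemma norm_zeta_minus_euler_le:
  assumes A: "\<And>p. p \<in> A \<Longrightarrow> prime p" and s: "Re s \<ge> 1 / 2" and "M \<ge> 1"
    and near: "(norm (euler_prod A s (line_phase u) - E))\<^sup>2 \<le> \<delta>" and B: "norm E \<le> B"
  shows "(norm (riemann_zeta (s + \<i> * of_real u) - E))\<^sup>2 \<le> 2 * \<delta> +
    8 * (B\<^sup>2 + \<delta>) * ((norm (rough_sum_gt_1 A M s u))\<^sup>2 + (norm (rough_zeta_tail A M (s + \<i> * of_real u)))\<^sup>2)"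
proof -
  define P where "P = euler_prod A s (line_phase u)"
  define Q where "Q = rough_sum_gt_1 A M s u"
  define R where "R = rough_zeta_tail A M (s + \<i> * of_real u)"
  have "riemann_zeta (s + \<i> * of_real u) = P * (1 + (Q + R))"
    using riemann_zeta_eq_euler_prod[of A s u] rough_zeta_eq[of M A s u] assms
    by (simp add: P_def Q_def R_def)
  hence split: "riemann_zeta (s + \<i> * of_real u) - E = (P - E) + P * (Q + R)"
    by (simp add: algebra_simps)
  have "(norm (riemann_zeta (s + \<i> * of_real u) - E))\<^sup>2 \<le> 2 * (norm (P - E))\<^sup>2 + 2 * ((norm P)\<^sup>2 * (norm (Q + R))\<^sup>2)"
    unfolding split using power2_norm_add_le[of "P - E" "P * (Q + R)"]
    by (simp add: norm_mult power_mult_distrib)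
  also have "\<dots> \<le> 2 * \<delta> + 2 * ((2 * (B\<^sup>2 + \<delta>)) * (2 * ((norm Q)\<^sup>2 + (norm R)\<^sup>2)))"
  proof (intro add_mono mult_left_mono mult_mono)
    have "(norm E)\<^sup>2 \<le> B\<^sup>2" using B by (intro power_mono) auto
    thus "(norm P)\<^sup>2 \<le> 2 * (B\<^sup>2 + \<delta>)"
      using power2_norm_add_le[of E "P - E"] near by (simp add: P_def)
    show "(norm (Q + R))\<^sup>2 \<le> 2 * ((norm Q)\<^sup>2 + (norm R)\<^sup>2)"
      using power2_norm_add_le[of Q R] by simp
    have "\<delta> \<ge> 0" using near by (rule order_trans[OF zero_le_power2])
    thus "0 \<le> 2 * (B\<^sup>2 + \<delta>)" by simp
  qed (use near P_def in auto)
  finally show ?thesis by (simp add: Q_def R_def algebra_simps)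
qed

lemma continuous_on_weighted_norm_square:
  assumes "f holomorphic_on - {1}" "Re s < 1"
  shows "continuous_on S (\<lambda>t. fejer_weight K w A t * (norm (f (s + \<i> * of_real (c * t)) - E))\<^sup>2)"
  by (intro continuous_on_mult continuous_on_fejer_weight continuous_on_power continuous_on_norm
      continuous_on_diff continuous_on_const continuous_on_vertical_line assms)

lemma real_trigpoly_weighted_rough_sum_gt_1:
  fixes c :: int
  assumes w: "\<And>p. norm (w p) = 1" and K: "K > 0" and A: "finite A" "\<And>p. p \<in> A \<Longrightarrow> prime p"
    and "c \<noteq> 0" and X: "\<And>s. s \<in> X \<Longrightarrow> Re s \<ge> 0"
  shows "real_trigpoly X UNIV
    (\<lambda>s t. 2 * D * (fejer_weight K w A t * phase_error w A t)
      + 8 * ((B * fejer_weight K w A t + D * (fejer_weight K w A t * phase_error w A t))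
           * (norm (rough_sum_gt_1 A M s (of_int c * t)))\<^sup>2))
    (\<lambda>s. 2 * D * mean_phase_error K A + 8 * ((B + D * mean_phase_error K A) *
      (\<Sum>l\<in>rough_numbers A M - {1}. (norm (complex_of_nat l powr (- s)))\<^sup>2)))"
proof -
  note W = real_trigpoly_fejer_weight[OF w K A]
  note WS = real_trigpoly_fejer_weight_mult_phase_error[OF w K A]
  have WQ: "real_trigpoly X (log_span (A \<union> - A))
      (\<lambda>s t. (B * fejer_weight K w A t + D * (fejer_weight K w A t * phase_error w A t))
        * (norm (rough_sum_gt_1 A M s (of_int c * t)))\<^sup>2)
      (\<lambda>s. (B * 1 + D * mean_phase_error K A) * (\<Sum>l\<in>rough_numbers A M - {1}. (norm (complex_of_nat l powr (- s)))\<^sup>2))"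
    by (intro real_trigpoly_mult_log_span real_trigpoly_add real_trigpoly_cmult W WS
        real_trigpoly_norm_square_rough_sum_gt_1 \<open>c \<noteq> 0\<close> X) auto
  from real_trigpoly_add[OF real_trigpoly_cmult[OF trigpoly_mono[OF WS subset_UNIV]]
      real_trigpoly_cmult[OF trigpoly_mono[OF WQ subset_UNIV]]]
  show ?thesis by (simp only: mult_1_right)
qed

lemma weighted_zeta_le:
  assumes w: "\<And>p. norm (w p) = 1" and A: "\<And>p. p \<in> A \<Longrightarrow> prime p"
    and s: "Re s \<ge> 1 / 2" and "M \<ge> 1" and D: "D \<ge> 0"
    and near: "(norm (euler_prod A s (line_phase u) - E))\<^sup>2 \<le> D * phase_error w A t" and B: "norm E \<le> B"
  shows "fejer_weight K w A t * (norm (riemann_zeta (s + \<i> * of_real u) - E))\<^sup>2 \<le>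
    2 * D * (fejer_weight K w A t * phase_error w A t)
    + 8 * ((B\<^sup>2 * fejer_weight K w A t + D * (fejer_weight K w A t * phase_error w A t)) * (norm (rough_sum_gt_1 A M s u))\<^sup>2)
    + 8 * (real K ^ card A * (B\<^sup>2 + D * (4 * real (card A)))) * (norm (rough_zeta_tail A M (s + \<i> * of_real u)))\<^sup>2"
proof -
  let ?W = "fejer_weight K w A t" and ?S = "phase_error w A t"
  let ?Q = "(norm (rough_sum_gt_1 A M s u))\<^sup>2" and ?R = "(norm (rough_zeta_tail A M (s + \<i> * of_real u)))\<^sup>2"
  have "?W * (norm (riemann_zeta (s + \<i> * of_real u) - E))\<^sup>2 \<le>
      ?W * (2 * (D * ?S) + 8 * (B\<^sup>2 + D * ?S) * (?Q + ?R))"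
    by (intro mult_left_mono norm_zeta_minus_euler_le A s \<open>M \<ge> 1\<close> near B fejer_weight_nonneg)
  also have "\<dots> = 2 * D * (?W * ?S) + 8 * ((B\<^sup>2 * ?W + D * (?W * ?S)) * ?Q) + 8 * (?W * (B\<^sup>2 + D * ?S)) * ?R"
    by (simp add: algebra_simps)
  also have "\<dots> \<le> 2 * D * (?W * ?S) + 8 * ((B\<^sup>2 * ?W + D * (?W * ?S)) * ?Q)
      + 8 * (real K ^ card A * (B\<^sup>2 + D * (4 * real (card A)))) * ?R"
    using D by (intro add_left_mono mult_right_mono mult_left_mono mult_mono fejer_weight_le[OF w]
        phase_error_le[OF w] add_nonneg_nonneg mult_nonneg_nonneg phase_error_nonneg) auto
  finally show ?thesis .
qed

lemma weighted_zeta_upper_mean: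
  fixes c :: int
  assumes w: "\<And>p. norm (w p) = 1" and K: "K > 0" and A: "finite A" "\<And>p. p \<in> A \<Longrightarrow> prime p"
    and X: "compact X" "X \<subseteq> strip_D" "\<And>s. s \<in> X \<Longrightarrow> r \<le> Re s" and c: "c \<noteq> 0" and D: "D \<ge> 0"
    and near: "\<And>s t. s \<in> X \<Longrightarrow> (norm (euler_prod A s (line_phase (of_int c * t)) - E s))\<^sup>2 \<le> D * phase_error w A t"
    and B: "\<And>s. s \<in> X \<Longrightarrow> norm (E s) \<le> B"
    and \<tau>: "\<And>M. (\<Sum>l\<in>rough_numbers A M - {1}. real l powr (- (2 * r))) \<le> \<tau>"
    and \<eta>: "2 * D * mean_phase_error K A + 8 * ((B\<^sup>2 + D * mean_phase_error K A) * \<tau>) < \<eta>" (is "?\<mu> < \<eta>")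
  shows "upper_mean_le X (\<lambda>s t. fejer_weight K w A t *
    (norm (riemann_zeta (s + \<i> * of_real (of_int c * t)) - E s))\<^sup>2) \<eta>"
proof -
  let ?W = "fejer_weight K w A" and ?S = "phase_error w A"
  define G where "G = 8 * (real K ^ card A * (B\<^sup>2 + D * (4 * real (card A))))"
  define \<theta> where "\<theta> = (\<eta> - ?\<mu>) / (2 * (G + 1))"
  have G: "G \<ge> 0" unfolding G_def using D by simp
  have \<theta>: "\<theta> > 0" "G * \<theta> \<le> (\<eta> - ?\<mu>) / 2" using \<eta> G by (simp_all add: \<theta>_def field_simps)
  obtain M where M: "M \<ge> 1"
    "upper_mean_le X (\<lambda>s t. (norm (rough_zeta_tail A M (s + \<i> * of_real (of_int c * t))))\<^sup>2) \<theta>"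
    using rough_zeta_tail_upper_mean[OF X(1,2) _ A \<theta>(1), of "of_int c"] c
    by (auto intro: max.cobounded1 max.cobounded2)
  have strip: "Re s \<ge> 1 / 2" "Re s < 1" if "s \<in> X" for s using X(2) that by (auto simp: strip_D_def)
  have main: "upper_mean_le X (\<lambda>s t. 2 * D * (?W t * ?S t)
      + 8 * ((B\<^sup>2 * ?W t + D * (?W t * ?S t)) * (norm (rough_sum_gt_1 A M s (of_int c * t)))\<^sup>2)) ((?\<mu> + \<eta>) / 2)"
  proof (rule upper_mean_le_trigpoly[OF real_trigpoly_weighted_rough_sum_gt_1[OF w K A c]])
    show "Re s \<ge> 0" if "s \<in> X" for s using strip(1)[OF that] by simp
    fix s assume s: "s \<in> X"
    have "(norm (complex_of_nat l powr (- s)))\<^sup>2 \<le> real l powr (- (2 * r))" if "l \<in> rough_numbers A M" for l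
      using power_mono[OF norm_of_nat_powr_le[OF rough_numbers_pos[OF that] X(3)[OF s]], of 2]
      by (simp add: power2_powr)
    hence "(\<Sum>l\<in>rough_numbers A M - {1}. (norm (complex_of_nat l powr (- s)))\<^sup>2) \<le> \<tau>"
      by (intro order_trans[OF sum_mono \<tau>]) auto
    thus "2 * D * mean_phase_error K A + 8 * ((B\<^sup>2 + D * mean_phase_error K A) *
        (\<Sum>l\<in>rough_numbers A M - {1}. (norm (complex_of_nat l powr (- s)))\<^sup>2)) \<le> ?\<mu>"
      using D mean_phase_error_nonneg by (intro add_left_mono mult_left_mono) auto
  next
    show "?\<mu> < (?\<mu> + \<eta>) / 2" using \<eta> by (rule field_less_half_sum)
  qed blast
  from upper_mean_le_add[OF main upper_mean_le_cmult[OF M(2) G]] show ?thesis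
  proof (rule upper_mean_le_mono)
    show "(?\<mu> + \<eta>) / 2 + G * \<theta> \<le> \<eta>" using \<theta>(2) by (simp add: field_simps)
  qed (use strip in \<open>auto simp only: G_def intro!: weighted_zeta_le w A M D near B integrable_continuous_real
         continuous_on_weighted_norm_square riemann_zeta_holomorphic\<close>)
qed

lemma exists_fejer_parameters:
  fixes B \<eta> :: real
  assumes \<eta>: "\<eta> > 0"
  obtains \<tau> where "\<tau> > 0" "\<And>D A. D \<ge> 0 \<Longrightarrow>
    \<exists>K>0. 2 * D * mean_phase_error K A + 8 * ((B\<^sup>2 + D * mean_phase_error K A) * \<tau>) < \<eta>"
proof -
  define \<tau> where "\<tau> = min 1 (\<eta> / (32 * (B\<^sup>2 + 1)))"
  have B1: "B\<^sup>2 + 1 > 0" by (simp add: add_nonneg_pos)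
  have \<tau>: "\<tau> > 0" "\<tau> \<le> 1" using \<eta> B1 by (auto simp: \<tau>_def)
  have "\<tau> \<le> \<eta> / (32 * (B\<^sup>2 + 1))" by (simp add: \<tau>_def)
  hence "\<tau> * (32 * (B\<^sup>2 + 1)) \<le> \<eta>" using B1 by (simp add: pos_le_divide_eq)
  hence B\<tau>: "8 * (B\<^sup>2 * \<tau>) \<le> \<eta> / 4" using \<tau> by (simp add: algebra_simps)
  show thesis
  proof (rule that[OF \<tau>(1)])
    fix D and A :: "nat set" assume D: "D \<ge> (0 :: real)"
    define K where "K = nat \<lceil>40 * D * real (card A) / \<eta>\<rceil> + 1"
    define V where "V = mean_phase_error K A"
    have K: "K > 0" by (simp add: K_def)
    have "40 * D * real (card A) / \<eta> \<le> real K" unfolding K_def by linarith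
    hence "40 * D * real (card A) \<le> real K * \<eta>" using \<eta> by (simp add: pos_divide_le_eq)
    hence "20 * (D * V) \<le> \<eta>" using K unfolding V_def mean_phase_error_def by (simp add: field_simps)
    moreover have "D * V * \<tau> \<le> D * V * 1"
      using \<tau> D by (intro mult_left_mono) (simp_all add: V_def mean_phase_error_nonneg)
    ultimately have "2 * D * V + 8 * ((B\<^sup>2 + D * V) * \<tau>) < \<eta>"
      using B\<tau> \<eta> by (simp add: algebra_simps)
    thus "\<exists>K>0. 2 * D * mean_phase_error K A + 8 * ((B\<^sup>2 + D * mean_phase_error K A) * \<tau>) < \<eta>"
      using K unfolding V_def by blast
  qed
qed

lemma fejer_weight_mean_ge:
  assumes "\<And>p. norm (w p) = 1" "K > 0" "finite A" "\<And>p. p \<in> A \<Longrightarrow> prime p"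
  shows "\<forall>\<^sub>F T in at_top. T / 2 \<le> integral {0..T} (fejer_weight K w A)"
proof -
  have "real_trigpoly {()} (log_span A) (\<lambda>_. fejer_weight K w A) (\<lambda>_. 1)"
    by (rule real_trigpoly_fejer_weight[OF assms])
  from real_trigpoly_mean[OF this, of "1 / 2"] show ?thesis
    by (auto elim!: eventually_mono simp: abs_if split: if_splits)
qed

proposition weighted_zeta_common_approx:
  fixes a b :: int
  assumes ab: "\<bar>a - b\<bar> \<ge> 2" "gcd a b = 1" "a \<noteq> 0" "b \<noteq> 0"
    and X: "compact X" "X \<subseteq> strip_D" and \<eta>: "\<eta> > 0"
  obtains W G E where "continuous_on UNIV W" "\<And>t. 0 \<le> W t" "\<And>t. W t \<le> G"
    "\<forall>\<^sub>F T in at_top. T / 2 \<le> integral {0..T} W"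
    "\<And>c. c \<in> {a, b} \<Longrightarrow> upper_mean_le X
       (\<lambda>s t. W t * (norm (riemann_zeta (s + \<i> * of_real (of_int c * t)) - E s))\<^sup>2) \<eta>"
proof -
  obtain r \<rho> H where box: "1 / 2 < r" "X \<subseteq> strip_box r \<rho> H" using compact_strip_bounds[OF X] .
  have Xbox: "r \<le> Re s" "norm s \<le> H" if "s \<in> X" for s using box(2) that by (auto simp: strip_box_def)
  from euler_prod_common_phases[OF ab(1,2) box(1), of H] obtain w E B where
    w: "\<And>p. norm (w p) = 1" and B: "\<And>y s. r \<le> Re s \<Longrightarrow> norm s \<le> H \<Longrightarrow> norm (E y s) \<le> B"
    and near: "\<And>y. \<exists>D\<ge>0. \<forall>c\<in>{a, b}. \<forall>s t. r \<le> Re s \<longrightarrow>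
      (norm (euler_prod (primes_le y) s (line_phase (of_int c * t)) - E y s))\<^sup>2 \<le> D * phase_error w (primes_le y) t"
    by blast
  obtain \<tau> where \<tau>: "\<tau> > 0" "\<And>D A. D \<ge> 0 \<Longrightarrow>
      \<exists>K>0. 2 * D * mean_phase_error K A + 8 * ((B\<^sup>2 + D * mean_phase_error K A) * \<tau>) < \<eta>"
    using exists_fejer_parameters[OF \<eta>, of B] by blast
  obtain y where y: "\<And>J. finite J \<Longrightarrow> (\<And>n. n \<in> J \<Longrightarrow> n > y) \<Longrightarrow> (\<Sum>n\<in>J. real n powr (- (2 * r))) \<le> \<tau>"
    using powr_tail_small[of "2 * r" \<tau>] box(1) \<tau>(1) by auto
  define A where "A = primes_le y"
  have A: "finite A" "\<And>p. p \<in> A \<Longrightarrow> prime p" by (auto simp: A_def prime_primes_le)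
  have tail: "(\<Sum>l\<in>rough_numbers A M - {1}. real l powr (- (2 * r))) \<le> \<tau>" for M
    using rough_numbers_primes_le[of _ y M] by (intro y) (auto simp: A_def)
  obtain D where D: "D \<ge> 0" "\<And>c s t. c \<in> {a, b} \<Longrightarrow> r \<le> Re s \<Longrightarrow>
      (norm (euler_prod A s (line_phase (of_int c * t)) - E y s))\<^sup>2 \<le> D * phase_error w A t"
    using near[of y] unfolding A_def by blast
  obtain K where K: "K > 0" and
    small: "2 * D * mean_phase_error K A + 8 * ((B\<^sup>2 + D * mean_phase_error K A) * \<tau>) < \<eta>"
    using \<tau>(2)[OF D(1)] by blast
  have "upper_mean_le X (\<lambda>s t. fejer_weight K w A t *
      (norm (riemann_zeta (s + \<i> * of_real (of_int c * t)) - E y s))\<^sup>2) \<eta>" if "c \<in> {a, b}" for c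
    by (rule weighted_zeta_upper_mean[OF w K A X, where r = r and D = D and B = B and \<tau> = \<tau>])
       (use that ab small D B Xbox tail in auto)
  thus thesis
    by (intro that[of "fejer_weight K w A" "real K ^ card A" "E y"] continuous_on_fejer_weight
        fejer_weight_nonneg fejer_weight_le[OF w] fejer_weight_mean_ge[OF w K A])
qed

section \<open>From mean squares to positive density\<close>

lemma norm_le_circle_integral:
  assumes f: "f holomorphic_on cball z e" and e: "e > 0" and s: "norm (s - z) \<le> e / 2"
  shows "norm (f s) \<le> 2 * integral {0..1} (\<lambda>x. norm (f (circlepath z e x)))"
proof -
  let ?g = "circlepath z e"
  let ?k = "\<lambda>x. f (?g x) / (?g x - s) * vector_derivative ?g (at x)"
  have on: "norm (?g x - z) = e" for x
    using e by (simp add: circlepath norm_mult)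
  have "norm (s - z) < e" using s e by simp
  from Cauchy_integral_circlepath_simple[OF f this]
  have Cauchy: "(?k has_integral (2 * of_real pi * \<i> * f s)) {0..1}"
    unfolding has_contour_integral .
  have "continuous_on {0..1} (\<lambda>x. norm (f (?g x)))"
    by (intro continuous_on_norm continuous_on_compose2[OF holomorphic_on_imp_continuous_on[OF f]])
       (use on in \<open>auto simp: circlepath dist_norm norm_minus_commute intro!: continuous_intros\<close>)
  hence integrable: "(\<lambda>x. 4 * pi * norm (f (?g x))) integrable_on {0..1}"
    by (intro integrable_continuous_real continuous_on_mult continuous_on_const)
  have le: "norm (?k x) \<le> 4 * pi * norm (f (?g x))" for x
  proof -
    have "norm (?g x - s) \<ge> norm (?g x - z) - norm (s - z)"
      using norm_triangle_ineq2[of "?g x - z" "s - z"] by simp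
    hence ge: "norm (?g x - s) \<ge> e / 2" using on[of x] s by linarith
    have "norm (vector_derivative ?g (at x)) = 2 * pi * e"
      using e by (simp add: vector_derivative_circlepath norm_mult)
    hence "norm (?k x) = norm (f (?g x)) * (2 * pi * e) / norm (?g x - s)"
      by (simp add: norm_mult norm_divide)
    also have "\<dots> \<le> norm (f (?g x)) * (2 * pi * e) / (e / 2)"
      using ge e by (intro divide_left_mono) (auto intro!: mult_pos_pos)
    also have "\<dots> = 4 * pi * norm (f (?g x))" using e by simp
    finally show ?thesis .
  qed
  have "norm (2 * of_real pi * \<i> * f s) \<le> integral {0..1} (\<lambda>x. 4 * pi * norm (f (?g x)))"
    using integral_norm_bound_integral[OF has_integral_integrable[OF Cauchy] integrable le]
    unfolding integral_unique[OF Cauchy] .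
  thus ?thesis by (simp add: norm_mult)
qed

definition circle_mean_square :: "complex set \<Rightarrow> real \<Rightarrow> (complex \<Rightarrow> complex) \<Rightarrow> real" where
  "circle_mean_square F e f = (\<Sum>z\<in>F. integral {0..1} (\<lambda>x. (norm (f (circlepath z e x)))\<^sup>2))"

lemma circlepath_in_cball: "e \<ge> 0 \<Longrightarrow> circlepath z e x \<in> cball z e"
  by (simp add: circlepath dist_norm norm_mult)

lemma continuous_on_circlepath: "continuous_on A (circlepath z e)"
  unfolding circlepath by (intro continuous_intros)

lemma circle_integral_nonneg:
  assumes "continuous_on (cball z e) f" "e \<ge> 0"
  shows "integral {0..1} (\<lambda>x. (norm (f (circlepath z e x)))\<^sup>2) \<ge> 0"
  using assms circlepath_in_cball
  by (intro integral_nonneg integrable_continuous_real continuous_on_power continuous_on_norm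
      continuous_on_compose2[OF assms(1) continuous_on_circlepath]) auto

lemma circle_mean_square_nonneg:
  assumes "\<And>z. z \<in> F \<Longrightarrow> continuous_on (cball z e) f" "e \<ge> 0"
  shows "circle_mean_square F e f \<ge> 0"
  unfolding circle_mean_square_def by (intro sum_nonneg circle_integral_nonneg assms)

lemma norm_square_le_circle_mean_square:
  assumes F: "finite F" and f: "\<And>z. z \<in> F \<Longrightarrow> f holomorphic_on cball z e" and e: "e > 0"
    and s: "s \<in> (\<Union>z\<in>F. cball z (e / 2))"
  shows "(norm (f s))\<^sup>2 \<le> 2 * circle_mean_square F e f"
proof -
  obtain z where z: "z \<in> F" "norm (s - z) \<le> e / 2"
    using s by (auto simp: dist_norm norm_minus_commute)
  have "(\<lambda>s. (f s)\<^sup>2) holomorphic_on cball z e" by (intro holomorphic_intros f z)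
  from norm_le_circle_integral[OF this e z(2)]
  have "(norm (f s))\<^sup>2 \<le> 2 * integral {0..1} (\<lambda>x. (norm (f (circlepath z e x)))\<^sup>2)"
    by (simp add: norm_power)
  also have "integral {0..1} (\<lambda>x. (norm (f (circlepath z e x)))\<^sup>2) \<le> circle_mean_square F e f"
    unfolding circle_mean_square_def using F z(1) e
    by (intro member_le_sum circle_integral_nonneg holomorphic_on_imp_continuous_on f) auto
  finally show ?thesis by simp
qed

lemma upper_mean_le_sum:
  assumes "finite J" "\<And>j. j \<in> J \<Longrightarrow> upper_mean_le X (f j) (\<eta> j)"
  shows "upper_mean_le X (\<lambda>x t. \<Sum>j\<in>J. f j x t) (\<Sum>j\<in>J. \<eta> j)"
  using assms
proof (induction J rule: finite_induct)
  case empty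
  show ?case by (simp add: upper_mean_le_def integrable_0)
next
  case (insert j J)
  thus ?case using upper_mean_le_add[of X "f j" "\<eta> j" "\<lambda>x t. \<Sum>j\<in>J. f j x t"] by simp
qed

lemma upper_mean_le_integral:
  fixes \<gamma> :: "real \<Rightarrow> 'x" and f :: "'x \<Rightarrow> real \<Rightarrow> real"
  assumes f: "upper_mean_le X f \<eta>" and \<gamma>: "\<And>x. \<gamma> x \<in> X"
    and cont: "continuous_on UNIV (\<lambda>(t, x). f (\<gamma> x) t)"
  shows "upper_mean_le Y (\<lambda>y t. integral {0..1} (\<lambda>x. f (\<gamma> x) t)) \<eta>"
  using f unfolding upper_mean_le_def
proof eventually_elim
  case (elim T)
  have cont_swap: "continuous_on UNIV (\<lambda>(x, t). f (\<gamma> x) t)"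
    using continuous_on_compose2[OF cont continuous_on_swap] by (simp add: case_prod_unfold)
  have "(\<lambda>t. integral (cbox 0 1) (\<lambda>x. f (\<gamma> x) t)) integrable_on cbox 0 T"
    by (intro integrable_continuous integral_continuous_on_param continuous_on_subset[OF cont]) auto
  moreover have "integral (cbox 0 T) (\<lambda>t. integral (cbox 0 1) (\<lambda>x. f (\<gamma> x) t)) =
      integral (cbox 0 1) (\<lambda>x. integral (cbox 0 T) (\<lambda>t. f (\<gamma> x) t))"
    by (intro integral_swap_continuous continuous_on_subset[OF cont]) auto
  moreover have "\<dots> \<le> integral (cbox 0 1) (\<lambda>x::real. \<eta> * T)"
    using elim \<gamma> by (intro integral_le integrable_continuous integral_continuous_on_param
        continuous_on_subset[OF cont_swap]) auto
  ultimately show ?case by simp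
qed

lemma upper_mean_le_circle_mean_square:
  assumes D: "upper_mean_le X (\<lambda>s t. W t * (norm (D t s))\<^sup>2) \<eta>" and W: "continuous_on UNIV W"
    and cont: "continuous_on (UNIV \<times> X) (\<lambda>(t, s). D t s)"
    and F: "finite F" "\<And>z. z \<in> F \<Longrightarrow> cball z e \<subseteq> X" and e: "e \<ge> 0"
  shows "upper_mean_le Y (\<lambda>y t. W t * circle_mean_square F e (D t)) (real (card F) * \<eta>)"
proof -
  have "upper_mean_le Y (\<lambda>y t. integral {0..1} (\<lambda>x. W t * (norm (D t (circlepath z e x)))\<^sup>2)) \<eta>" if z: "z \<in> F" for z
  proof (rule upper_mean_le_integral[OF D])
    show on: "circlepath z e x \<in> X" for x using circlepath_in_cball[OF e] F(2)[OF z] by blast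
    have "continuous_on UNIV (\<lambda>p. case (fst p, circlepath z e (snd p)) of (t, s) \<Rightarrow> D t s)"
      by (rule continuous_on_compose2[OF cont]) (use on in \<open>auto intro!: continuous_on_Pair continuous_on_fst
        continuous_on_id continuous_on_compose2[OF continuous_on_circlepath continuous_on_snd[OF continuous_on_id]]\<close>)
    moreover have "continuous_on UNIV (\<lambda>p::real \<times> real. W (fst p))"
      by (intro continuous_on_compose2[OF W] continuous_on_fst continuous_on_id) auto
    ultimately show "continuous_on UNIV (\<lambda>(t, x). W t * (norm (D t (circlepath z e x)))\<^sup>2)"
      unfolding case_prod_unfold fst_conv snd_conv by (intro continuous_intros)
  qed
  from upper_mean_le_sum[OF F(1) this] show ?thesis
    by (simp add: circle_mean_square_def sum_distrib_left)
qed

lemma SUP_ereal_less_iff: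
  fixes h :: "'a \<Rightarrow> real"
  shows "(SUP s\<in>K. ereal (h s)) < ereal \<epsilon> \<longleftrightarrow> (\<exists>n. \<forall>s\<in>K. h s \<le> \<epsilon> - 1 / real (Suc n))"
proof
  assume "(SUP s\<in>K. ereal (h s)) < ereal \<epsilon>"
  then obtain y where y: "(SUP s\<in>K. ereal (h s)) < ereal y" "ereal y < ereal \<epsilon>"
    using ereal_dense2 by blast
  obtain n where n: "1 / real (Suc n) < \<epsilon> - y" using nat_approx_posE[of "\<epsilon> - y"] y(2) by auto
  have "h s \<le> \<epsilon> - 1 / real (Suc n)" if "s \<in> K" for s
  proof -
    have "ereal (h s) \<le> ereal y"
      using SUP_upper[OF that, of "\<lambda>s. ereal (h s)"] y(1) by (meson less_imp_le order_trans)
    thus ?thesis using n by simp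
  qed
  thus "\<exists>n. \<forall>s\<in>K. h s \<le> \<epsilon> - 1 / real (Suc n)" by blast
next
  assume "\<exists>n. \<forall>s\<in>K. h s \<le> \<epsilon> - 1 / real (Suc n)"
  then obtain n where n: "\<And>s. s \<in> K \<Longrightarrow> h s \<le> \<epsilon> - 1 / real (Suc n)" by blast
  have "(SUP s\<in>K. ereal (h s)) \<le> ereal (\<epsilon> - 1 / real (Suc n))" by (rule SUP_least) (use n in auto)
  also have "\<dots> < ereal \<epsilon>" by simp
  finally show "(SUP s\<in>K. ereal (h s)) < ereal \<epsilon>" .
qed

lemma SUP_less_lmeasurable:
  fixes h :: "'a \<Rightarrow> real \<Rightarrow> real"
  assumes "\<And>s. s \<in> K \<Longrightarrow> continuous_on UNIV (h s)"
  shows "{\<tau> \<in> {0..T}. (SUP s\<in>K. ereal (h s \<tau>)) < ereal \<epsilon>} \<in> lmeasurable"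
proof -
  have "closed ({0..T} \<inter> (\<Inter>s\<in>K. {\<tau>. h s \<tau> \<le> c}))" for c
    by (intro closed_Int closed_INT ballI closed_Collect_le assms continuous_on_const) auto
  hence "(\<Union>n. {0..T} \<inter> (\<Inter>s\<in>K. {\<tau>. h s \<tau> \<le> \<epsilon> - 1 / real (Suc n)})) \<in> sets lebesgue"
    by (intro sets.countable_UN image_subsetI borel_closed[THEN sets_completionI_sets[of _ lborel, simplified]]) auto
  also have "(\<Union>n. {0..T} \<inter> (\<Inter>s\<in>K. {\<tau>. h s \<tau> \<le> \<epsilon> - 1 / real (Suc n)})) =
      {\<tau> \<in> {0..T}. (SUP s\<in>K. ereal (h s \<tau>)) < ereal \<epsilon>}"
    unfolding SUP_ereal_less_iff by auto
  finally show ?thesis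
    by (rule bounded_set_imp_lmeasurable[rotated]) (rule bounded_subset[of "{0..T}"], auto)
qed

lemma weighted_measure_lower_bound:
  fixes W \<Phi> :: "real \<Rightarrow> real"
  assumes W: "W integrable_on {0..T}" "\<And>t. 0 \<le> W t" "\<And>t. W t \<le> B"
    and \<Phi>: "(\<lambda>t. W t * \<Phi> t) integrable_on {0..T}" "\<And>t. \<Phi> t \<ge> 0" and \<delta>: "\<delta> > 0"
    and G: "G \<in> lmeasurable" "G \<subseteq> {0..T}" "\<And>t. t \<in> {0..T} \<Longrightarrow> \<Phi> t < \<delta> \<Longrightarrow> t \<in> G"
  shows "integral {0..T} W \<le> B * measure lebesgue G + integral {0..T} (\<lambda>t. W t * \<Phi> t) / \<delta>"
proof -
  have "((\<lambda>x. 1) has_integral measure lebesgue G) G"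
    using G(1) lmeasure_integral[OF G(1)] lmeasurable_iff_integrable_on[THEN iffD1, OF G(1)]
    by (simp only: has_integral_iff)
  hence "((\<lambda>t. if t \<in> G then 1 else 0) has_integral measure lebesgue G) {0..T}"
    by (subst has_integral_restrict[OF G(2)])
  hence "((\<lambda>t. B * (if t \<in> G then 1 else 0) + W t * \<Phi> t / \<delta>) has_integral
      (B * measure lebesgue G + integral {0..T} (\<lambda>t. W t * \<Phi> t) / \<delta>)) {0..T}"
    by (intro has_integral_add has_integral_mult_right has_integral_divide integrable_integral \<Phi>)
  moreover have "W t \<le> B * (if t \<in> G then 1 else 0) + W t * \<Phi> t / \<delta>" if t: "t \<in> {0..T}" for t
  proof (cases "t \<in> G")
    case True
    thus ?thesis using W(2,3)[of t] \<Phi>(2)[of t] \<delta> by (simp add: add_increasing2)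
  next
    case False
    hence "\<Phi> t \<ge> \<delta>" using G(3)[OF t] by force
    hence "W t * \<delta> \<le> W t * \<Phi> t" using W(2) by (intro mult_left_mono) auto
    thus ?thesis using False \<delta> by (simp add: field_simps)
  qed
  ultimately show ?thesis by (intro has_integral_le[OF integrable_integral[OF W(1)]]) auto
qed

definition positive_lower_density :: "(real \<Rightarrow> bool) \<Rightarrow> bool" where
  "positive_lower_density P \<longleftrightarrow> (\<exists>c>0. \<forall>\<^sub>F T in at_top. c * T \<le> measure lebesgue {t \<in> {0..T}. P t})"

lemma positive_lower_density_Liminf:
  assumes "positive_lower_density P"
  shows "Liminf at_top (\<lambda>T::real. ereal (1 / T * measure lebesgue {t \<in> {0..T}. P t})) > 0"
proof -
  obtain c where c: "c > 0" "\<forall>\<^sub>F T in at_top. c * T \<le> measure lebesgue {t \<in> {0..T}. P t}"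
    using assms unfolding positive_lower_density_def by blast
  have "\<forall>\<^sub>F T in at_top. ereal c \<le> ereal (1 / T * measure lebesgue {t \<in> {0..T}. P t})"
    using c(2) eventually_gt_at_top[of 0] by eventually_elim (simp add: field_simps)
  hence "ereal c \<le> Liminf at_top (\<lambda>T::real. ereal (1 / T * measure lebesgue {t \<in> {0..T}. P t}))"
    by (rule Liminf_bounded)
  moreover have "0 < ereal c" using c(1) by simp
  ultimately show ?thesis by (rule less_le_trans[rotated])
qed

lemma positive_lower_density_True: "positive_lower_density (\<lambda>t. True)"
proof -
  have "{t \<in> {0..T}. True} = {0..T}" for T :: real by auto
  hence "\<forall>\<^sub>F T in at_top. 1 * T \<le> measure lebesgue {t \<in> {0..T}. True}"
    by (intro eventually_mono[OF eventually_ge_at_top[of 0]]) simp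
  thus ?thesis unfolding positive_lower_density_def by (intro exI[of _ 1]) simp
qed

lemma positive_lower_density_stretch:
  assumes "positive_lower_density P" and b: "b > 0"
  shows "positive_lower_density (\<lambda>t. P (t / b))"
proof -
  obtain c where c: "c > 0" "\<forall>\<^sub>F T in at_top. c * T \<le> measure lebesgue {t \<in> {0..T}. P t}"
    using assms(1) unfolding positive_lower_density_def by blast
  have "filterlim (\<lambda>T. T / b) at_top at_top" using b by real_asymp
  from eventually_compose_filterlim[OF c(2) this]
  have "\<forall>\<^sub>F T in at_top. c * T \<le> measure lebesgue {t \<in> {0..T}. P (t / b)}"
  proof eventually_elim
    case (elim T)
    have "{t \<in> {0..T}. P (t / b)} = (\<lambda>t. b * t) ` {t \<in> {0..T / b}. P t}"
    proof (intro equalityI subsetI)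
      fix t assume "t \<in> {t \<in> {0..T}. P (t / b)}"
      hence "t / b \<in> {t \<in> {0..T / b}. P t}" using b by (auto simp: divide_right_mono)
      moreover have "t = b * (t / b)" using b by simp
      ultimately show "t \<in> (\<lambda>t. b * t) ` {t \<in> {0..T / b}. P t}" by blast
    qed (use b in \<open>auto simp: field_simps\<close>)
    hence "measure lebesgue {t \<in> {0..T}. P (t / b)} = b * measure lebesgue {t \<in> {0..T / b}. P t}"
      using measure_lebesgue_affine[of b 0 "{t \<in> {0..T / b}. P t}"] b by simp
    thus ?case using mult_left_mono[OF elim, of b] b by simp
  qed
  thus ?thesis using c(1) unfolding positive_lower_density_def by blast
qed

lemma positive_lower_density_weighted:
  fixes W \<Phi> :: "real \<Rightarrow> real"
  assumes W: "continuous_on UNIV W" "\<And>t. 0 \<le> W t" "\<And>t. W t \<le> B" "\<forall>\<^sub>F T in at_top. T / 2 \<le> integral {0..T} W"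
    and \<Phi>: "upper_mean_le {()} (\<lambda>_ t. W t * \<Phi> t) \<theta>" "\<And>t. \<Phi> t \<ge> 0" and \<delta>: "\<delta> > 0" "4 * \<theta> \<le> \<delta>"
    and P: "\<And>T. {t \<in> {0..T}. P t} \<in> lmeasurable" "\<And>t. \<Phi> t < \<delta> \<Longrightarrow> P t"
  shows "positive_lower_density P"
proof -
  have B: "B \<ge> 0" using W(2,3)[of 0] by linarith
  have "\<forall>\<^sub>F T in at_top. (1 / (4 * (B + 1))) * T \<le> measure lebesgue {t \<in> {0..T}. P t}"
    using W(4) \<Phi>(1) eventually_ge_at_top[of 0] unfolding upper_mean_le_def
  proof eventually_elim
    case (elim T)
    let ?m = "measure lebesgue {t \<in> {0..T}. P t}"
    have "integral {0..T} W \<le> B * ?m + integral {0..T} (\<lambda>t. W t * \<Phi> t) / \<delta>"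
      by (rule weighted_measure_lower_bound[OF _ W(2,3) _ \<Phi>(2) \<delta>(1) P(1)])
         (use elim P(2) integrable_continuous_real[OF continuous_on_subset[OF W(1)]] in auto)
    moreover have "integral {0..T} (\<lambda>t. W t * \<Phi> t) \<le> \<delta> / 4 * T"
      using elim \<delta>(2) mult_right_mono[of \<theta> "\<delta> / 4" T] by simp
    hence "integral {0..T} (\<lambda>t. W t * \<Phi> t) / \<delta> \<le> T / 4"
      using \<delta>(1) by (simp add: divide_le_eq mult.commute)
    ultimately have "T / 4 \<le> B * ?m" using elim(1) by linarith
    also have "\<dots> \<le> (B + 1) * ?m" by (intro mult_right_mono) auto
    finally show ?case using B by (simp add: field_simps)
  qed
  moreover have "1 / (4 * (B + 1)) > 0" using B by simp
  ultimately show ?thesis unfolding positive_lower_density_def by blast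
qed

lemma compact_finite_cball_cover:
  fixes K :: "'a::heine_borel set"
  assumes "compact K" "open U" "K \<subseteq> U"
  obtains F e where "finite F" "e > 0" "K \<subseteq> (\<Union>z\<in>F. cball z (e / 2))" "(\<Union>z\<in>F. cball z e) \<subseteq> U"
proof -
  obtain e where e: "e > 0" "(\<Union>z\<in>K. cball z e) \<subseteq> U"
    using compact_subset_open_imp_cball_epsilon_subset[OF assms] by blast
  obtain F where F: "F \<subseteq> K" "finite F" "K \<subseteq> (\<Union>z\<in>F. ball z (e / 2))"
  proof (rule compactE_image[OF assms(1), of K "\<lambda>z. ball z (e / 2)"])
    show "K \<subseteq> (\<Union>z\<in>K. ball z (e / 2))" using e(1) by force
  qed auto
  show thesis
  proof (rule that[OF F(2) e(1)])
    show "K \<subseteq> (\<Union>z\<in>F. cball z (e / 2))" using F(3) by force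
    show "(\<Union>z\<in>F. cball z e) \<subseteq> U" using F(1) e(2) by blast
  qed
qed

lemma open_strip_D: "open strip_D"
proof -
  have "strip_D = {s. Re s > 1 / 2} \<inter> {s. Re s < 1}" by (auto simp: strip_D_def)
  thus ?thesis using open_Int[OF open_halfspace_Re_gt[of "1 / 2"] open_halfspace_Re_lt[of 1]] by (simp only:)
qed

definition zeta_gap :: "real \<Rightarrow> real \<Rightarrow> real \<Rightarrow> complex \<Rightarrow> complex" where
  "zeta_gap a b t s = riemann_zeta (s + \<i> * of_real (a * t)) - riemann_zeta (s + \<i> * of_real (b * t))"

lemma continuous_on_zeta_gap:
  assumes "\<And>s. s \<in> X \<Longrightarrow> Re s < 1"
  shows "continuous_on (A \<times> X) (\<lambda>(t, s). zeta_gap a b t s)"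
proof -
  have "continuous_on (A \<times> X) (\<lambda>p. riemann_zeta (snd p + \<i> * of_real (c * fst p)))" for c
    by (intro continuous_on_compose2[OF holomorphic_on_imp_continuous_on[OF riemann_zeta_holomorphic]] continuous_intros)
       (auto simp: complex_eq_iff dest!: assms)
  thus ?thesis unfolding zeta_gap_def case_prod_unfold by (intro continuous_on_diff)
qed

lemma continuous_on_zeta_gap_line:
  assumes "Re s < 1"
  shows "continuous_on A (\<lambda>t. zeta_gap a b t s)"
  unfolding zeta_gap_def
  by (intro continuous_on_diff continuous_on_vertical_line riemann_zeta_holomorphic assms)

lemma zeta_gap_holomorphic:
  assumes "\<And>s. s \<in> X \<Longrightarrow> Re s < 1"
  shows "zeta_gap a b t holomorphic_on X"
proof -
  have "(riemann_zeta \<circ> (\<lambda>s. s + \<i> * of_real u)) holomorphic_on X" for u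
    by (intro holomorphic_on_compose_gen[OF _ riemann_zeta_holomorphic] holomorphic_intros)
       (auto simp: complex_eq_iff dest!: assms)
  thus ?thesis unfolding zeta_gap_def o_def by (intro holomorphic_on_diff)
qed

lemma weighted_zeta_gap_upper_mean:
  fixes a b :: int
  assumes ab: "\<bar>a - b\<bar> \<ge> 2" "gcd a b = 1" "a \<noteq> 0" "b \<noteq> 0"
    and X: "compact X" "X \<subseteq> strip_D" and \<eta>: "\<eta> > 0"
  obtains W G where "continuous_on UNIV W" "\<And>t. 0 \<le> W t" "\<And>t. W t \<le> G"
    "\<forall>\<^sub>F T in at_top. T / 2 \<le> integral {0..T} W"
    "upper_mean_le X (\<lambda>s t. W t * (norm (zeta_gap a b t s))\<^sup>2) \<eta>"
proof -
  have "\<eta> / 4 > 0" using \<eta> by simp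
  from weighted_zeta_common_approx[OF ab X this] obtain W G E where W: "continuous_on UNIV W" "\<And>t. 0 \<le> W t" "\<And>t. W t \<le> G"
    "\<forall>\<^sub>F T in at_top. T / 2 \<le> integral {0..T} W"
    and approx: "\<And>c. c \<in> {a, b} \<Longrightarrow> upper_mean_le X
       (\<lambda>s t. W t * (norm (riemann_zeta (s + \<i> * of_real (of_int c * t)) - E s))\<^sup>2) (\<eta> / 4)"
    by blast
  let ?f = "\<lambda>c s t. W t * (norm (riemann_zeta (s + \<i> * of_real (of_int c * t)) - E s))\<^sup>2"
  have "upper_mean_le X (\<lambda>s t. 2 * ?f a s t + 2 * ?f b s t) (2 * (\<eta> / 4) + 2 * (\<eta> / 4))"
    by (intro upper_mean_le_add upper_mean_le_cmult approx) auto
  hence "upper_mean_le X (\<lambda>s t. W t * (norm (zeta_gap a b t s))\<^sup>2) \<eta>"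
  proof (rule upper_mean_le_mono)
    fix s t
    let ?x = "\<lambda>c. riemann_zeta (s + \<i> * of_real (of_int c * t)) - E s"
    have "zeta_gap a b t s = ?x a + - ?x b" by (simp add: zeta_gap_def)
    hence "(norm (zeta_gap a b t s))\<^sup>2 \<le> 2 * (norm (?x a))\<^sup>2 + 2 * (norm (?x b))\<^sup>2"
      using power2_norm_add_le[of "?x a" "- ?x b"] by (simp only: norm_minus_cancel)
    from mult_left_mono[OF this W(2)]
    show "W t * (norm (zeta_gap a b t s))\<^sup>2 \<le> 2 * ?f a s t + 2 * ?f b s t"
      by (simp add: algebra_simps)
  next
    fix s T assume "s \<in> X"
    hence "Re s < 1" using X(2) by (auto simp: strip_D_def)
    thus "(\<lambda>t. W t * (norm (zeta_gap a b t s))\<^sup>2) integrable_on {0..T}"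
      by (intro integrable_continuous_real continuous_on_mult continuous_on_power continuous_on_norm
          continuous_on_subset[OF W(1)] continuous_on_zeta_gap_line) auto
  qed simp
  with W show thesis by (rule that)
qed

proposition zeta_gap_positive_lower_density:
  fixes a b :: int
  assumes ab: "\<bar>a - b\<bar> \<ge> 2" "gcd a b = 1" "a \<noteq> 0" "b \<noteq> 0"
    and K: "compact K" "K \<subseteq> strip_D" and \<epsilon>: "\<epsilon> > 0"
  shows "positive_lower_density (\<lambda>t. (SUP s\<in>K. ereal (norm (zeta_gap a b t s))) < ereal \<epsilon>)"
proof -
  obtain F e where F: "finite F" "e > 0" "K \<subseteq> (\<Union>z\<in>F. cball z (e / 2))" "(\<Union>z\<in>F. cball z e) \<subseteq> strip_D"
    using compact_finite_cball_cover[OF K(1) open_strip_D K(2)] .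
  define X where "X = (\<Union>z\<in>F. cball z e)"
  have X: "compact X" "X \<subseteq> strip_D" using F by (auto simp: X_def)
  have re: "Re s < 1" if "s \<in> X" for s using X(2) that by (auto simp: strip_D_def)
  define \<delta> where "\<delta> = \<epsilon>\<^sup>2 / 8"
  have \<delta>: "\<delta> > 0" using \<epsilon> by (simp add: \<delta>_def)
  define \<eta> where "\<eta> = \<delta> / (4 * (real (card F) + 1))"
  have \<eta>: "\<eta> > 0" "4 * (real (card F) * \<eta>) \<le> \<delta>"
    using \<delta> by (simp_all add: \<eta>_def field_simps add_pos_nonneg)
  from weighted_zeta_gap_upper_mean[OF ab X \<eta>(1)] obtain W G where
    W: "continuous_on UNIV W" "\<And>t. 0 \<le> W t" "\<And>t. W t \<le> G" "\<forall>\<^sub>F T in at_top. T / 2 \<le> integral {0..T} W"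
    and gap: "upper_mean_le X (\<lambda>s t. W t * (norm (zeta_gap a b t s))\<^sup>2) \<eta>"
    by blast
  define \<Phi> where "\<Phi> = (\<lambda>t. circle_mean_square F e (zeta_gap a b t))"
  have hol: "zeta_gap a b t holomorphic_on cball z e" if "z \<in> F" for z t
    using that re by (intro zeta_gap_holomorphic) (auto simp: X_def)
  show ?thesis
  proof (rule positive_lower_density_weighted[OF W _ _ \<delta> \<eta>(2)])
    show "upper_mean_le {()} (\<lambda>_ t. W t * \<Phi> t) (real (card F) * \<eta>)"
      unfolding \<Phi>_def using F re
      by (intro upper_mean_le_circle_mean_square[OF gap W(1) continuous_on_zeta_gap]) (auto simp: X_def)
    show "\<Phi> t \<ge> 0" for t
      unfolding \<Phi>_def using F(2)
      by (intro circle_mean_square_nonneg holomorphic_on_imp_continuous_on hol) auto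
    show "{t \<in> {0..T}. (SUP s\<in>K. ereal (norm (zeta_gap a b t s))) < ereal \<epsilon>} \<in> lmeasurable" for T
      by (intro SUP_less_lmeasurable continuous_on_norm continuous_on_zeta_gap_line) (use K(2) in \<open>auto simp: strip_D_def\<close>)
    fix t assume t: "\<Phi> t < \<delta>"
    have "norm (zeta_gap a b t s) \<le> \<epsilon> / 2" if "s \<in> K" for s
    proof (rule power2_le_imp_le)
      have "(norm (zeta_gap a b t s))\<^sup>2 \<le> 2 * \<Phi> t"
        unfolding \<Phi>_def by (rule norm_square_le_circle_mean_square[OF F(1) hol F(2) subsetD[OF F(3) that]])
      thus "(norm (zeta_gap a b t s))\<^sup>2 \<le> (\<epsilon> / 2)\<^sup>2" using t by (simp add: \<delta>_def power2_eq_square)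
    qed (use \<epsilon> in simp)
    hence "(SUP s\<in>K. ereal (norm (zeta_gap a b t s))) \<le> ereal (\<epsilon> / 2)" by (intro SUP_least) simp
    also have "\<dots> < ereal \<epsilon>" using \<epsilon> by simp
    finally show "(SUP s\<in>K. ereal (norm (zeta_gap a b t s))) < ereal \<epsilon>" .
  qed
qed

lemma zeta_gap_ratio_positive_lower_density:
  fixes a b :: int
  assumes "b \<noteq> 0" "a \<noteq> 0" and ab: "\<bar>a - b\<bar> \<noteq> 1" "gcd a b = 1"
    and K: "compact K" "K \<subseteq> strip_D" and \<epsilon>: "\<epsilon> > 0"
  shows "positive_lower_density (\<lambda>\<tau>. (SUP s\<in>K. ereal (norm (zeta_gap 1 (of_int a / of_int b) \<tau> s))) < ereal \<epsilon>)"
proof (cases "a = b")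
  case True
  have "(SUP s\<in>K. ereal 0) \<le> ereal 0" by (rule SUP_least) simp
  also have "\<dots> < ereal \<epsilon>" using \<epsilon> by simp
  finally show ?thesis using True \<open>b \<noteq> 0\<close> positive_lower_density_True by (simp add: zeta_gap_def)
next
  case False
  define \<alpha> where "\<alpha> = sgn b * a"
  define \<beta> where "\<beta> = \<bar>b\<bar>"
  have "\<alpha> - \<beta> = sgn b * (a - b)" by (simp add: \<alpha>_def \<beta>_def abs_sgn algebra_simps)
  hence "\<bar>\<beta> - \<alpha>\<bar> \<ge> 2" using ab(1) False \<open>b \<noteq> 0\<close> by (simp add: abs_minus_commute abs_mult abs_sgn_eq)
  moreover have "gcd \<beta> \<alpha> = 1" using ab(2) \<open>b \<noteq> 0\<close> by (simp add: \<alpha>_def \<beta>_def gcd.commute sgn_if)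
  moreover have "\<alpha> \<noteq> 0" "\<beta> \<noteq> 0" "real_of_int \<beta> > 0" using assms by (auto simp: \<alpha>_def \<beta>_def sgn_if)
  ultimately have "positive_lower_density (\<lambda>\<tau>. (SUP s\<in>K. ereal (norm (zeta_gap \<beta> \<alpha> (\<tau> / \<beta>) s))) < ereal \<epsilon>)"
    by (intro positive_lower_density_stretch zeta_gap_positive_lower_density K \<epsilon>) auto
  moreover have "zeta_gap \<beta> \<alpha> (\<tau> / \<beta>) = zeta_gap 1 (of_int a / of_int b) \<tau>" for \<tau>
    using \<open>b \<noteq> 0\<close> by (auto simp: zeta_gap_def \<alpha>_def \<beta>_def abs_if sgn_if)
  ultimately show ?thesis by simp
qed

theorem theorem3:
  fixes a b :: int and d :: real and K :: "complex set" and \<epsilon> :: real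
  assumes "b \<noteq> 0" and "d = real_of_int a / real_of_int b" and "d \<noteq> 0"
    and "\<bar>a - b\<bar> \<noteq> 1" and "gcd a b = 1"
    and "compact K" and "K \<subseteq> strip_D" and "\<epsilon> > 0"
  shows "Liminf at_top (\<lambda>T::real. ereal (1 / T * measure lebesgue
           {\<tau> \<in> {0..T}. (SUP s\<in>K. ereal (cmod (riemann_zeta (s + \<i> * of_real \<tau>)
              - riemann_zeta (s + \<i> * of_real (d * \<tau>))))) < ereal \<epsilon>})) > 0"
proof -
  have "a \<noteq> 0" using assms(2,3) by auto
  have "positive_lower_density (\<lambda>\<tau>. (SUP s\<in>K. ereal (norm (zeta_gap 1 d \<tau> s))) < ereal \<epsilon>)"
    unfolding assms(2) by (rule zeta_gap_ratio_positive_lower_density) (fact assms \<open>a \<noteq> 0\<close>)+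
  from positive_lower_density_Liminf[OF this] show ?thesis by (simp add: zeta_gap_def)
qed

end
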